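(* Let $u$ be a Dirichlet (or Neumann) eigenfunction of the Laplacian on $\mathcal{SG}$ with level of birth $m_0$, and let $E$ be an $m$-edge in $\mathcal{SG}$ with $m\ge m_0$ (with $m>m_0$ required if $u$ is a $6$-series eigenfunction). Suppose $u$ is non-constant on $E$, and let $\{\psi_n\}_{n\ge0}$ be the sequence of all eigenfunctions initialed from $u|_{V_m}$, ordered so that the corresponding eigenvalue is an increasing function of $n$. Let $\lambda_{m+1}^{(0)}=\frac{5-\sqrt{25-4\lambda_m}}2$ be the $(m+1)$-th graph eigenvalue of $\psi_0$, and let $N^E(\psi_n)$ be the number of local extrema of $\psi_n$ in $E$. Then $$N^E(\psi_n)=\begin{cases}2\left[\frac{n+1}2\right],&\text{if }\frac1{4-\lambda^{(0)}_{m+1}}<r^E(\psi_0)<4-\lambda^{(0)}_{m+1},\\ n,&\text{if }r^E(\psi_0)=\frac1{4-\lambda^{(0)}_{m+1}}\text{ or }4-\lambda^{(0)}_{m+1},\\ 2\left[\frac n2\right]+1,&\text{otherwise.}\end{cases}$$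
   Context: Sierpinski gasket. Let $q_0,q_1,q_2$ be the vertices of an equilateral triangle in $\mathbb{R}^2$, $F_i(x)=\frac12(x-q_i)+q_i$, and $\mathcal{SG}$ the attractor of $\{F_0,F_1,F_2\}$. Put $V_0=\{q_0,q_1,q_2\}$, $V_m=\bigcup_iF_iV_{m-1}$, $V_*=\bigcup_mV_m$; for a word $w=w_1\cdots w_m$, $w_i\in\{0,1,2\}$, $F_w=F_{w_1}\circ\cdots\circ F_{w_m}$, and $F_w\mathcal{SG}$ is an $m$-cell with boundary vertices $F_wV_0$. For $x\ne y$ in $V_m$, $x\sim_my$ iff $x,y\in F_wV_0$ for some $|w|=m$. An $m$-edge is a line segment joining two distinct boundary vertices of an $m$-cell. Laplacian. $\Delta_mu(x)=\sum_{y\sim_mx}(u(y)-u(x))$ for $x\in V_m\setminus V_0$, and $\Delta u(x)=\frac32\lim_{m\to\infty}5^m\Delta_mu(x)$, with $u\in\mathrm{dom}\,\Delta$ iff the limit converges uniformly on $V_*\setminus V_0$ to a continuous function. An eigenfunction is a non-zero (continuous) $u$ with $-\Delta u=\lambda u$. It is Dirichlet if $u|_{V_0}=0$ and Neumann if its normal derivatives $\lim_m(\frac53)^m\sum_{j\neq i}(u(q_i)-u(F_i^mq_j))$ vanish at each $q_i$ (in the Neumann case graph eigenvalue equations are also required at $q_i\in V_0$ by even reflection: $2\sum_{y\sim_mq_i}(u(q_i)-u(y))=\lambda_mu(q_i)$). Spectral decimation (known). For such an eigenfunction there is a minimal integer $m_0$ (level of birth) such that for all $m\ge m_0$, $u|_{V_m}$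 is an eigenfunction of $-\Delta_m$ with eigenvalue $\lambda_m$ (the $m$-th graph eigenvalue), where $\lambda_m=\lambda_{m+1}(5-\lambda_{m+1})$ and $\lambda=\frac32\lim_m5^m\lambda_m$. Thus $\lambda_{m+1}=\frac{5+\varepsilon_{m+1}\sqrt{25-4\lambda_m}}2$ with $\varepsilon_{m+1}=\pm1$ for $m\ge m_0$; $\{\varepsilon_m\}_{m>m_0}$ is the $\varepsilon$-sequence, with only finitely many $\varepsilon_m=1$. For non-constant Dirichlet/Neumann eigenfunctions $\lambda_{m_0}\in\{2,5,6\}$ ($2$-, $5$-, $6$-series), and $\lambda_{m_0+1}=3$ ($\varepsilon_{m_0+1}=1$) if $\lambda_{m_0}=6$. For $m\ge m_0$ and an $m$-cell with boundary vertices $p_0,p_1,p_2$, the local extension algorithm is $$u(p_{ij})=\frac{(4-\lambda_{m+1})(u(p_i)+u(p_j))+2u(p_k)}{(2-\lambda_{m+1})(5-\lambda_{m+1})},\quad \{i,j,k\}=\{0,1,2\},$$ where $p_{ij}$ is the midpoint of the edge joining $p_i,p_j$. Eigenfunctions initialed from $u|_{V_m}$: all eigenfunctions $\psi$ with $\psi|_{V_m}=u|_{V_m}$ and the same $\lambda_m$, obtained by choosing $\varepsilon_{m'}\in\{\pm1\}$ for $m'\ge m+1$, all but finitely many equal to $-1$, defining $\lambda_{m'}$ for $m'>m$ by the recursion $\lambda_{m'}=\frac{5+\varepsilon_{m'}\sqrt{25-4\lambda_{m'-1}}}2$, and extending successively to $V_{m+1},V_{m+2},\dots$ by the local extension algorithm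 (then to $\mathcal{SG}$ by continuity). $\psi_0$ is the one with $\varepsilon_{m'}=-1$ for all $m'\ge m+1$. Edges. For an $m$-edge $E$, let $p_0^E,p_1^E$ be its endpoints (in a fixed order) and $p_{01}^E$ its midpoint. For $f$ non-constant on $E$, $r^E(f)=\frac{f(p_1^E)-f(p_{01}^E)}{f(p_{01}^E)-f(p_0^E)}\in\mathbb{R}\cup\{\infty\}$, equal to $\infty$ (a single point at infinity) when $f(p_{01}^E)=f(p_0^E)$. Local extrema of $f$ in $E$ are local extrema of $f|_E$ at points of $E$ other than its endpoints. $[x]$ is the largest integer not exceeding $x$. *)

theory Defs
  imports "HOL-Analysis.Analysis"
begin

text \<open>Vertices are indexed by the three-element type \<^typ>\<open>3\<close>, and words over
  \<open>{0,1,2}\<close> are lists over it. Functions on the gasket are total functions on the plane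
  whose values off the gasket are irrelevant.\<close>

definition equilateral :: "(3 \<Rightarrow> real^2) \<Rightarrow> bool" where
  "equilateral q \<longleftrightarrow> (\<exists>d>0. \<forall>i j. i \<noteq> j \<longrightarrow> dist (q i) (q j) = d)"

definition SF :: "(3 \<Rightarrow> real^2) \<Rightarrow> 3 \<Rightarrow> real^2 \<Rightarrow> real^2" where
  "SF q i x = (1/2) *\<^sub>R (x - q i) + q i"

definition SF_attractor :: "(3 \<Rightarrow> real^2) \<Rightarrow> (real^2) set \<Rightarrow> bool" where
  "SF_attractor q K \<longleftrightarrow> compact K \<and> K \<noteq> {} \<and> K = (\<Union>i. SF q i ` K)"

definition SG :: "(3 \<Rightarrow> real^2) \<Rightarrow> (real^2) set" where
  "SG q = (THE K. SF_attractor q K)"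

primrec SFw :: "(3 \<Rightarrow> real^2) \<Rightarrow> 3 list \<Rightarrow> real^2 \<Rightarrow> real^2" where
  "SFw q [] = id"
| "SFw q (i # w) = SF q i \<circ> SFw q w"

primrec V :: "(3 \<Rightarrow> real^2) \<Rightarrow> nat \<Rightarrow> (real^2) set" where
  "V q 0 = range q"
| "V q (Suc m) = (\<Union>i. SF q i ` V q m)"

definition Vstar :: "(3 \<Rightarrow> real^2) \<Rightarrow> (real^2) set" where
  "Vstar q = (\<Union>m. V q m)"

text \<open>The definite description in \<^const>\<open>SG\<close> is well defined.\<close>

lemma dist_SF: "dist (SF q i x) (SF q i y) = dist x y / 2"
proof -
  have "SF q i x - SF q i y = (1/2) *\<^sub>R (x - y)" by (simp add: SF_def algebra_simps)
  then show ?thesis by (simp add: dist_norm)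
qed

lemma SF_attractor_subset:
  assumes K: "SF_attractor q K" and L: "SF_attractor q L"
  shows "K \<subseteq> L"
proof -
  have cK: "compact K" "K \<noteq> {}" and cL: "compact L" "L \<noteq> {}"
    using K L by (auto simp: SF_attractor_def)
  have "continuous_on K (\<lambda>x. infdist x L)" by (intro continuous_intros)
  then obtain x where x: "x \<in> K" "\<forall>y\<in>K. infdist y L \<le> infdist x L"
    using continuous_attains_sup[OF cK] by blast
  have "x \<in> (\<Union>i. SF q i ` K)" using K x unfolding SF_attractor_def by blast
  then obtain i y where y: "y \<in> K" "x = SF q i y" by blast
  obtain z where z: "z \<in> L" "infdist y L = dist y z"
    using infdist_attains_inf[OF compact_imp_closed[OF cL(1)] cL(2)] by blast
  have "SF q i z \<in> (\<Union>i. SF q i ` L)" using z by blast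
  then have "SF q i z \<in> L" using L unfolding SF_attractor_def by blast
  then have "infdist x L \<le> dist y z / 2"
    unfolding y(2) by (metis infdist_le dist_SF)
  then have "infdist x L \<le> infdist x L / 2" using x(2) y(1) z(2) by force
  then have "infdist v L = 0" if "v \<in> K" for v
    using x(2) that infdist_nonneg[of v L] by force
  then show ?thesis
    using cL by (simp add: in_closed_iff_infdist_zero compact_imp_closed subset_iff)
qed

lemma SF_continuous: "continuous_on S (SF q i)"
  unfolding SF_def by (intro continuous_intros)

lemma V_mono: "V q m \<subseteq> V q (Suc m)"
proof (induction m)
  case 0
  have "q i = SF q i (q i)" for i by (simp add: SF_def)
  then show ?case by auto
next
  case (Suc m)
  then show ?case by fastforce
qed

lemma Vstar_eq: "Vstar q = (\<Union>i. SF q i ` Vstar q)"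
proof -
  have "Vstar q = (\<Union>m. V q (Suc m))" unfolding Vstar_def using V_mono by blast
  also have "\<dots> = (\<Union>i. SF q i ` Vstar q)" unfolding Vstar_def by auto
  finally show ?thesis .
qed

lemma V_subset_hull: "V q m \<subseteq> convex hull (range q)"
proof (induction m)
  case 0 show ?case by (simp add: hull_subset)
next
  case (Suc m)
  have "SF q i x \<in> convex hull (range q)" if "x \<in> V q m" for i x
  proof -
    have "(1/2) *\<^sub>R x + (1/2) *\<^sub>R q i \<in> convex hull (range q)"
      by (rule convexD[OF convex_convex_hull]) (use that Suc in \<open>auto simp: hull_inc\<close>)
    moreover have "(1/2) *\<^sub>R x + (1/2) *\<^sub>R q i = SF q i x"
      by (simp add: SF_def vec_eq_iff field_simps)
    ultimately show ?thesis by simp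
  qed
  then show ?case by auto
qed

lemma SF_attractor_closure: "SF_attractor q (closure (Vstar q))"
proof -
  have "Vstar q \<subseteq> convex hull (range q)" unfolding Vstar_def using V_subset_hull by blast
  moreover have "compact (convex hull (range q))"
    by (intro compact_convex_hull finite_imp_compact finite_imageI) simp
  ultimately have "bounded (Vstar q)" using bounded_subset compact_imp_bounded by blast
  then have c: "compact (closure (Vstar q))" by simp
  have "range q \<subseteq> Vstar q" unfolding Vstar_def by (metis V.simps(1) UNIV_I UN_upper)
  then have ne: "closure (Vstar q) \<noteq> {}" by (simp add: closure_eq_empty) blast
  have "SF q i ` closure (Vstar q) = closure (SF q i ` Vstar q)" for i
  proof
    show "SF q i ` closure (Vstar q) \<subseteq> closure (SF q i ` Vstar q)"
      by (rule image_closure_subset[OF SF_continuous closed_closure closure_subset])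
    show "closure (SF q i ` Vstar q) \<subseteq> SF q i ` closure (Vstar q)"
      by (rule closure_minimal)
        (auto intro!: image_mono closure_subset compact_imp_closed compact_continuous_image SF_continuous c
          simp: closure_subset[THEN subsetD])
  qed
  then have im: "(\<Union>i. SF q i ` closure (Vstar q)) = (\<Union>i. closure (SF q i ` Vstar q))" by simp
  have "closure (\<Union>i. SF q i ` Vstar q) = (\<Union>i. closure (SF q i ` Vstar q))"
  proof
    have "(\<Union>i. SF q i ` Vstar q) \<subseteq> (\<Union>i. closure (SF q i ` Vstar q))"
      using closure_subset by fast
    then show "closure (\<Union>i. SF q i ` Vstar q) \<subseteq> (\<Union>i. closure (SF q i ` Vstar q))"
      by (rule closure_minimal) (simp add: closed_UN)
    show "(\<Union>i. closure (SF q i ` Vstar q)) \<subseteq> closure (\<Union>i. SF q i ` Vstar q)"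
      by (intro UN_least closure_mono UN_upper) simp
  qed
  then show ?thesis using c ne Vstar_eq[of q] im unfolding SF_attractor_def by simp
qed

lemma SF_attractor_iff: "SF_attractor q K \<longleftrightarrow> K = closure (Vstar q)"
  using SF_attractor_subset SF_attractor_closure by blast

lemma SG_eq_closure: "SG q = closure (Vstar q)"
  by (simp add: SG_def SF_attractor_iff)

lemma SF_attractor_SG: "SF_attractor q (SG q)"
  by (simp add: SF_attractor_iff SG_eq_closure)

text \<open>This is also the relation ``\<open>x\<close> and \<open>y\<close> are the endpoints of an \<open>m\<close>-edge''; the edge
  itself is \<^term>\<open>closed_segment x y\<close>.\<close>

definition adj :: "(3 \<Rightarrow> real^2) \<Rightarrow> nat \<Rightarrow> real^2 \<Rightarrow> real^2 \<Rightarrow> bool" where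
  "adj q m x y \<longleftrightarrow>
     x \<noteq> y \<and> (\<exists>w. length w = m \<and> x \<in> SFw q w ` range q \<and> y \<in> SFw q w ` range q)"

definition graph_laplacian ::
    "(3 \<Rightarrow> real^2) \<Rightarrow> nat \<Rightarrow> (real^2 \<Rightarrow> real) \<Rightarrow> real^2 \<Rightarrow> real" where
  "graph_laplacian q m u x = (\<Sum>y | adj q m x y. u y - u x)"

text \<open>\<open>has_laplacian q u f\<close> means that \<open>u\<close> is in the domain of the Laplacian, with
  \<open>\<Delta> u = f\<close>. The \<open>m\<close>-th graph Laplacian lives on \<open>V q m\<close> only, so a point
  \<open>x\<close> of \<^term>\<open>Vstar q\<close> takes part in the uniform convergence from the first \<open>m\<close>
  with \<open>x \<in> V q m\<close> on.\<close>

definition has_laplacian ::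
    "(3 \<Rightarrow> real^2) \<Rightarrow> (real^2 \<Rightarrow> real) \<Rightarrow> (real^2 \<Rightarrow> real) \<Rightarrow> bool" where
  "has_laplacian q u f \<longleftrightarrow>
     continuous_on (SG q) u \<and> continuous_on (SG q) f \<and>
     (\<forall>e>0. \<exists>N. \<forall>m\<ge>N. \<forall>x \<in> Vstar q - V q 0. x \<in> V q m \<longrightarrow>
        \<bar>3/2 * 5^m * graph_laplacian q m u x - f x\<bar> < e)"

definition eigenfunction ::
    "(3 \<Rightarrow> real^2) \<Rightarrow> (real^2 \<Rightarrow> real) \<Rightarrow> real \<Rightarrow> bool" where
  "eigenfunction q u L \<longleftrightarrow>
     (\<exists>x \<in> SG q. u x \<noteq> 0) \<and> has_laplacian q u (\<lambda>x. - L * u x)"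

datatype boundary_condition = Dirichlet | Neumann

fun satisfies_bc ::
    "(3 \<Rightarrow> real^2) \<Rightarrow> boundary_condition \<Rightarrow> (real^2 \<Rightarrow> real) \<Rightarrow> bool" where
  "satisfies_bc q Dirichlet u \<longleftrightarrow> (\<forall>i. u (q i) = 0)"
| "satisfies_bc q Neumann u \<longleftrightarrow>
     (\<forall>i. (\<lambda>m. (5/3)^m * (\<Sum>j \<in> UNIV - {i}. u (q i) - u ((SF q i ^^ m) (q j))))
            \<longlonglongrightarrow> 0)"

text \<open>In the Neumann case the equation at a boundary vertex comes from even reflection, which
  doubles each of its neighbours.\<close>

fun graph_bc ::
    "(3 \<Rightarrow> real^2) \<Rightarrow> boundary_condition \<Rightarrow> nat \<Rightarrow> (real^2 \<Rightarrow> real) \<Rightarrow> real \<Rightarrow> bool" where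
  "graph_bc q Dirichlet m u l \<longleftrightarrow> (\<forall>i. u (q i) = 0)"
| "graph_bc q Neumann m u l \<longleftrightarrow>
     (\<forall>i. 2 * (\<Sum>y | adj q m (q i) y. u (q i) - u y) = l * u (q i))"

definition graph_eigenfunction ::
    "(3 \<Rightarrow> real^2) \<Rightarrow> boundary_condition \<Rightarrow> nat \<Rightarrow> (real^2 \<Rightarrow> real) \<Rightarrow> real \<Rightarrow> bool" where
  "graph_eigenfunction q b m u l \<longleftrightarrow>
     (\<exists>x \<in> V q m. u x \<noteq> 0) \<and>
     (\<forall>x \<in> V q m - V q 0. - graph_laplacian q m u x = l * u x) \<and>
     graph_bc q b m u l"

text \<open>The recursion is part of the definition of the level of birth: a function of the
  6-series born at level \<open>m\<^sub>0\<close> may restrict to a graph eigenfunction on \<open>V q (m\<^sub>0 - 1)\<close> as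
  well, but then with an eigenvalue that violates the recursion.\<close>

definition graph_eigenvalues ::
    "(3 \<Rightarrow> real^2) \<Rightarrow> boundary_condition \<Rightarrow> (real^2 \<Rightarrow> real) \<Rightarrow> real \<Rightarrow> nat \<Rightarrow> (nat \<Rightarrow> real) \<Rightarrow> bool" where
  "graph_eigenvalues q b u L m0 l \<longleftrightarrow>
     (\<forall>m\<ge>m0. graph_eigenfunction q b m u (l m) \<and> l m = l (Suc m) * (5 - l (Suc m))) \<and>
     (\<lambda>m. 3/2 * 5^m * l m) \<longlonglongrightarrow> L"

definition level_of_birth ::
    "(3 \<Rightarrow> real^2) \<Rightarrow> boundary_condition \<Rightarrow> (real^2 \<Rightarrow> real) \<Rightarrow> real \<Rightarrow> nat \<Rightarrow> bool" where
  "level_of_birth q b u L m0 \<longleftrightarrow>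
     (\<exists>l. graph_eigenvalues q b u L m0 l) \<and>
     (\<forall>k<m0. \<not> (\<exists>l. graph_eigenvalues q b u L k l))"

definition local_extension ::
    "(3 \<Rightarrow> real^2) \<Rightarrow> nat \<Rightarrow> real \<Rightarrow> (real^2 \<Rightarrow> real) \<Rightarrow> bool" where
  "local_extension q m l u \<longleftrightarrow>
     (\<forall>w i j k. length w = m \<longrightarrow> distinct [i, j, k] \<longrightarrow>
        u (midpoint (SFw q w (q i)) (SFw q w (q j))) =
          ((4 - l) * (u (SFw q w (q i)) + u (SFw q w (q j))) + 2 * u (SFw q w (q k)))
            / ((2 - l) * (5 - l)))"

text \<open>\<open>initialed q m u l \<psi> L\<close>: \<open>\<psi>\<close> is an eigenfunction initialed from \<open>u\<close> restricted to
  \<open>V q m\<close>, where \<open>l\<close> is the \<open>m\<close>-th graph eigenvalue of \<open>u\<close>, and \<open>L\<close> is the eigenvalue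
  of \<open>\<psi>\<close>. The extension from \<^term>\<open>Vstar q\<close> to the gasket by continuity is expressed by
  the continuity contained in \<^const>\<open>eigenfunction\<close>.\<close>

definition initialed ::
    "(3 \<Rightarrow> real^2) \<Rightarrow> nat \<Rightarrow> (real^2 \<Rightarrow> real) \<Rightarrow> real \<Rightarrow> (real^2 \<Rightarrow> real) \<Rightarrow> real \<Rightarrow> bool" where
  "initialed q m u l \<psi> L \<longleftrightarrow>
     eigenfunction q \<psi> L \<and>
     (\<forall>x \<in> V q m. \<psi> x = u x) \<and>
     (\<exists>(\<epsilon> :: nat \<Rightarrow> real) \<mu>.
        (\<forall>k>m. \<epsilon> k \<in> {-1, 1}) \<and> finite {k. k > m \<and> \<epsilon> k \<noteq> -1} \<and>
        \<mu> m = l \<and>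
        (\<forall>k>m. \<mu> k = (5 + \<epsilon> k * sqrt (25 - 4 * \<mu> (k - 1))) / 2) \<and>
        (\<forall>k\<ge>m. local_extension q k (\<mu> (Suc k)) \<psi>))"

definition initialed_enumeration ::
    "(3 \<Rightarrow> real^2) \<Rightarrow> nat \<Rightarrow> (real^2 \<Rightarrow> real) \<Rightarrow> real \<Rightarrow> (nat \<Rightarrow> real^2 \<Rightarrow> real) \<Rightarrow> bool" where
  "initialed_enumeration q m u l \<psi> \<longleftrightarrow>
     (\<exists>L. strict_mono L \<and> (\<forall>n. initialed q m u l (\<psi> n) (L n))) \<and>
     (\<forall>\<phi> L. initialed q m u l \<phi> L \<longrightarrow> (\<exists>n. \<forall>x \<in> SG q. \<phi> x = \<psi> n x))"

text \<open>The single point at infinity of the projective line is represented by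
  \<open>\<infinity>\<close> in \<^typ>\<open>ereal\<close>; the value \<open>-\<infinity>\<close> does not occur.\<close>

definition edge_ratio :: "real^2 \<Rightarrow> real^2 \<Rightarrow> (real^2 \<Rightarrow> real) \<Rightarrow> ereal" where
  "edge_ratio p0 p1 f =
     (if f (midpoint p0 p1) = f p0 then \<infinity>
      else ereal ((f p1 - f (midpoint p0 p1)) / (f (midpoint p0 p1) - f p0)))"

definition edge_local_extrema :: "real^2 \<Rightarrow> real^2 \<Rightarrow> (real^2 \<Rightarrow> real) \<Rightarrow> (real^2) set" where
  "edge_local_extrema p0 p1 f =
     {x \<in> closed_segment p0 p1 - {p0, p1}. \<exists>d>0.
        (\<forall>y \<in> closed_segment p0 p1 \<inter> ball x d. f y \<le> f x) \<or>
        (\<forall>y \<in> closed_segment p0 p1 \<inter> ball x d. f x \<le> f y)}"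

end

theory Submission
  imports Defs
begin

text \<open>
  Give a cell with corner values \<open>f\<^sub>0, f\<^sub>1, f\<^sub>2\<close> at a level with graph
  eigenvalue \<open>x\<close> the discrete normal derivatives \<open>N\<^sub>i = (6 - x) f\<^sub>i - 2 (f\<^sub>0 + f\<^sub>1 + f\<^sub>2)\<close>; the graph
  eigenvalue equation at a point says that the normal derivatives of the two cells meeting there
  cancel. Under local extension with the next eigenvalue \<open>t\<close>, \<open>x = t (5 - t)\<close>, they transform very
  simply: at an old corner \<open>N\<^sub>i\<close> is multiplied by a number with the sign of \<open>2 - t\<close>, and at the
  midpoint of the edge from \<open>i\<close> to \<open>j\<close> the new one is a positive multiple of \<open>f\<^sub>i - f\<^sub>j\<close>, which in turn
  is \<open>(N\<^sub>i - N\<^sub>j) / (6 - x)\<close>. So the third corner drops out: along one edge everything is determined,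
  up to an additive constant, by the pair \<open>(X, Y) = (N\<^sub>0, -N\<^sub>1)\<close>, and halving the edge replaces it by
  \<open>(c X, M)\<close> and \<open>(M, c Y)\<close>, where \<open>M\<close> is a positive multiple of \<open>X + Y\<close> (\<open>edge_profile\<close>).

  The three cases of the theorem are \<open>X Y > 0\<close>, \<open>X Y = 0\<close> and \<open>X Y < 0\<close>
  (\<open>edge_ratio_classification\<close>). For a function that is not constant on the edge, the midpoint is a
  local extremum exactly when \<open>M = 0\<close> (\<open>midpoint_extremum_iff\<close>). If every later \<open>\<epsilon>\<close> is \<open>-1\<close>, all
  factors are positive, and the function is strictly monotone when \<open>X\<close> and \<open>Y\<close> have no opposite signs
  and has one extremum otherwise. A step with \<open>\<epsilon> = -1\<close> preserves the signs of \<open>X\<close> and \<open>Y\<close>, a step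
  with \<open>\<epsilon> = 1\<close> reverses both, and adding up the two halves gives a recursion for the number of
  extrema (\<open>extrema_count_rec\<close>).

  The recursion is solved by the formulas of the theorem because the increasing order of the
  eigenvalues is the reflected binary (Gray) order of the \<open>\<epsilon>\<close>-sequences: the branch with \<open>\<epsilon> = -1\<close>
  is increasing and the branch with \<open>\<epsilon> = 1\<close> decreasing in the previous eigenvalue, so the order is
  reversed once for every \<open>\<epsilon> = 1\<close> (\<open>decim_limit_mono\<close>, \<open>decim_limit_less_Suc\<close>). To identify \<open>\<psi>\<^sub>n\<close>
  with the \<open>n\<close>-th Gray sequence one also needs that every sequence is realised. Once
  \<open>t \<le> 1/2\<close> the normal derivatives, and with them the oscillation on cells, decay geometrically, so
  the values on \<^term>\<open>Vstar q\<close> extend continuously (\<open>ex_extension\<close>).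

  All of this requires \<open>0 < \<lambda>\<^sub>m < 6\<close> (\<open>eigenvalue_in_range\<close>). The bounds \<open>0 \<le> \<lambda>\<^sub>m \<le> 6\<close> are a maximum
  principle for the sums over cells, which form an eigenfunction of the graph whose vertices are
  the cells; and \<open>\<lambda>\<^sub>m = 0\<close> would make \<open>u\<close> constant.
\<close>

section \<open>Dynamics of spectral decimation\<close>

text \<open>The two inverse branches of \<open>y \<mapsto> y (5 - y)\<close>; the truth value says whether \<open>\<epsilon> = 1\<close>.\<close>

definition decim :: "bool \<Rightarrow> real \<Rightarrow> real" where
  "decim s x = (if s then (5 + sqrt (25 - 4 * x)) / 2 else (5 - sqrt (25 - 4 * x)) / 2)"

text \<open>Digits of the reflected binary code: digit \<open>j\<close> is the exclusive or of the binary digits \<open>j\<close> and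
  \<open>j + 1\<close> of \<open>n\<close>. Dropping the first digit of the code of \<open>n\<close> leaves the code of \<open>n div 2\<close>.\<close>

definition gray :: "nat \<Rightarrow> nat \<Rightarrow> bool" where
  "gray n j \<longleftrightarrow> (n div 2 ^ j) mod 4 \<in> {1, 2}"

primrec decim_seq :: "nat \<Rightarrow> real \<Rightarrow> nat \<Rightarrow> real" where
  "decim_seq n x 0 = x"
| "decim_seq n x (Suc j) = decim (gray n j) (decim_seq n x j)"

lemma gray_Suc: "gray n (Suc j) = gray (n div 2) j"
  by (simp add: gray_def div_mult2_eq)

lemma gray_0: "gray n 0 \<longleftrightarrow> n mod 4 \<in> {1, 2}"
  by (simp add: gray_def)

lemma gray_zero [simp]: "\<not> gray 0 j"
  by (simp add: gray_def)

text \<open>Consequently the parity of \<open>n\<close> is the parity of the number of digits that are set.\<close>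

lemma gray_parity: "gray n 0 \<longleftrightarrow> (even n \<noteq> even (n div 2))"
  unfolding gray_0 by simp presburger

lemma gray_finite: "finite {j. gray n j}"
proof (rule finite_subset)
  show "{j. gray n j} \<subseteq> {..<n}"
  proof
    fix j assume "j \<in> {j. gray n j}"
    then have "n div 2 ^ j \<noteq> 0" by (intro notI) (simp add: gray_def)
    then have "2 ^ j \<le> n" by (metis div_less not_le)
    moreover have "j < 2 ^ j" by (rule less_exp)
    ultimately have "j < n" by linarith
    then show "j \<in> {..<n}" by simp
  qed
qed simp

lemma gray_surj:
  assumes "\<And>j. j \<ge> K \<Longrightarrow> \<not> s j"
  shows "\<exists>n. \<forall>j. gray n j = s j"
  using assms
proof (induction K arbitrary: s)
  case 0
  then show ?case by (intro exI[of _ 0]) simp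
next
  case (Suc K)
  obtain n' where n': "\<And>j. gray n' j = s (Suc j)"
    using Suc.IH[of "\<lambda>j. s (Suc j)"] Suc.prems by auto
  define n where "n = 2 * n' + (if s 0 = even n' then 1 else 0)"
  have d: "n div 2 = n'" by (simp add: n_def)
  have "gray n j = s j" for j
  proof (cases j)
    case 0
    then show ?thesis by (auto simp: gray_parity d) (auto simp: n_def split: if_splits)
  next
    case (Suc i)
    then show ?thesis using n' by (simp add: gray_Suc d)
  qed
  then show ?case by blast
qed

lemma decim_seq_shift:
  "decim_seq n x (Suc j) = decim_seq (n div 2) (decim (gray n 0) x) j"
  by (induction j) (auto simp: gray_Suc)

lemma decim_eq:
  assumes "x \<le> 25/4"
  shows "decim s x * (5 - decim s x) = x"
proof -
  have "(sqrt (25 - 4 * x))\<^sup>2 = 25 - 4 * x" using assms by simp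
  then show ?thesis by (simp add: decim_def field_simps power2_eq_square)
qed

lemma sqrt_decim_bounds:
  assumes "0 < x" "x < 6"
  shows "1 < sqrt (25 - 4 * x)" "sqrt (25 - 4 * x) < 5"
proof -
  show "1 < sqrt (25 - 4 * x)" using assms by (intro real_less_rsqrt) simp
  show "sqrt (25 - 4 * x) < 5" using assms by (intro real_less_lsqrt) simp_all
qed

lemma decim_False_bounds:
  assumes "0 < x" "x < 6"
  shows "0 < decim False x" "decim False x < 2"
  using sqrt_decim_bounds[OF assms] by (auto simp: decim_def)

lemma decim_True_bounds:
  assumes "0 < x" "x < 6"
  shows "3 < decim True x" "decim True x < 5"
  using sqrt_decim_bounds[OF assms] by (auto simp: decim_def)

lemma decim_bounds:
  assumes "0 < x" "x < 6"
  shows "0 < decim s x" "decim s x < 5" "decim s x \<noteq> 2" "decim s x \<noteq> 3"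
  using decim_False_bounds[OF assms] decim_True_bounds[OF assms] by (cases s; auto)+

lemma decim_root:
  assumes "y * (5 - y) = x"
  shows "y = decim (y > 5/2) x"
proof -
  have "25 - 4 * x = (2 * y - 5)\<^sup>2" using assms by (simp add: power2_eq_square algebra_simps)
  then have "sqrt (25 - 4 * x) = \<bar>2 * y - 5\<bar>" by simp
  then show ?thesis by (auto simp: decim_def)
qed

lemma decim_seq_bounds:
  assumes "0 < x" "x < 6"
  shows "0 < decim_seq n x j" "decim_seq n x j < 6"
proof -
  have "0 < decim_seq n x j \<and> decim_seq n x j < 6"
  proof (induction j)
    case (Suc j)
    then show ?case
      using decim_bounds(1,2)[of "decim_seq n x j" "gray n j"] by auto
  qed (use assms in auto)
  then show "0 < decim_seq n x j" "decim_seq n x j < 6" by auto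
qed

text \<open>The increasing branch has slope at least \<open>1/5\<close>. This bound survives the passage to the limit and
  keeps the limit strictly increasing.\<close>

lemma decim_mono:
  assumes "x < y" "y < 6"
  shows "0 < x \<Longrightarrow> y - x \<le> 5 * (decim False y - decim False x)"
    and "decim False x < decim False y" and "decim True y < decim True x"
proof -
  have lt: "sqrt (25 - 4 * y) < sqrt (25 - 4 * x)" using assms by simp
  then show "decim False x < decim False y" "decim True y < decim True x"
    by (auto simp: decim_def)
  show "y - x \<le> 5 * (decim False y - decim False x)" if "0 < x"
  proof -
    have le: "sqrt (25 - 4 * y) + sqrt (25 - 4 * x) \<le> 10"
      using sqrt_decim_bounds[of x] sqrt_decim_bounds[of y] assms that by linarith
    have "(sqrt (25 - 4 * x) - sqrt (25 - 4 * y)) * (sqrt (25 - 4 * x) + sqrt (25 - 4 * y))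
        = (sqrt (25 - 4 * x))\<^sup>2 - (sqrt (25 - 4 * y))\<^sup>2"
      by (simp add: power2_eq_square algebra_simps)
    also have "\<dots> = 4 * (y - x)" using assms by simp
    finally have "4 * (y - x) \<le> (sqrt (25 - 4 * x) - sqrt (25 - 4 * y)) * 10"
      using le lt by (metis add.commute diff_ge_0_iff_ge less_imp_le mult_left_mono)
    then show ?thesis by (simp add: decim_def field_simps)
  qed
qed

lemma decim_seq_mono:
  assumes "0 < x" "x < y" "y < 6"
  shows "y - x \<le> 5 ^ j * (decim_seq 0 y j - decim_seq 0 x j)"
    and "decim_seq 0 x j < decim_seq 0 y j"
proof -
  have "y - x \<le> 5 ^ j * (decim_seq 0 y j - decim_seq 0 x j) \<and> decim_seq 0 x j < decim_seq 0 y j"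
  proof (induction j)
    case (Suc j)
    let ?x = "decim_seq 0 x j" and ?y = "decim_seq 0 y j"
    have b: "0 < ?x" "?y < 6"
      using decim_seq_bounds[of x] decim_seq_bounds[of y] assms by auto
    have "?y - ?x \<le> 5 * (decim False ?y - decim False ?x)"
      using decim_mono(1)[of ?x ?y] Suc b by simp
    then have "5 ^ j * (?y - ?x) \<le> 5 ^ j * (5 * (decim False ?y - decim False ?x))"
      by (rule mult_left_mono) simp
    also have "\<dots> = 5 ^ Suc j * (decim_seq 0 y (Suc j) - decim_seq 0 x (Suc j))" by simp
    finally have "5 ^ j * (?y - ?x) \<le> 5 ^ Suc j * (decim_seq 0 y (Suc j) - decim_seq 0 x (Suc j))" .
    then show ?case using Suc decim_mono(2)[of ?x ?y] b by (auto intro: order_trans)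
  qed (use assms in auto)
  then show "y - x \<le> 5 ^ j * (decim_seq 0 y j - decim_seq 0 x j)"
    "decim_seq 0 x j < decim_seq 0 y j" by auto
qed

text \<open>The function \<open>y \<mapsto> y / (1 - y / 12)\<close> dominates \<open>y\<close> and does not increase when \<open>y\<close> is replaced by the
  lower preimage and the result multiplied by \<open>5\<close>; it therefore bounds all \<open>5\<^sup>j \<lambda>\<^sub>j\<close> at once. The
  constant \<open>12\<close> is what \<open>5 - y \<ge> 3\<close>, valid for the lower branch, requires.\<close>

lemma decim_contract:
  assumes "0 < x" "x < 6"
  defines "y \<equiv> decim False x"
  shows "x \<le> 5 * y" "5 * (y / (1 - y / 12)) \<le> x / (1 - x / 12)"
proof -
  have x: "x = y * (5 - y)" using decim_eq[of x False] assms by simp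
  have y: "0 < y" "y < 2" using decim_False_bounds[OF assms(1,2)] by (auto simp: y_def)
  show "x \<le> 5 * y" using y by (simp add: x algebra_simps)
  have "x * (1 - y / 12) - 5 * y * (1 - x / 12) = y * y * (8 - 4 * y) / 12"
    by (simp add: x field_simps)
  moreover have "0 \<le> y * y * (8 - 4 * y)" using y by (intro mult_nonneg_nonneg) auto
  ultimately have "5 * y * (1 - x / 12) \<le> x * (1 - y / 12)" by simp
  then show "5 * (y / (1 - y / 12)) \<le> x / (1 - x / 12)"
    using assms y by (simp add: divide_simps mult.commute)
qed

lemma decim_seq_0_bounded:
  assumes "0 < x" "x < 6"
  shows "5 ^ j * decim_seq 0 x j \<le> 12"
proof -
  let ?g = "\<lambda>y::real. y / (1 - y / 12)"
  have *: "5 ^ j * ?g (decim_seq 0 x j) \<le> ?g x"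
  proof (induction j)
    case (Suc j)
    let ?x = "decim_seq 0 x j"
    have "5 * ?g (decim False ?x) \<le> ?g ?x"
      using decim_contract[of ?x] decim_seq_bounds[OF assms, of 0 j] by simp
    then have "5 ^ j * (5 * ?g (decim False ?x)) \<le> 5 ^ j * ?g ?x"
      by (rule mult_left_mono) simp
    then show ?case using Suc by (simp add: mult.assoc mult.left_commute)
  qed auto
  let ?y = "decim_seq 0 x j"
  have b: "0 < ?y" "?y < 6" using decim_seq_bounds[OF assms] by auto
  have "?y \<le> ?g ?y" using b by (simp add: divide_simps)
  then have "5 ^ j * ?y \<le> 5 ^ j * ?g ?y" by (rule mult_left_mono) simp
  also note *
  also have "?g x \<le> 12" using assms by (simp add: divide_simps)
  finally show ?thesis .
qed

text \<open>Up to the factor \<open>3/2 \<cdot> 5\<^sup>m\<close> this is the eigenvalue of the Laplacian that belongs to the \<open>n\<close>-th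
  sequence of signs, started from \<open>\<lambda>\<^sub>m = x\<close>.\<close>

definition decim_limit :: "nat \<Rightarrow> real \<Rightarrow> real" where
  "decim_limit n x = lim (\<lambda>j. 5 ^ j * decim_seq n x j)"

lemma decim_seq_renormalized_convergent:
  assumes "0 < x" "x < 6"
  shows "convergent (\<lambda>j. 5 ^ j * decim_seq n x j)"
  using assms
proof (induction n arbitrary: x rule: less_induct)
  case (less n)
  show ?case
  proof (cases "n = 0")
    case True
    \<comment> \<open>without upper branches the renormalised sequence increases and is bounded\<close>
    have "incseq (\<lambda>j. 5 ^ j * decim_seq 0 x j)"
    proof (rule incseq_SucI)
      fix j
      have "5 ^ j * decim_seq 0 x j \<le> 5 ^ j * (5 * decim False (decim_seq 0 x j))"
        using decim_contract(1) decim_seq_bounds[OF less.prems] by (intro mult_left_mono) auto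
      then show "5 ^ j * decim_seq 0 x j \<le> 5 ^ Suc j * decim_seq 0 x (Suc j)"
        by (simp add: mult.assoc mult.left_commute)
    qed
    moreover have "\<exists>B. \<forall>j. 5 ^ j * decim_seq 0 x j \<le> B"
      using decim_seq_0_bounded[OF less.prems] by blast
    ultimately show ?thesis unfolding True
      using incseq_convergent[of "\<lambda>j. 5 ^ j * decim_seq 0 x j"] convergentI by blast
  next
    case False
    let ?y = "decim (gray n 0) x"
    have "convergent (\<lambda>j. 5 ^ j * decim_seq (n div 2) ?y j)"
      using False decim_bounds[OF less.prems, of "gray n 0"] by (intro less.IH) auto
    then have "convergent (\<lambda>j. 5 * (5 ^ j * decim_seq (n div 2) ?y j))"
      unfolding convergent_def using tendsto_mult_left by blast
    then have "convergent (\<lambda>j. 5 ^ Suc j * decim_seq n x (Suc j))"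
      by (simp only: decim_seq_shift power_Suc mult.assoc)
    then show ?thesis by (simp only: convergent_Suc_iff[of "\<lambda>j. 5 ^ j * decim_seq n x j"])
  qed
qed

lemma decim_limit_tendsto:
  assumes "0 < x" "x < 6"
  shows "(\<lambda>j. 5 ^ j * decim_seq n x j) \<longlonglongrightarrow> decim_limit n x"
  unfolding decim_limit_def using decim_seq_renormalized_convergent[OF assms] by (simp add: convergent_LIMSEQ_iff)

lemma decim_limit_rec:
  assumes "0 < x" "x < 6"
  shows "decim_limit n x = 5 * decim_limit (n div 2) (decim (gray n 0) x)"
proof -
  let ?y = "decim (gray n 0) x"
  have "(\<lambda>j. 5 * (5 ^ j * decim_seq (n div 2) ?y j)) \<longlonglongrightarrow> 5 * decim_limit (n div 2) ?y"
    using decim_bounds[OF assms, of "gray n 0"] by (intro tendsto_mult_left decim_limit_tendsto) auto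
  then have "(\<lambda>j. 5 ^ Suc j * decim_seq n x (Suc j)) \<longlonglongrightarrow> 5 * decim_limit (n div 2) ?y"
    by (simp only: decim_seq_shift power_Suc mult.assoc)
  then have "(\<lambda>j. 5 ^ j * decim_seq n x j) \<longlonglongrightarrow> 5 * decim_limit (n div 2) ?y"
    by (simp only: filterlim_sequentially_Suc[of "\<lambda>j. 5 ^ j * decim_seq n x j"])
  with decim_limit_tendsto[OF assms] show ?thesis by (rule LIMSEQ_unique)
qed

text \<open>Each digit that is set contributes one decreasing branch, and by \<open>gray_parity\<close> their number has
  the parity of \<open>n\<close>.\<close>

lemma decim_limit_mono:
  assumes "0 < x" "x < y" "y < 6"
  shows "if even n then decim_limit n x < decim_limit n y else decim_limit n y < decim_limit n x"
  using assms
proof (induction n arbitrary: x y rule: less_induct)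
  case (less n)
  show ?case
  proof (cases "n = 0")
    case True
    have "y - x \<le> decim_limit 0 y - decim_limit 0 x"
    proof (rule tendsto_lowerbound)
      show "(\<lambda>j. 5 ^ j * decim_seq 0 y j - 5 ^ j * decim_seq 0 x j) \<longlonglongrightarrow> decim_limit 0 y - decim_limit 0 x"
        using less.prems by (intro tendsto_diff decim_limit_tendsto) auto
      show "\<forall>\<^sub>F j in sequentially. y - x \<le> 5 ^ j * decim_seq 0 y j - 5 ^ j * decim_seq 0 x j"
        using decim_seq_mono[OF less.prems] by (simp add: algebra_simps)
    qed auto
    then show ?thesis using True less.prems by simp
  next
    case False
    have x: "0 < x" "x < 6" and y: "0 < y" "y < 6" using less.prems by auto
    have b: "0 < decim s x" "decim s x < 6" "0 < decim s y" "decim s y < 6" for s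
      using decim_bounds[OF x, of s] decim_bounds[OF y, of s] by auto
    have IH: "if even (n div 2) then decim_limit (n div 2) x' < decim_limit (n div 2) y'
        else decim_limit (n div 2) y' < decim_limit (n div 2) x'" if "0 < x'" "x' < y'" "y' < 6" for x' y'
      using less.IH[of "n div 2" x' y'] that False by simp
    show ?thesis
    proof (cases "gray n 0")
      case True
      then have "even n \<noteq> even (n div 2)" by (simp add: gray_parity)
      then show ?thesis
        using IH[of "decim True y" "decim True x"] decim_mono(3)[OF less.prems(2,3)] b[of True]
        by (auto simp: decim_limit_rec[OF x, of n] decim_limit_rec[OF y, of n] True)
    next
      case F: False
      then have "even n = even (n div 2)" by (simp add: gray_parity)
      then show ?thesis
        using IH[of "decim False x" "decim False y"] decim_mono(2)[OF less.prems(2,3)] b[of False]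
        by (auto simp: decim_limit_rec[OF x, of n] decim_limit_rec[OF y, of n] F)
    qed
  qed
qed

text \<open>This is where the Gray code comes in. If \<open>n\<close> is even, the codes of \<open>n\<close> and \<open>n + 1\<close> differ in the
  first digit only, and the monotonicity of the remaining branches decides; if \<open>n\<close> is odd, they share
  the first digit, and the comparison is inherited from \<open>n div 2\<close> and \<open>n div 2 + 1\<close>.\<close>

lemma decim_limit_less_Suc:
  assumes "0 < x" "x < 6"
  shows "decim_limit n x < decim_limit (Suc n) x"
  using assms
proof (induction n arbitrary: x rule: less_induct)
  case (less n)
  have b: "0 < decim s x" "decim s x < 6" for s
    using decim_bounds[OF less.prems, of s] by auto
  have lt: "decim False x < decim True x"
    using decim_False_bounds[OF less.prems] decim_True_bounds[OF less.prems] by simp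
  note rec = decim_limit_rec[OF less.prems, of n] decim_limit_rec[OF less.prems, of "Suc n"]
  show ?case
  proof (cases "even n")
    case True
    then have d: "Suc n div 2 = n div 2" by simp
    have g: "gray n 0 \<longleftrightarrow> odd (n div 2)" "gray (Suc n) 0 \<longleftrightarrow> even (n div 2)"
      using True by (simp_all add: gray_parity d)
    show ?thesis
      using decim_limit_mono[OF b(1)[of False] lt b(2)[of True], of "n div 2"]
      by (cases "even (n div 2)") (auto simp: rec d g)
  next
    case False
    then have d: "Suc n div 2 = Suc (n div 2)" by simp
    have g: "gray (Suc n) 0 \<longleftrightarrow> gray n 0" using False by (simp add: gray_parity d)
    have "n div 2 < n" using False by (intro div_less_dividend) (auto intro: gr0I)
    then show ?thesis using less.IH[of "n div 2", OF _ b] by (simp add: rec d g)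
  qed
qed

lemma strict_mono_decim_limit:
  assumes "0 < x" "x < 6"
  shows "strict_mono (\<lambda>n. decim_limit n x)"
  using decim_limit_less_Suc[OF assms] by (simp add: strict_mono_Suc_iff)

section \<open>Profiles of eigenfunctions along an edge\<close>

text \<open>How the normal derivatives of a cell change under extension with the next eigenvalue \<open>t\<close>: at the
  old corners by \<open>corner_factor t\<close> (\<open>normal_deriv_subcell_same\<close>), while \<open>mid_factor t\<close> turns a difference of
  corner values into the normal derivative at the midpoint (\<open>normal_deriv_subcell_mid\<close>).\<close>

definition corner_factor :: "real \<Rightarrow> real" where
  "corner_factor t = (6 - t) / ((5 - t) * (2 - t))"

definition mid_factor :: "real \<Rightarrow> real" where
  "mid_factor t = (6 - t) / (5 - t)"

text \<open>The restriction of an eigenfunction to an edge, parametrised by \<open>[0, 1]\<close>, as a self-similar object: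
  \<open>X\<close> and \<open>- Y\<close> are the normal derivatives at the two ends, \<open>x\<close> is the graph eigenvalue at the level of
  the edge, and \<open>n\<close> encodes the signs that follow. Coinduction fits because the description refers to
  all finer levels and never reaches a last one.\<close>

coinductive edge_profile :: "nat \<Rightarrow> real \<Rightarrow> real \<Rightarrow> real \<Rightarrow> (real \<Rightarrow> real) \<Rightarrow> bool" where
  "t = decim (gray n 0) x \<Longrightarrow> g 0 - g 1 = (X + Y) / (6 - x) \<Longrightarrow> M = mid_factor t * (g 0 - g 1) \<Longrightarrow>
   edge_profile (n div 2) t (corner_factor t * X) M (\<lambda>s. g (s / 2)) \<Longrightarrow>
   edge_profile (n div 2) t M (corner_factor t * Y) (\<lambda>s. g ((s + 1) / 2)) \<Longrightarrow>
   edge_profile n x X Y g"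

definition local_extrema01 :: "(real \<Rightarrow> real) \<Rightarrow> real set" where
  "local_extrema01 g = {s. 0 < s \<and> s < 1 \<and> (\<exists>d>0.
     (\<forall>y. 0 \<le> y \<and> y \<le> 1 \<and> \<bar>y - s\<bar> < d \<longrightarrow> g y \<le> g s) \<or>
     (\<forall>y. 0 \<le> y \<and> y \<le> 1 \<and> \<bar>y - s\<bar> < d \<longrightarrow> g s \<le> g y))}"

lemma six_minus:
  assumes "0 < x" "x < 6" and "t = decim s x"
  shows "6 - x = (2 - t) * (3 - t)"
  using decim_eq[of x s] assms by (simp add: algebra_simps)

lemma factor_signs:
  assumes "0 < x" "x < 6" and "t = decim s x"
  shows "mid_factor t > 0" and "corner_factor t \<noteq> 0" and "corner_factor t > 0 \<longleftrightarrow> \<not> s"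
    and "corner_factor t < 0 \<longleftrightarrow> s"
proof -
  note b = decim_bounds[OF assms(1,2), of s, folded assms(3)]
  show "mid_factor t > 0" using b by (simp add: mid_factor_def)
  have *: "corner_factor t = ((6 - t) / (5 - t)) / (2 - t)" by (simp add: corner_factor_def)
  have p: "(6 - t) / (5 - t) > 0" using b by simp
  show "corner_factor t \<noteq> 0" "corner_factor t > 0 \<longleftrightarrow> \<not> s" "corner_factor t < 0 \<longleftrightarrow> s"
    using p decim_False_bounds[OF assms(1,2)] decim_True_bounds[OF assms(1,2)] assms(3)
    unfolding * by (cases s; simp add: zero_less_divide_iff divide_less_0_iff del: divide_divide_eq_left)+
qed

text \<open>The normal derivative \<open>M\<close> at the midpoint is written in two ways: as a positive multiple \<open>k\<close> of
  \<open>X + Y\<close>, which is what sign arguments use, and relative to \<open>c\<close>, which compares its size with that of the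
  new end values \<open>c * X\<close> and \<open>c * Y\<close>.\<close>

lemma edge_profileE:
  assumes "edge_profile n x X Y g" "0 < x" "x < 6"
  obtains t c M k where "t = decim (gray n 0) x" "0 < t" "t < 6" "c = corner_factor t"
    "c > 0 \<longleftrightarrow> \<not> gray n 0" "c < 0 \<longleftrightarrow> gray n 0" "k > 0" "M = k * (X + Y)" 
    "M = c * (X + Y) / (3 - t)"
    "g 0 - g 1 = (X + Y) / (6 - x)"
    "edge_profile (n div 2) t (c * X) M (\<lambda>s. g (s / 2))"
    "edge_profile (n div 2) t M (c * Y) (\<lambda>s. g ((s + 1) / 2))"
proof -
  from assms(1) obtain t M where h: "t = decim (gray n 0) x" "g 0 - g 1 = (X + Y) / (6 - x)"
     "M = mid_factor t * (g 0 - g 1)"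
     "edge_profile (n div 2) t (corner_factor t * X) M (\<lambda>s. g (s / 2))"
     "edge_profile (n div 2) t M (corner_factor t * Y) (\<lambda>s. g ((s + 1) / 2))"
    by (cases rule: edge_profile.cases) blast
  note b = decim_bounds[OF assms(2,3), of "gray n 0", folded h(1)]
  note f = factor_signs[OF assms(2,3) h(1)]
  have k: "mid_factor t / (6 - x) > 0" using f(1) assms by simp
  have M: "M = mid_factor t / (6 - x) * (X + Y)" using h(2,3) by simp
  have M': "M = corner_factor t * (X + Y) / (3 - t)"
    unfolding M six_minus[OF assms(2,3) h(1)] mid_factor_def corner_factor_def by simp
  show thesis
    by (rule that[OF h(1) _ _ refl f(3) f(4) k M M' h(2) h(4) h(5)]) (use b in auto)
qed

lemma edge_profile_coinductI:
  assumes "R n x X Y g"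
    and "\<And>n x X Y g. R n x X Y g \<Longrightarrow> g 0 - g 1 = (X + Y) / (6 - x) \<and>
      (\<exists>t M. t = decim (gray n 0) x \<and> M = mid_factor t * (g 0 - g 1) \<and>
        R (n div 2) t (corner_factor t * X) M (\<lambda>s. g (s / 2)) \<and>
        R (n div 2) t M (corner_factor t * Y) (\<lambda>s. g ((s + 1) / 2)))"
  shows "edge_profile n x X Y g"
  using assms(1)
proof (rule edge_profile.coinduct[of R], goal_cases)
  case (1 n x X Y g)
  from assms(2)[OF this] obtain t M where h: "g 0 - g 1 = (X + Y) / (6 - x)" "t = decim (gray n 0) x"
    "M = mid_factor t * (g 0 - g 1)" "R (n div 2) t (corner_factor t * X) M (\<lambda>s. g (s / 2))"
    "R (n div 2) t M (corner_factor t * Y) (\<lambda>s. g ((s + 1) / 2))" by blast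
  show ?case
    by (intro exI[of _ t] exI[of _ n] exI[of _ x] exI[of _ g] exI[of _ X] exI[of _ Y] exI[of _ M])
      (use h in simp)
qed

lemma edge_profile_uminus:
  assumes "edge_profile n x X Y g"
  shows "edge_profile n x (- X) (- Y) (\<lambda>s. - g s)"
proof (rule edge_profile_coinductI[of "\<lambda>n x X Y g. edge_profile n x (- X) (- Y) (\<lambda>s. - g s)"], goal_cases)
  case (2 n x X Y g)
  then obtain t M where h: "t = decim (gray n 0) x" "- g 0 - - g 1 = (- X + - Y) / (6 - x)"
     "M = mid_factor t * (- g 0 - - g 1)"
     "edge_profile (n div 2) t (corner_factor t * - X) M (\<lambda>s. - g (s / 2))"
     "edge_profile (n div 2) t M (corner_factor t * - Y) (\<lambda>s. - g ((s + 1) / 2))"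
    by (cases rule: edge_profile.cases) blast
  have "g 0 - g 1 = (X + Y) / (6 - x)"
    using h(2) by (simp add: diff_divide_distrib add_divide_distrib)
  moreover have "M = - (mid_factor t * (g 0 - g 1))" using h(3) by (simp add: algebra_simps)
  ultimately show ?case
    using h(1,4,5) by (intro conjI, simp) (rule exI[of _ t], rule exI[of _ "- M"], simp)
qed (use assms in simp)

lemma edge_profile_reverse:
  assumes "edge_profile n x X Y g"
  shows "edge_profile n x (- Y) (- X) (\<lambda>s. g (1 - s))"
proof (rule edge_profile_coinductI[of "\<lambda>n x X Y g. edge_profile n x (- Y) (- X) (\<lambda>s. g (1 - s))"], goal_cases)
  case (2 n x X Y g)
  then obtain t M where h: "t = decim (gray n 0) x" "g (1 - 0) - g (1 - 1) = (- Y + - X) / (6 - x)"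
     "M = mid_factor t * (g (1 - 0) - g (1 - 1))"
     "edge_profile (n div 2) t (corner_factor t * - Y) M (\<lambda>s. g (1 - s / 2))"
     "edge_profile (n div 2) t M (corner_factor t * - X) (\<lambda>s. g (1 - (s + 1) / 2))"
    by (cases rule: edge_profile.cases) blast
  have e: "(\<lambda>s. g ((1 - s + 1) / 2)) = (\<lambda>s. g (1 - s / 2))"
    "(\<lambda>s. g ((1 - s) / 2)) = (\<lambda>s. g (1 - (s + 1) / 2))"
    by (intro ext arg_cong[of _ _ g]; simp add: field_simps)+
  have "g 0 - g 1 = (X + Y) / (6 - x)"
    using h(2) by (simp add: diff_divide_distrib add_divide_distrib)
  moreover have "M = - (mid_factor t * (g 0 - g 1))" using h(3) by (simp add: algebra_simps)
  ultimately show ?case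
    unfolding e using h(1,4,5) by (intro conjI, simp) (rule exI[of _ t], rule exI[of _ "- M"], simp)
qed (use assms in simp)

text \<open>Profiles only see dyadic points; rounding down at every level reaches all others in the limit.\<close>

definition dyadic_floor :: "nat \<Rightarrow> real \<Rightarrow> nat" where
  "dyadic_floor d s = nat \<lfloor>s * 2 ^ d\<rfloor>"

lemma dyadic_floor_tendsto:
  assumes "0 \<le> s"
  shows "(\<lambda>d. real (dyadic_floor d s) / 2 ^ d) \<longlonglongrightarrow> s"
proof (rule LIMSEQ_I)
  fix r :: real assume "0 < r"
  then obtain N where N: "(1/2::real) ^ N < r" using real_arch_pow_inv[of r "1/2"] by auto
  have "norm (real (dyadic_floor d s) / 2 ^ d - s) < r" if "d \<ge> N" for d
  proof -
    have "0 \<le> s * 2 ^ d" using assms by simp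
    then have "real (dyadic_floor d s) \<le> s * 2 ^ d" "s * 2 ^ d < real (dyadic_floor d s) + 1"
      unfolding dyadic_floor_def by linarith+
    then have "\<bar>real (dyadic_floor d s) - s * 2 ^ d\<bar> / 2 ^ d \<le> 1 / 2 ^ d"
      by (intro divide_right_mono) auto
    moreover have "real (dyadic_floor d s) / 2 ^ d - s = (real (dyadic_floor d s) - s * 2 ^ d) / 2 ^ d"
      by (simp add: field_simps)
    ultimately have "\<bar>real (dyadic_floor d s) / 2 ^ d - s\<bar> \<le> (1/2) ^ d"
      by (simp add: power_one_over)
    also have "\<dots> \<le> (1/2) ^ N" using that by (intro power_decreasing) auto
    finally show ?thesis using N by simp
  qed
  then show "\<exists>N. \<forall>d\<ge>N. norm (real (dyadic_floor d s) / 2 ^ d - s) < r" by blast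
qed

lemma dyadic_floor_le:
  assumes "0 \<le> s" "s \<le> 1"
  shows "dyadic_floor d s \<le> 2 ^ d" "real (dyadic_floor d s) / 2 ^ d \<in> {0..1}"
proof -
  have "s * 2 ^ d \<le> 2 ^ d" using assms by auto
  then have "\<lfloor>s * 2 ^ d\<rfloor> \<le> \<lfloor>(2::real) ^ d\<rfloor>" by (rule floor_mono)
  then show le: "dyadic_floor d s \<le> 2 ^ d" unfolding dyadic_floor_def
    by (simp add: nat_le_iff floor_numeral_power)
  have "real (dyadic_floor d s) \<le> 2 ^ d" using le by (simp flip: of_nat_le_iff)
  then show "real (dyadic_floor d s) / 2 ^ d \<in> {0..1}" by simp
qed

lemma dyadic_floor_limit:
  fixes g :: "real \<Rightarrow> real"
  assumes "continuous_on {0..1} g" "0 \<le> s" "s \<le> 1"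
  shows "(\<lambda>d. g (real (dyadic_floor d s) / 2 ^ d)) \<longlonglongrightarrow> g s"
  by (rule continuous_on_tendsto_compose[OF assms(1) dyadic_floor_tendsto])
    (use assms dyadic_floor_le in auto)

text \<open>To keep the inequality strict in the limit, two neighbouring dyadic points are placed between the
  points to be compared.\<close>

lemma dyadic_strict_antimono:
  fixes g :: "real \<Rightarrow> real"
  assumes cont: "continuous_on {0..1} g"
    and step: "\<And>d p. p < 2 ^ d \<Longrightarrow> g (real (Suc p) / 2 ^ d) < g (real p / 2 ^ d)"
  shows "strict_antimono_on {0..1} g"
proof (rule monotone_onI)
  have same: "p < p' \<Longrightarrow> p' \<le> 2 ^ d \<Longrightarrow> g (real p' / 2 ^ d) < g (real p / 2 ^ d)" for p p' d
  proof (induction p')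
    case (Suc p')
    then show ?case using step[of p' d] by (cases "p = p'") force+
  qed simp
  have weak: "g s' \<le> g s" if s: "0 \<le> s" "s \<le> s'" "s' \<le> 1" for s s'
  proof (rule LIMSEQ_le[OF dyadic_floor_limit[OF cont] dyadic_floor_limit[OF cont]])
    have "dyadic_floor d s \<le> dyadic_floor d s'" for d
      unfolding dyadic_floor_def using s(2) by (intro nat_mono floor_mono) simp
    moreover have "dyadic_floor d s' \<le> 2 ^ d" for d using s by (intro dyadic_floor_le) auto
    ultimately show "\<exists>N. \<forall>d\<ge>N. g (real (dyadic_floor d s') / 2 ^ d) \<le> g (real (dyadic_floor d s) / 2 ^ d)"
      using same by (metis le_neq_implies_less less_imp_le order_refl)
  qed (use s in auto)
  fix s s' :: real assume s: "s \<in> {0..1}" "s' \<in> {0..1}" "s < s'"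
  obtain D where D: "(1/2::real) ^ D < (s' - s) / 2"
    using real_arch_pow_inv[of "(s' - s) / 2" "1/2"] s by auto
  define p where "p = Suc (dyadic_floor D s)"
  have "0 \<le> s * 2 ^ D" using s by simp
  then have p: "s * 2 ^ D < real p" "real p \<le> s * 2 ^ D + 1"
    unfolding p_def dyadic_floor_def by linarith+
  have "2 < (s' - s) * 2 ^ D" using D by (simp add: field_simps)
  then have p': "real (Suc p) < s' * 2 ^ D" using p by (simp add: algebra_simps)
  have "s' * 2 ^ D \<le> 2 ^ D" using s by simp
  then have "real (Suc p) < 2 ^ D" using p' by linarith
  then have le: "Suc p \<le> 2 ^ D" by (simp add: of_nat_less_numeral_power_cancel_iff[symmetric] del: of_nat_Suc)
  then have "g (real (Suc p) / 2 ^ D) < g (real p / 2 ^ D)" using step by simp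
  moreover have "g (real p / 2 ^ D) \<le> g s"
    using s p Suc_leD[OF le] by (intro weak) (simp_all add: field_simps)
  moreover have "g s' \<le> g (real (Suc p) / 2 ^ D)"
    using s p' by (intro weak) (simp_all add: field_simps)
  ultimately show "g s' < g s" by linarith
qed

lemma dyadic_half:
  fixes p d :: nat
  assumes "p < 2 ^ Suc d"
  obtains "p < 2 ^ d" | p' where "p = 2 ^ d + p'" "p' < 2 ^ d"
proof (cases "p < 2 ^ d")
  case False
  then have "p = 2 ^ d + (p - 2 ^ d)" "p - 2 ^ d < 2 ^ d" using assms by auto
  then show thesis using that(2) by blast
qed (use that(1) in blast)

text \<open>When all remaining signs are \<open>-1\<close>, nonnegative end values stay nonnegative on both halves, and their
  sum, which is proportional to the drop along the edge, stays positive.\<close>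

lemma edge_profile_dyadic_decreasing:
  assumes "edge_profile 0 x X Y g" "0 < x" "x < 6" "X \<ge> 0" "Y \<ge> 0" "X + Y > 0" "p < 2 ^ d"
  shows "g (real (Suc p) / 2 ^ d) < g (real p / 2 ^ d)"
  using assms
proof (induction d arbitrary: x X Y g p)
  case 0
  from edge_profileE[OF 0(1-3)] have "g 0 - g 1 = (X + Y) / (6 - x)" by metis
  then have "g 0 - g 1 > 0" using 0 by simp
  then show ?case using 0 by simp
next
  case (Suc d)
  from Suc.prems(1-3) show ?case
  proof (cases rule: edge_profileE)
    case (1 t c M k)
    have c: "c > 0" and M: "M > 0" using 1 Suc.prems by auto
    have IH: "g (real (Suc p) / 2 ^ d / 2) < g (real p / 2 ^ d / 2)" if "p < 2 ^ d" for p
      using Suc.IH[of t "c * X" M "\<lambda>s. g (s / 2)" p] that 1(2,3,11) c M Suc.prems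
      by (simp add: add_nonneg_pos)
    have IH': "g ((real (Suc p) / 2 ^ d + 1) / 2) < g ((real p / 2 ^ d + 1) / 2)" if "p < 2 ^ d" for p
      using Suc.IH[of t M "c * Y" "\<lambda>s. g ((s + 1) / 2)" p] that 1(2,3,12) c M Suc.prems
      by (simp add: add_pos_nonneg)
    from Suc.prems(7) show ?thesis
    proof (cases rule: dyadic_half)
      case 1
      have e: "real a / 2 ^ d / 2 = real a / 2 ^ Suc d" for a by (simp add: field_simps)
      show ?thesis using IH[OF 1] unfolding e .
    next
      case (2 p')
      have e: "(real a / 2 ^ d + 1) / 2 = real (2 ^ d + a) / 2 ^ Suc d" for a
        by (simp add: field_simps)
      show ?thesis using IH'[OF 2(2)] unfolding e 2(1) by simp
    qed
  qed
qed

lemma edge_profile_dyadic_const: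
  assumes "edge_profile n x 0 0 g" "0 < x" "x < 6" "p \<le> 2 ^ d"
  shows "g (real p / 2 ^ d) = g 0"
  using assms
proof (induction d arbitrary: n x g p)
  case 0
  from edge_profileE[OF 0(1-3)] have "g 0 - g 1 = (0 + 0) / (6 - x)" by metis
  then show ?case using 0 by (cases p) auto
next
  case (Suc d)
  from Suc.prems(1-3) show ?case
  proof (cases rule: edge_profileE)
    case (1 t c M k)
    have M: "M = 0" using 1 by simp
    have IH: "g (real p / 2 ^ d / 2) = g 0" if "p \<le> 2 ^ d" for p
      using Suc.IH[OF _ 1(2,3) that, of "n div 2" "\<lambda>s. g (s / 2)"] 1(11) M by simp
    have IH': "g ((real p / 2 ^ d + 1) / 2) = g (1 / 2)" if "p \<le> 2 ^ d" for p
      using Suc.IH[OF _ 1(2,3) that, of "n div 2" "\<lambda>s. g ((s + 1) / 2)"] 1(12) M by simp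
    have half: "g (1 / 2) = g 0" using IH[of "2 ^ d"] by simp
    show ?thesis
    proof (cases "p \<le> 2 ^ d")
      case True
      have e: "real p / 2 ^ d / 2 = real p / 2 ^ Suc d" by (simp add: field_simps)
      show ?thesis using IH[OF True] unfolding e .
    next
      case False
      define p' where "p' = p - 2 ^ d"
      have p': "p = 2 ^ d + p'" "p' \<le> 2 ^ d" using False Suc.prems(4) by (auto simp: p'_def)
      have e: "(real p' / 2 ^ d + 1) / 2 = real p / 2 ^ Suc d"
        by (simp add: field_simps p')
      show ?thesis using IH'[OF p'(2)] half unfolding e by simp
    qed
  qed
qed

lemma edge_profile_const:
  assumes "edge_profile n x 0 0 g" "0 < x" "x < 6" "continuous_on {0..1} g" "s \<in> {0..1}"
  shows "g s = g 0"
proof -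
  have "(\<lambda>d. g (real (dyadic_floor d s) / 2 ^ d)) \<longlonglongrightarrow> g s"
    using dyadic_floor_limit[OF assms(4)] assms by simp
  moreover have "g (real (dyadic_floor d s) / 2 ^ d) = g 0" for d
    using edge_profile_dyadic_const[OF assms(1-3) dyadic_floor_le(1)] assms by simp
  ultimately show ?thesis using LIMSEQ_unique[OF _ tendsto_const] by simp
qed

lemma edge_profile_decreasing:
  assumes "edge_profile 0 x X Y g" "0 < x" "x < 6" "X \<ge> 0" "Y \<ge> 0" "X + Y > 0" "continuous_on {0..1} g"
  shows "strict_antimono_on {0..1} g"
  using dyadic_strict_antimono[OF assms(7)] edge_profile_dyadic_decreasing[OF assms(1-6)] by blast

lemma continuous_on_halves:
  assumes "continuous_on {0..1::real} g"
  shows "continuous_on {0..1} (\<lambda>s. g (s / 2))" "continuous_on {0..1} (\<lambda>s. g ((s + 1) / 2))"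
    "continuous_on {0..1} (\<lambda>s. g (1 - s))"
  by (rule continuous_on_compose2[OF assms]; auto intro!: continuous_intros)+

lemma strict_antimono_left_half:
  fixes g :: "real \<Rightarrow> real"
  assumes "strict_antimono_on {0..d} (\<lambda>s. g (s / 2))"
  shows "strict_antimono_on {0..d / 2} g"
proof (rule monotone_onI)
  fix s s' :: real assume "s \<in> {0..d / 2}" "s' \<in> {0..d / 2}" "s < s'"
  then show "g s' < g s" using monotone_onD[OF assms, of "2 * s" "2 * s'"] by simp
qed

text \<open>A negative \<open>Y\<close> fades out next to the left end: by \<open>M = c (X + Y) / (3 - t)\<close> and \<open>3 - t \<ge> 1\<close>, the ratio
  \<open>- Y / X\<close> drops by at least \<open>1\<close> with every passage to the left half until it falls below \<open>1\<close>, and then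
  the next \<open>M\<close> is positive. So after finitely many steps both end values are nonnegative.\<close>

lemma minus_branch_germ:
  assumes "edge_profile 0 x X Y g" "0 < x" "x < 6" "X > 0" "- Y \<le> real N * X" "continuous_on {0..1} g"
  shows "\<exists>d>0. d \<le> 1 \<and> strict_antimono_on {0..d} g"
  using assms
proof (induction N arbitrary: x X Y g)
  case 0
  then have "strict_antimono_on {0..1} g" by (intro edge_profile_decreasing[of x X Y]) auto
  then show ?case by (intro exI[of _ 1]) simp
next
  case (Suc N)
  from Suc.prems(1-3) show ?case
  proof (cases rule: edge_profileE)
    case (1 t c M k)
    have c: "c > 0" using 1 by simp
    have "t < 2" using decim_False_bounds[OF Suc.prems(2,3)] 1(1) by simp
    then have t: "3 - t \<ge> 1" by simp
    have "c * (X + Y) = - (c * (- Y - X))" by (simp add: algebra_simps)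
    then have "- M = c * (- Y - X) / (3 - t)" unfolding 1(9) by simp
    also have "\<dots> \<le> c * (real N * X) / (3 - t)"
      using Suc.prems c t by (intro divide_right_mono mult_left_mono) (auto simp: algebra_simps)
    also have "\<dots> \<le> c * (real N * X) / 1"
      using c t Suc.prems by (intro divide_left_mono) auto
    finally have M: "- M \<le> real N * (c * X)" by (simp add: mult.left_commute)
    have "\<exists>d>0. d \<le> 1 \<and> strict_antimono_on {0..d} (\<lambda>s. g (s / 2))"
      using 1 c Suc.prems M continuous_on_halves(1) by (intro Suc.IH[of t "c * X" M]) auto
    then obtain d where "d > 0" "d \<le> 1" "strict_antimono_on {0..d} (\<lambda>s. g (s / 2))" by blast
    then show ?thesis using strict_antimono_left_half by (intro exI[of _ "d / 2"]) auto
  qed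
qed

lemma strict_antimono_mult_pos:
  fixes g :: "real \<Rightarrow> real"
  assumes "strict_antimono_on S (\<lambda>s. a * g s)" "0 < a * b"
  shows "strict_antimono_on S (\<lambda>s. b * g s)"
proof (rule monotone_onI)
  fix s s' assume "s \<in> S" "s' \<in> S" "s < s'"
  then have "a * g s' < a * g s" using monotone_onD[OF assms(1)] by simp
  then show "b * g s' < b * g s" using assms(2)
    by (auto simp: mult_less_cancel_left zero_less_mult_iff)
qed

text \<open>Near an end with nonzero normal derivative, its sign decides the direction; every \<open>\<epsilon> = 1\<close> still to
  come reverses that sign, and their number has the parity of \<open>n\<close>.\<close>

lemma nonzero_end_germ:
  assumes "edge_profile n x X Y g" "0 < x" "x < 6" "X \<noteq> 0" "continuous_on {0..1} g"
  shows "\<exists>d>0. d \<le> 1 \<and> strict_antimono_on {0..d} (\<lambda>s. X * (- 1) ^ n * g s)"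
  using assms
proof (induction n arbitrary: x X Y g rule: less_induct)
  case (less n)
  show ?case
  proof (cases "n = 0")
    case True
    have pos: "\<exists>d>0. d \<le> 1 \<and> strict_antimono_on {0..d} g"
      if "edge_profile 0 x X Y g" "X > 0" "continuous_on {0..1} g" for X Y g
    proof -
      obtain N where "- Y / X \<le> real N" using real_arch_simple by blast
      then have "- Y \<le> real N * X" using that by (simp add: field_simps)
      then show ?thesis using minus_branch_germ[OF that(1) less.prems(2,3) that(2) _ that(3)] by blast
    qed
    show ?thesis
    proof (cases "X > 0")
      case True
      then show ?thesis using pos[of X Y g] less.prems \<open>n = 0\<close> strict_antimono_mult_pos[of _ 1 g X] by auto
    next
      case False
      then have "X < 0" using less.prems by simp
      then show ?thesis
        using pos[OF edge_profile_uminus, of X Y g] less.prems \<open>n = 0\<close> continuous_on_minus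
          strict_antimono_mult_pos[of _ "- 1" g X] by auto
    qed
  next
    case False
    from less.prems(1-3) show ?thesis
    proof (cases rule: edge_profileE)
      case (1 t c M k)
      have c: "c \<noteq> 0" using 1(5,6) by auto
      have "\<exists>d>0. d \<le> 1 \<and> strict_antimono_on {0..d} (\<lambda>s. (c * X) * (- 1) ^ (n div 2) * g (s / 2))"
        using 1 c less.prems continuous_on_halves(1) False
        by (intro less.IH[of "n div 2" t "c * X" M]) auto
      then obtain d where d: "d > 0" "d \<le> 1"
        "strict_antimono_on {0..d} (\<lambda>s. (c * X) * (- 1) ^ (n div 2) * g (s / 2))" by blast
      have "strict_antimono_on {0..d / 2} (\<lambda>s. (c * X) * (- 1) ^ (n div 2) * g s)"
        using strict_antimono_left_half[OF d(3)] .
      moreover have "0 < (c * X) * (- 1) ^ (n div 2) * (X * (- 1) ^ n)"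
      proof -
        have "0 < c * (- 1) ^ (n div 2) * (- 1) ^ n"
          using 1(5,6) gray_parity[of n] by (cases "even n"; cases "even (n div 2)") auto
        moreover have "0 < X * X" using less.prems not_real_square_gt_zero[of X] by blast
        ultimately have "0 < (c * (- 1) ^ (n div 2) * (- 1) ^ n) * (X * X)" by (rule mult_pos_pos)
        then show ?thesis by (simp add: mult_ac)
      qed
      ultimately have "strict_antimono_on {0..d / 2} (\<lambda>s. X * (- 1) ^ n * g s)"
        by (rule strict_antimono_mult_pos)
      then show ?thesis using d by (intro exI[of _ "d / 2"]) auto
    qed
  qed
qed

text \<open>If the normal derivative at the end vanishes, no reversal takes place: the midpoint value is a positive
  multiple of \<open>Y\<close> for either sign of \<open>\<epsilon>\<close>.\<close>

lemma zero_end_germ: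
  assumes "edge_profile n x 0 Y g" "0 < x" "x < 6" "Y > 0" "continuous_on {0..1} g"
  shows "\<exists>d>0. d \<le> 1 \<and> strict_antimono_on {0..d} g"
  using assms
proof (induction n arbitrary: x Y g rule: less_induct)
  case (less n)
  show ?case
  proof (cases "n = 0")
    case True
    then have "strict_antimono_on {0..1} g"
      using less.prems by (intro edge_profile_decreasing[of x 0 Y]) auto
    then show ?thesis by (intro exI[of _ 1]) simp
  next
    case False
    from less.prems(1-3) show ?thesis
    proof (cases rule: edge_profileE)
      case (1 t c M k)
      have "\<exists>d>0. d \<le> 1 \<and> strict_antimono_on {0..d} (\<lambda>s. g (s / 2))"
        using 1 less.prems continuous_on_halves(1) False
        by (intro less.IH[of "n div 2" t M]) auto
      then obtain d where "d > 0" "d \<le> 1" "strict_antimono_on {0..d} (\<lambda>s. g (s / 2))" by blast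
      then show ?thesis using strict_antimono_left_half by (intro exI[of _ "d / 2"]) auto
    qed
  qed
qed

section \<open>Counting local extrema\<close>

lemma local_extrema01_uminus: "local_extrema01 (\<lambda>s. - g s) = local_extrema01 g"
  unfolding local_extrema01_def by (rule Collect_cong) (simp, blast)

lemma strict_antimono_no_extrema:
  assumes "strict_antimono_on {0..1} g"
  shows "local_extrema01 g = {}"
proof (rule equals0I)
  fix s assume "s \<in> local_extrema01 g"
  then obtain d where s: "0 < s" "s < 1" and d: "d > 0"
    and ext: "(\<forall>y. 0 \<le> y \<and> y \<le> 1 \<and> \<bar>y - s\<bar> < d \<longrightarrow> g y \<le> g s) \<or>
       (\<forall>y. 0 \<le> y \<and> y \<le> 1 \<and> \<bar>y - s\<bar> < d \<longrightarrow> g s \<le> g y)"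
    unfolding local_extrema01_def by blast
  define e where "e = min (d / 2) (min s (1 - s))"
  have e: "0 < e" "e < d" "e \<le> s" "s + e \<le> 1" using s d by (auto simp: e_def)
  have "g (s + e) < g s" "g s < g (s - e)"
    using e s by (auto intro!: monotone_onD[OF assms])
  moreover have "g (s - e) \<le> g s \<or> g s \<le> g (s + e)"
    using ext[THEN disj_forward, of "g (s - e) \<le> g s" "g s \<le> g (s + e)"] e s by force
  ultimately show False by linarith
qed

text \<open>Being a local extremum is a local property, so it is not affected by zooming into a subinterval as
  long as the point stays away from its ends.\<close>

lemma local_extrema01_affine:
  assumes c: "0 < c" "0 \<le> a" "a + c \<le> 1" and s: "0 < s" "s < 1"
  shows "a + c * s \<in> local_extrema01 g \<longleftrightarrow> s \<in> local_extrema01 (\<lambda>s. g (a + c * s))"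
proof
  assume "a + c * s \<in> local_extrema01 g"
  then obtain d where d: "d > 0"
    and ext: "(\<forall>y. 0 \<le> y \<and> y \<le> 1 \<and> \<bar>y - (a + c * s)\<bar> < d \<longrightarrow> g y \<le> g (a + c * s)) \<or>
       (\<forall>y. 0 \<le> y \<and> y \<le> 1 \<and> \<bar>y - (a + c * s)\<bar> < d \<longrightarrow> g (a + c * s) \<le> g y)"
    unfolding local_extrema01_def by blast
  have "0 \<le> a + c * y \<and> a + c * y \<le> 1 \<and> \<bar>a + c * y - (a + c * s)\<bar> < d"
    if y: "0 \<le> y \<and> y \<le> 1 \<and> \<bar>y - s\<bar> < d / c" for y
  proof -
    have "c * y \<le> c * 1" using y c by (intro mult_left_mono) auto
    then have le: "a + c * y \<le> 1" using c(3) by linarith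
    have "a + c * y - (a + c * s) = c * (y - s)" by (simp add: algebra_simps)
    then have "\<bar>a + c * y - (a + c * s)\<bar> = c * \<bar>y - s\<bar>" using c by (simp add: abs_mult)
    then show ?thesis using y c le by (simp add: less_divide_eq mult.commute)
  qed
  then show "s \<in> local_extrema01 (\<lambda>s. g (a + c * s))"
    unfolding local_extrema01_def using s d c ext by (auto intro!: exI[of _ "d / c"])
next
  assume "s \<in> local_extrema01 (\<lambda>s. g (a + c * s))"
  then obtain d where d: "d > 0"
    and ext: "(\<forall>y. 0 \<le> y \<and> y \<le> 1 \<and> \<bar>y - s\<bar> < d \<longrightarrow> g (a + c * y) \<le> g (a + c * s)) \<or>
       (\<forall>y. 0 \<le> y \<and> y \<le> 1 \<and> \<bar>y - s\<bar> < d \<longrightarrow> g (a + c * s) \<le> g (a + c * y))"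
    unfolding local_extrema01_def by auto
  define e where "e = c * min d (min s (1 - s))"
  have e: "e > 0" using d c s by (simp add: e_def)
  have near: "\<exists>z. y = a + c * z \<and> 0 \<le> z \<and> z \<le> 1 \<and> \<bar>z - s\<bar> < d" if y: "\<bar>y - (a + c * s)\<bar> < e" for y
  proof -
    define z where "z = (y - a) / c"
    have z: "y = a + c * z" using c by (simp add: z_def)
    have "y - (a + c * s) = c * (z - s)" unfolding z by (simp add: algebra_simps)
    then have "c * \<bar>z - s\<bar> < c * min d (min s (1 - s))" using y c by (simp add: abs_mult e_def)
    then have "\<bar>z - s\<bar> < min d (min s (1 - s))" using c by simp
    then show ?thesis using z by (intro exI[of _ z]) auto
  qed
  have "(\<forall>y. 0 \<le> y \<and> y \<le> 1 \<and> \<bar>y - (a + c * s)\<bar> < e \<longrightarrow> g y \<le> g (a + c * s)) \<or>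
       (\<forall>y. 0 \<le> y \<and> y \<le> 1 \<and> \<bar>y - (a + c * s)\<bar> < e \<longrightarrow> g (a + c * s) \<le> g y)"
    using ext near by metis
  moreover have "c * s < c" "0 < c * s" using c s by simp_all
  then have "0 < a + c * s" "a + c * s < 1" using c by linarith+
  ultimately show "a + c * s \<in> local_extrema01 g" unfolding local_extrema01_def using e by blast
qed

lemma local_extrema01_split:
  "local_extrema01 g = (\<lambda>s. s / 2) ` local_extrema01 (\<lambda>s. g (s / 2)) \<union>
     (\<lambda>s. (s + 1) / 2) ` local_extrema01 (\<lambda>s. g ((s + 1) / 2)) \<union> (local_extrema01 g \<inter> {1/2})"
    (is "?E = ?L \<union> ?R \<union> ?M")
proof -
  have unit: "0 < s" "s < 1" if "s \<in> local_extrema01 h" for s h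
    using that by (simp_all add: local_extrema01_def)
  have left: "s / 2 \<in> ?E \<longleftrightarrow> s \<in> local_extrema01 (\<lambda>s. g (s / 2))" if "0 < s" "s < 1" for s
    using local_extrema01_affine[of "1/2" 0 s g] that by simp
  have right: "(s + 1) / 2 \<in> ?E \<longleftrightarrow> s \<in> local_extrema01 (\<lambda>s. g ((s + 1) / 2))" if "0 < s" "s < 1" for s
    using local_extrema01_affine[of "1/2" "1/2" s g] that by (simp add: add_divide_distrib add.commute)
  show ?thesis
  proof (intro equalityI subsetI)
    fix s assume s: "s \<in> ?E"
    consider "s < 1/2" | "s > 1/2" | "s = 1/2" by linarith
    then show "s \<in> ?L \<union> ?R \<union> ?M"
    proof cases
      case 1
      then have "2 * s \<in> local_extrema01 (\<lambda>s. g (s / 2))" using left[of "2 * s"] s unit[OF s] by simp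
      then show ?thesis by (intro UnI1 image_eqI[of s _ "2 * s"]) simp_all
    next
      case 2
      then have "2 * s - 1 \<in> local_extrema01 (\<lambda>s. g ((s + 1) / 2))"
        using right[of "2 * s - 1"] s unit[OF s] by simp
      then show ?thesis by (intro UnI1[OF UnI2] image_eqI[of s _ "2 * s - 1"]) simp_all
    next
      case 3
      then show ?thesis using s by blast
    qed
  next
    fix s assume "s \<in> ?L \<union> ?R \<union> ?M"
    then show "s \<in> ?E" using left right unit by blast
  qed
qed

lemma card_local_extrema01_split:
  assumes "finite (local_extrema01 (\<lambda>s. g (s / 2)))" "finite (local_extrema01 (\<lambda>s. g ((s + 1) / 2)))"
  shows "finite (local_extrema01 g)"
    and "card (local_extrema01 g) = card (local_extrema01 (\<lambda>s. g (s / 2)))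
      + card (local_extrema01 (\<lambda>s. g ((s + 1) / 2))) + (if 1/2 \<in> local_extrema01 g then 1 else 0)"
proof -
  let ?L = "(\<lambda>s. s / 2) ` local_extrema01 (\<lambda>s. g (s / 2))"
  let ?R = "(\<lambda>s. (s + 1) / 2) ` local_extrema01 (\<lambda>s. g ((s + 1) / 2))"
  let ?M = "local_extrema01 g \<inter> {1/2}"
  have fin: "finite ?L" "finite ?R" "finite ?M" using assms by auto
  note split = local_extrema01_split[of g]
  show "finite (local_extrema01 g)" by (subst split) (use fin in blast)
  have L: "s < 1/2" if "s \<in> ?L" for s using that by (auto simp: local_extrema01_def)
  have R: "s > 1/2" if "s \<in> ?R" for s using that by (auto simp: local_extrema01_def)
  have "card (local_extrema01 g) = card (?L \<union> ?R \<union> ?M)" using split by simp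
  also have "\<dots> = card (?L \<union> ?R) + card ?M"
    using fin L R by (intro card_Un_disjoint) force+
  also have "card (?L \<union> ?R) = card ?L + card ?R"
    using fin L R by (intro card_Un_disjoint) force+
  also have "card ?L = card (local_extrema01 (\<lambda>s. g (s / 2)))"
    by (rule card_image) (simp add: inj_on_def)
  also have "card ?R = card (local_extrema01 (\<lambda>s. g ((s + 1) / 2)))"
    by (rule card_image) (simp add: inj_on_def)
  also have "card ?M = (if 1/2 \<in> local_extrema01 g then 1 else 0)" by simp
  finally show "card (local_extrema01 g) = card (local_extrema01 (\<lambda>s. g (s / 2)))
      + card (local_extrema01 (\<lambda>s. g ((s + 1) / 2))) + (if 1/2 \<in> local_extrema01 g then 1 else 0)" .
qed

lemma midpoint_max:
  fixes g :: "real \<Rightarrow> real"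
  assumes "d > 0" "strict_antimono_on {0..d} (\<lambda>s. g ((s + 1) / 2))"
    "e > 0" "strict_antimono_on {0..e} (\<lambda>s. g ((1 - s) / 2))"
  shows "1/2 \<in> local_extrema01 g"
proof -
  \<comment> \<open>half, because the halves of the interval are stretched by a factor \<open>2\<close>\<close>
  define r where "r = min d e / 2"
  have r: "r > 0" "2 * r \<le> d" "2 * r \<le> e" using assms by (auto simp: r_def)
  have "g y \<le> g (1/2)" if "\<bar>y - 1/2\<bar> < r" for y
  proof (cases y "1/2 :: real" rule: linorder_cases)
    case less
    then have "g ((1 - (1 - 2 * y)) / 2) < g ((1 - 0) / 2)"
      using that r by (intro monotone_onD[OF assms(4)]) auto
    then show ?thesis by simp
  next
    case greater
    then have "g ((2 * y - 1 + 1) / 2) < g ((0 + 1) / 2)"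
      using that r by (intro monotone_onD[OF assms(2)]) auto
    then show ?thesis by simp
  next
    case equal
    then show ?thesis by (simp only: order_refl)
  qed
  then show ?thesis unfolding local_extrema01_def using r by auto
qed

lemma midpoint_crossing:
  fixes g :: "real \<Rightarrow> real"
  assumes "d > 0" "strict_antimono_on {0..d} (\<lambda>s. g ((s + 1) / 2))"
    "e > 0" "strict_antimono_on {0..e} (\<lambda>s. - g ((1 - s) / 2))"
  shows "1/2 \<notin> local_extrema01 g"
proof
  assume "1/2 \<in> local_extrema01 g"
  then obtain r where r: "r > 0"
    and ext: "(\<forall>y. 0 \<le> y \<and> y \<le> 1 \<and> \<bar>y - 1/2\<bar> < r \<longrightarrow> g y \<le> g (1/2)) \<or>
       (\<forall>y. 0 \<le> y \<and> y \<le> 1 \<and> \<bar>y - 1/2\<bar> < r \<longrightarrow> g (1/2) \<le> g y)"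
    unfolding local_extrema01_def by blast
  define h where "h = min (min d e) (min r 1)"
  have h: "0 < h" "h \<le> d" "h \<le> e" "h \<le> r" "h \<le> 1" using assms r by (auto simp: h_def)
  have "g ((h + 1) / 2) < g ((0 + 1) / 2)"
    using h by (intro monotone_onD[OF assms(2)]) auto
  moreover have "- g ((1 - h) / 2) < - g ((1 - 0) / 2)"
    using h by (intro monotone_onD[OF assms(4)]) auto
  moreover have dist: "\<bar>(h + 1) / 2 - 1 / 2\<bar> < r" "\<bar>(1 - h) / 2 - 1 / 2\<bar> < r"
    using h r by (auto simp: abs_if field_simps)
  have "g ((1 - h) / 2) \<le> g (1/2) \<or> g (1/2) \<le> g ((h + 1) / 2)"
    using ext
  proof (elim disjE)
    assume "\<forall>y. 0 \<le> y \<and> y \<le> 1 \<and> \<bar>y - 1/2\<bar> < r \<longrightarrow> g y \<le> g (1/2)"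
    from this[rule_format, of "(1 - h) / 2"] show ?thesis using dist h by simp
  next
    assume "\<forall>y. 0 \<le> y \<and> y \<le> 1 \<and> \<bar>y - 1/2\<bar> < r \<longrightarrow> g (1/2) \<le> g y"
    from this[rule_format, of "(h + 1) / 2"] show ?thesis using dist h by simp
  qed
  ultimately show False by simp
qed

text \<open>If \<open>X + Y \<noteq> 0\<close>, both halves have the nonzero end value \<open>M\<close> at the midpoint, and the function crosses
  it in one direction. If \<open>X + Y = 0\<close>, the end value \<open>M\<close> vanishes, and the outer end values \<open>c * X\<close> and
  \<open>c * Y\<close> are opposite; so to both sides of the midpoint the function falls, or to both it rises.\<close>

lemma midpoint_extremum_iff:
  assumes "edge_profile n x X Y g" "0 < x" "x < 6" "X \<noteq> 0 \<or> Y \<noteq> 0" "continuous_on {0..1} g"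
  shows "1/2 \<in> local_extrema01 g \<longleftrightarrow> X + Y = 0"
  using assms(1-3)
proof (cases rule: edge_profileE)
  case (1 t c M k)
  let ?R = "\<lambda>s. g ((s + 1) / 2)" and ?L = "\<lambda>s. g ((1 - s) / 2)"
  have right: "edge_profile (n div 2) t M (c * Y) ?R" using 1 by simp
  have left: "edge_profile (n div 2) t (- M) (- (c * X)) ?L"
    using edge_profile_reverse[OF 1(11)] by simp
  have cont: "continuous_on {0..1} ?R" "continuous_on {0..1} ?L"
    using continuous_on_halves[OF assms(5)] continuous_on_halves(3)[OF continuous_on_halves(1)[OF assms(5)]]
    by auto
  show ?thesis
  proof (cases "M = 0")
    case True
    then have sum: "X + Y = 0" using 1 by simp
    then have "X = - Y" by linarith
    then have Y: "Y \<noteq> 0" "- (c * X) = c * Y" using assms(4) by auto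
    have c: "c \<noteq> 0" using 1(5,6) by auto
    have "1/2 \<in> local_extrema01 g"
    proof (cases "c * Y > 0")
      case True
      obtain d where "d > 0" "strict_antimono_on {0..d} ?R"
        using zero_end_germ[of "n div 2" t "c * Y" ?R] right 1 True cont \<open>M = 0\<close> by auto
      moreover obtain e where "e > 0" "strict_antimono_on {0..e} ?L"
        using zero_end_germ[of "n div 2" t "c * Y" ?L] left 1 True cont \<open>M = 0\<close> Y by auto
      ultimately show ?thesis by (rule midpoint_max)
    next
      case False
      moreover have "c * Y \<noteq> 0" using c Y by simp
      ultimately have neg: "- (c * Y) > 0" by linarith
      have "edge_profile (n div 2) t 0 (- (c * Y)) (\<lambda>s. - ?R s)"
        using edge_profile_uminus[OF right] \<open>M = 0\<close> by simp
      then obtain d where "d > 0" "strict_antimono_on {0..d} (\<lambda>s. - ?R s)"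
        using zero_end_germ[OF _ 1(2,3) neg continuous_on_minus[OF cont(1)]] by blast
      moreover have "edge_profile (n div 2) t 0 (- (c * Y)) (\<lambda>s. - ?L s)"
        using edge_profile_uminus[OF left] \<open>M = 0\<close> Y by simp
      then obtain e where "e > 0" "strict_antimono_on {0..e} (\<lambda>s. - ?L s)"
        using zero_end_germ[OF _ 1(2,3) neg continuous_on_minus[OF cont(2)]] by blast
      ultimately have "1/2 \<in> local_extrema01 (\<lambda>s. - g s)"
        using midpoint_max[of d "\<lambda>s. - g s"] by blast
      then show ?thesis by (simp add: local_extrema01_uminus)
    qed
    then show ?thesis using sum by simp
  next
    case False
    then have sum: "X + Y \<noteq> 0" using 1 by auto
    define a where "a = M * (- 1) ^ (n div 2)"
    obtain d where d: "d > 0" "strict_antimono_on {0..d} (\<lambda>s. a * ?R s)"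
      using nonzero_end_germ[OF right 1(2,3) False cont(1)] by (auto simp: a_def)
    obtain e where e: "e > 0" "strict_antimono_on {0..e} (\<lambda>s. - (a * ?L s))"
      using nonzero_end_germ[OF left 1(2,3) _ cont(2)] False by (auto simp: a_def)
    have "1/2 \<notin> local_extrema01 (\<lambda>s. a * g s)"
      using midpoint_crossing[of d "\<lambda>s. a * g s" e] d e by blast
    moreover have "1/2 \<in> local_extrema01 (\<lambda>s. a * g s)" if "1/2 \<in> local_extrema01 g"
    proof (cases "a \<ge> 0")
      case True
      then have "g y \<le> g y' \<Longrightarrow> a * g y \<le> a * g y'" for y y' by (rule mult_left_mono[rotated])
      then show ?thesis using that unfolding local_extrema01_def by blast
    next
      case False
      then have "g y \<le> g y' \<Longrightarrow> a * g y' \<le> a * g y" for y y' by (simp add: mult_left_mono_neg)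
      then show ?thesis using that unfolding local_extrema01_def by blast
    qed
    ultimately show ?thesis using sum by blast
  qed
qed

text \<open>With only signs \<open>-1\<close> to come and end values of opposite sign, one half inherits the sign change and the
  other one is monotone, or the midpoint is the extremum and both halves are monotone. Hence the
  extrema lie in a nested sequence of dyadic intervals.\<close>

lemma extrema_close:
  assumes "edge_profile 0 x X Y g" "0 < x" "x < 6" "X > 0" "Y < 0" "continuous_on {0..1} g"
    and "r \<in> local_extrema01 g" "s \<in> local_extrema01 g"
  shows "\<bar>r - s\<bar> \<le> (1/2) ^ d"
  using assms
proof (induction d arbitrary: x X Y g r s)
  case 0
  then show ?case by (simp add: local_extrema01_def abs_le_iff)
next
  case (Suc d)
  from Suc.prems(1-3) show ?case
  proof (cases rule: edge_profileE)
    case (1 t c M k)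
    have c: "c > 0" using 1 by simp
    have signs: "c * X > 0" "c * Y < 0" using c Suc.prems by (auto simp: mult_pos_neg)
    note cont = continuous_on_halves(1,2)[OF Suc.prems(6)]
    have mid: "1/2 \<in> local_extrema01 g \<longleftrightarrow> X + Y = 0"
      using Suc.prems by (intro midpoint_extremum_iff) auto
    have A: "local_extrema01 (\<lambda>s. g (s / 2)) = {}" if "M \<ge> 0"
      using that signs 1 cont
      by (intro strict_antimono_no_extrema edge_profile_decreasing[of t "c * X" M]) auto
    have B: "local_extrema01 (\<lambda>s. g ((s + 1) / 2)) = {}" if "M \<le> 0"
    proof -
      have "edge_profile 0 t (- M) (- (c * Y)) (\<lambda>s. - g ((s + 1) / 2))"
        using edge_profile_uminus 1 by simp
      then have "local_extrema01 (\<lambda>s. - g ((s + 1) / 2)) = {}"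
        using that signs 1 cont
        by (intro strict_antimono_no_extrema edge_profile_decreasing[of t "- M" "- (c * Y)"])
          (auto intro!: continuous_intros)
      then show ?thesis using local_extrema01_uminus[of "\<lambda>s. g ((s + 1) / 2)"] by simp
    qed
    note split = local_extrema01_split[of g]
    consider "M > 0" | "M = 0" | "M < 0" by linarith
    then show ?thesis
    proof cases
      case M: 1
      then have "X + Y \<noteq> 0" using 1(8) by auto
      then have "local_extrema01 g = (\<lambda>s. (s + 1) / 2) ` local_extrema01 (\<lambda>s. g ((s + 1) / 2))"
        using split A M mid by auto
      then obtain r' s' where rs: "r = (r' + 1) / 2" "s = (s' + 1) / 2"
        "r' \<in> local_extrema01 (\<lambda>s. g ((s + 1) / 2))" "s' \<in> local_extrema01 (\<lambda>s. g ((s + 1) / 2))"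
        using Suc.prems(7,8) by auto
      have "\<bar>r' - s'\<bar> \<le> (1/2) ^ d"
        using Suc.IH[OF _ 1(2,3) M signs(2) cont(2) rs(3,4)] 1(12) by simp
      moreover have e: "r - s = (r' - s') / 2" using rs(1,2) by (simp add: field_simps)
      have "\<bar>r - s\<bar> = \<bar>r' - s'\<bar> / 2" unfolding e by simp
      ultimately show ?thesis by simp
    next
      case M: 2
      then have "local_extrema01 g \<subseteq> {1/2}" using split A B by auto
      then have "r = 1/2" "s = 1/2" using Suc.prems(7,8) by auto
      then show ?thesis by simp
    next
      case M: 3
      then have "X + Y \<noteq> 0" using 1(8) by auto
      then have "local_extrema01 g = (\<lambda>s. s / 2) ` local_extrema01 (\<lambda>s. g (s / 2))"
        using split B M mid by auto
      then obtain r' s' where rs: "r = r' / 2" "s = s' / 2"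
        "r' \<in> local_extrema01 (\<lambda>s. g (s / 2))" "s' \<in> local_extrema01 (\<lambda>s. g (s / 2))"
        using Suc.prems(7,8) by auto
      have "\<bar>r' - s'\<bar> \<le> (1/2) ^ d"
        using Suc.IH[OF _ 1(2,3) signs(1) M cont(1) rs(3,4)] 1(11) by simp
      moreover have e: "r - s = (r' - s') / 2" using rs(1,2) by (simp add: field_simps)
      have "\<bar>r - s\<bar> = \<bar>r' - s'\<bar> / 2" unfolding e by simp
      ultimately show ?thesis by simp
    qed
  qed
qed

text \<open>Existence: the function falls after the left end and, read backwards, also after the right one, so
  its minimum is attained inside.\<close>

lemma single_extremum:
  assumes "edge_profile 0 x X Y g" "0 < x" "x < 6" "X > 0" "Y < 0" "continuous_on {0..1} g"
  shows "\<exists>s. local_extrema01 g = {s}"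
proof -
  have uniq: "r = s" if "r \<in> local_extrema01 g" "s \<in> local_extrema01 g" for r s
  proof (rule ccontr)
    assume "r \<noteq> s"
    then obtain d where "(1/2::real) ^ d < \<bar>r - s\<bar>" using real_arch_pow_inv[of "\<bar>r - s\<bar>" "1/2"] by auto
    then show False using extrema_close[OF assms that, of d] by simp
  qed
  obtain d where d: "d > 0" "d \<le> 1" "strict_antimono_on {0..d} (\<lambda>s. X * g s)"
    using nonzero_end_germ[OF assms(1-3) _ assms(6)] assms(4) by auto
  obtain e where e: "e > 0" "e \<le> 1" "strict_antimono_on {0..e} (\<lambda>s. - Y * g (1 - s))"
    using nonzero_end_germ[OF edge_profile_reverse[OF assms(1)] assms(2,3) _ continuous_on_halves(3)[OF assms(6)]] assms(5)
    by auto
  obtain s where s: "s \<in> {0..1}" "\<forall>y\<in>{0..1}. g s \<le> g y"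
    using continuous_attains_inf[of "{0..1}" g] assms by auto
  have "X * g d < X * g 0" using d by (intro monotone_onD[OF d(3)]) auto
  moreover have "- Y * g (1 - e) < - Y * g (1 - 0)" using e by (intro monotone_onD[OF e(3)]) auto
  ultimately have "g d < g 0" "g (1 - e) < g 1" using assms(4,5) by simp_all
  moreover have "g s \<le> g d" "g s \<le> g (1 - e)" using s d e by auto
  ultimately have "s \<noteq> 0" "s \<noteq> 1" by auto
  then have "s \<in> local_extrema01 g"
    unfolding local_extrema01_def using s by (auto intro!: exI[of _ 1])
  then show ?thesis using uniq by blast
qed

definition extrema_count :: "nat \<Rightarrow> real \<Rightarrow> real \<Rightarrow> nat" where
  "extrema_count n X Y = (if X * Y > 0 then 2 * ((n + 1) div 2) else if X * Y = 0 then n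
     else 2 * (n div 2) + 1)"

text \<open>\<open>P\<close> and \<open>Q\<close> have the sign that the product of the end values would have on the left and on the right
  half if the end values were not reversed.\<close>

lemma endpoint_sign_table:
  fixes X Y :: real
  assumes "X \<noteq> 0 \<or> Y \<noteq> 0"
  defines "P \<equiv> X * (X + Y)" and "Q \<equiv> (X + Y) * Y"
  obtains (same) "X * Y > 0" "P > 0" "Q > 0" "X + Y \<noteq> 0"
  | (left0) "X * Y = 0" "P = 0" "Q > 0" "X + Y \<noteq> 0"
  | (right0) "X * Y = 0" "P > 0" "Q = 0" "X + Y \<noteq> 0"
  | (balanced) "X * Y < 0" "P = 0" "Q = 0" "X + Y = 0"
  | (left) "X * Y < 0" "P < 0" "Q > 0" "X + Y \<noteq> 0"
  | (right) "X * Y < 0" "P > 0" "Q < 0" "X + Y \<noteq> 0"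
proof -
  have sum: "P + Q = (X + Y)\<^sup>2" by (simp add: P_def Q_def power2_eq_square algebra_simps)
  have PQ: "P = X\<^sup>2 + X * Y" "Q = Y\<^sup>2 + X * Y"
    by (simp_all add: P_def Q_def power2_eq_square algebra_simps)
  \<comment> \<open>for \<open>X * Y < 0\<close> the sign change goes to exactly one of the halves\<close>
  have PQ': "P * Q = (X + Y)\<^sup>2 * (X * Y)" by (simp add: P_def Q_def power2_eq_square)
  consider "X * Y > 0" | "X = 0" | "Y = 0" | "X * Y < 0" "X + Y = 0" | "X * Y < 0" "X + Y \<noteq> 0"
    by (metis linorder_neqE_linordered_idom mult_eq_0_iff)
  then show thesis
  proof cases
    case 1
    then have pos: "P > 0" "Q > 0" unfolding PQ by (auto intro: add_nonneg_pos)
    then have "X + Y \<noteq> 0" by (auto simp: P_def)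
    with 1 pos show thesis by (rule same)
  next
    case 2
    then show thesis using assms(1) left0 by (auto simp: PQ)
  next
    case 3
    then show thesis using assms(1) right0 by (auto simp: PQ)
  next
    case 4
    then show thesis using balanced by (simp add: P_def Q_def)
  next
    case 5
    then have "(X + Y)\<^sup>2 > 0" by simp
    then have "P * Q < 0" unfolding PQ' using 5(1) by (rule mult_pos_neg)
    then consider "P < 0" "Q > 0" | "P > 0" "Q < 0" by (auto simp: mult_less_0_iff)
    then show thesis using 5 left right by cases auto
  qed
qed

text \<open>The claimed numbers of extrema satisfy the recursion obtained by halving the edge. Writing \<open>n\<close> as
  \<open>4 a + r\<close> fixes both the first sign and the residue of the index \<open>n div 2\<close> of the halves.\<close>

lemma extrema_count_rec:
  assumes "X \<noteq> 0 \<or> Y \<noteq> 0" "k > 0" "c > 0 \<longleftrightarrow> \<not> gray n 0" "c < 0 \<longleftrightarrow> gray n 0"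
  shows "extrema_count n X Y = extrema_count (n div 2) (c * X) (k * (X + Y))
    + extrema_count (n div 2) (k * (X + Y)) (c * Y) + (if X + Y = 0 then 1 else 0)"
proof -
  define P Q s where "P = X * (X + Y)" and "Q = (X + Y) * Y" and "s = c * k"
  have prods: "c * X * (k * (X + Y)) = s * P" "k * (X + Y) * (c * Y) = s * Q"
    by (simp_all add: P_def Q_def s_def algebra_simps)
  have s: "s > 0 \<longleftrightarrow> \<not> gray n 0" "s < 0 \<longleftrightarrow> gray n 0" "s \<noteq> 0"
    using assms(2-4) unfolding s_def by (auto simp: zero_less_mult_iff mult_less_0_iff)
  define a r where "a = n div 4" and "r = n mod 4"
  have n4: "n = 4 * a + r" "n div 2 = 2 * a + r div 2" unfolding a_def r_def by presburger+
  have "r = 0 \<or> r = 1 \<or> r = 2 \<or> r = 3" unfolding r_def by presburger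
  moreover have "gray n 0 \<longleftrightarrow> r = 1 \<or> r = 2" by (simp add: gray_0 r_def)
  ultimately have residues: "gray n 0 \<and> n = 4 * a + 1 \<and> n div 2 = 2 * a \<or> gray n 0 \<and> n = 4 * a + 2 \<and> n div 2 = 2 * a + 1
    \<or> \<not> gray n 0 \<and> n = 4 * a \<and> n div 2 = 2 * a \<or> \<not> gray n 0 \<and> n = 4 * a + 3 \<and> n div 2 = 2 * a + 1"
    using n4 by (elim disjE) simp_all
  define K :: "nat \<Rightarrow> real \<Rightarrow> nat" where
    "K = (\<lambda>n p. if p > 0 then 2 * ((n + 1) div 2) else if p = 0 then n else 2 * (n div 2) + 1)"
  have K: "p > 0 \<Longrightarrow> K n p = 2 * ((n + 1) div 2)" "p = 0 \<Longrightarrow> K n p = n"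
    "p < 0 \<Longrightarrow> K n p = 2 * (n div 2) + 1" for n p
    by (simp_all add: K_def)
  have Ks: "s > 0 \<Longrightarrow> K n (s * p) = K n p" "s < 0 \<Longrightarrow> K n (s * p) = K n (- p)" for n p
    by (simp_all add: K_def zero_less_mult_iff)
  have count: "extrema_count n X Y = K n (X * Y)" for n X Y
    by (simp only: extrema_count_def K_def)
  from residues
  show ?thesis
  proof (elim disjE conjE)
    assume g: "gray n 0" and n: "n = 4 * a + 1" "n div 2 = 2 * a"
    have sgn: "s < 0" using s g by simp
    from assms(1) show ?thesis
      unfolding count prods n(2) unfolding n(1)
      by (cases rule: endpoint_sign_table; fold P_def Q_def; simp add: K Ks sgn)
  next
    assume g: "gray n 0" and n: "n = 4 * a + 2" "n div 2 = 2 * a + 1"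
    have sgn: "s < 0" using s g by simp
    from assms(1) show ?thesis
      unfolding count prods n(2) unfolding n(1)
      by (cases rule: endpoint_sign_table; fold P_def Q_def; simp add: K Ks sgn)
  next
    assume g: "\<not> gray n 0" and n: "n = 4 * a" "n div 2 = 2 * a"
    have sgn: "s > 0" using s g by simp
    from assms(1) show ?thesis
      unfolding count prods n(2) unfolding n(1)
      by (cases rule: endpoint_sign_table; fold P_def Q_def; simp add: K Ks sgn)
  next
    assume g: "\<not> gray n 0" and n: "n = 4 * a + 3" "n div 2 = 2 * a + 1"
    have sgn: "s > 0" using s g by simp
    from assms(1) show ?thesis
      unfolding count prods n(2) unfolding n(1)
      by (cases rule: endpoint_sign_table; fold P_def Q_def; simp add: K Ks sgn)
  qed
qed

text \<open>Induction on the index: halving the edge replaces \<open>n\<close> by \<open>n div 2\<close>. The base case is the one with only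
  signs \<open>-1\<close> to come.\<close>

lemma card_local_extrema01:
  assumes "edge_profile n x X Y g" "0 < x" "x < 6" "X \<noteq> 0 \<or> Y \<noteq> 0" "continuous_on {0..1} g"
  shows "finite (local_extrema01 g) \<and> card (local_extrema01 g) = extrema_count n X Y"
  using assms
proof (induction n arbitrary: x X Y g rule: less_induct)
  case (less n)
  show ?case
  proof (cases "n = 0")
    case True
    have mono: "local_extrema01 g = {}" if "edge_profile 0 x X Y g" "0 \<le> X" "0 \<le> Y" "X \<noteq> 0 \<or> Y \<noteq> 0"
       "continuous_on {0..1} g" for X Y g
      using that less.prems by (intro strict_antimono_no_extrema edge_profile_decreasing[of x X Y]) auto
    have neg: "edge_profile 0 x (- X) (- Y) (\<lambda>s. - g s)" "continuous_on {0..1} (\<lambda>s. - g s)"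
      using edge_profile_uminus less.prems True by (auto intro!: continuous_intros)
    consider "0 \<le> X" "0 \<le> Y" | "X \<le> 0" "Y \<le> 0" | "X > 0" "Y < 0" | "X < 0" "Y > 0" by linarith
    then show ?thesis
    proof cases
      case 1
      then have "local_extrema01 g = {}" using mono less.prems True by auto
      then show ?thesis using 1 True
        by (auto simp: extrema_count_def zero_less_mult_iff mult_eq_0_iff)
    next
      case 2
      then have "local_extrema01 g = {}"
        using mono[OF neg(1)] neg(2) less.prems by (simp add: local_extrema01_uminus)
      then show ?thesis using 2 True
        by (auto simp: extrema_count_def zero_less_mult_iff mult_eq_0_iff)
    next
      case 3
      then obtain s where "local_extrema01 g = {s}" using single_extremum less.prems True by blast
      then show ?thesis using 3 True by (simp add: extrema_count_def zero_less_mult_iff)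
    next
      case 4
      then obtain s where "local_extrema01 g = {s}"
        using single_extremum[OF neg(1)] neg(2) less.prems by (auto simp: local_extrema01_uminus)
      then show ?thesis using 4 True by (simp add: extrema_count_def zero_less_mult_iff)
    qed
  next
    case False
    from less.prems(1-3) show ?thesis
    proof (cases rule: edge_profileE)
      case (1 t c M k)
      have c: "c \<noteq> 0" using 1(5,6) by auto
      have nz: "c * X \<noteq> 0 \<or> M \<noteq> 0" "M \<noteq> 0 \<or> c * Y \<noteq> 0" using less.prems(4) c 1(7,8) by auto
      note cont = continuous_on_halves(1,2)[OF less.prems(5)]
      have lt: "n div 2 < n" using False by simp
      note left = less.IH[OF lt 1(11,2,3) nz(1) cont(1)]
      note right = less.IH[OF lt 1(12,2,3) nz(2) cont(2)]
      note split = card_local_extrema01_split[OF left[THEN conjunct1] right[THEN conjunct1]]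
      show ?thesis
        using split left right midpoint_extremum_iff[OF less.prems]
          extrema_count_rec[OF less.prems(4) 1(7,5,6)] by (simp add: 1(8))
    qed
  qed
qed

section \<open>Addresses of vertices and cells\<close>

text \<open>Words are reversed here: the head of the list is the innermost map, so that consing subdivides a cell, and \<^term>\<open>vertex q (a # r) i\<close> is a corner of a subcell of the cell \<open>r\<close>.\<close>

definition vertex :: "(3 \<Rightarrow> real^2) \<Rightarrow> 3 list \<Rightarrow> 3 \<Rightarrow> real^2" where
  "vertex q r i = SFw q (rev r) (q i)"

text \<open>Barycentric coordinates of a cell, scaled by \<open>2\<^sup>m\<close> to be integers; corner \<open>i\<close> of the cell has one
  more in coordinate \<open>i\<close>.\<close>

primrec cell_coord :: "3 list \<Rightarrow> 3 \<Rightarrow> int" where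
  "cell_coord [] j = 0"
| "cell_coord (a # r) j = 2 * cell_coord r j + of_bool (j = a)"

text \<open>Every vertex of level \<open>m\<close> outside the boundary is a corner of exactly two \<open>m\<close>-cells. This is the
  involution between its two addresses; its fixed points are the addresses of the boundary vertices.\<close>

primrec other_address :: "3 list \<Rightarrow> 3 \<Rightarrow> 3 list \<times> 3" where
  "other_address [] i = ([], i)"
| "other_address (a # r) i = (if a = i then (snd (other_address r i) # fst (other_address r i), snd (other_address r i)) else (i # r, a))"

lemma SFw_append: "SFw q (v @ w) x = SFw q v (SFw q w x)"
  by (induction v) auto

lemma SF_midpoint: "SF q i (midpoint x y) = midpoint (SF q i x) (SF q i y)"
  by (simp add: SF_def midpoint_def vec_eq_iff field_simps)

lemma SFw_midpoint: "SFw q w (midpoint x y) = midpoint (SFw q w x) (SFw q w y)"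
  by (induction w) (auto simp: SF_midpoint)

lemma vertex_Nil [simp]: "vertex q [] i = q i"
  by (simp add: vertex_def)

lemma vertex_Cons: "vertex q (a # r) i = midpoint (vertex q r a) (vertex q r i)"
proof -
  have "SF q a (q i) = midpoint (q a) (q i)"
    by (simp add: SF_def midpoint_def vec_eq_iff field_simps)
  then show ?thesis by (simp add: vertex_def SFw_append SFw_midpoint)
qed

lemma vertex_Cons_same [simp]: "vertex q (i # r) i = vertex q r i"
  by (simp add: vertex_Cons)

lemma vertex_replicate [simp]: "vertex q (replicate n i) i = q i"
  by (induction n) auto

lemma SFw_eq_coord:
  "SFw q (rev r) x = (1 / 2 ^ length r) *\<^sub>R (x + (\<Sum>j\<in>UNIV. real_of_int (cell_coord r j) *\<^sub>R q j))"
proof (induction r arbitrary: x)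
  case (Cons a r)
  have "(\<Sum>j\<in>UNIV. real_of_int (cell_coord (a # r) j) *\<^sub>R q j)
      = (\<Sum>j\<in>UNIV. 2 *\<^sub>R (real_of_int (cell_coord r j) *\<^sub>R q j) + of_bool (j = a) *\<^sub>R q j)"
    by (simp add: algebra_simps)
  also have "\<dots> = 2 *\<^sub>R (\<Sum>j\<in>UNIV. real_of_int (cell_coord r j) *\<^sub>R q j) + q a"
    by (simp add: sum.distrib scaleR_right.sum of_bool_def if_distrib[of "\<lambda>c. c *\<^sub>R _"] cong: if_cong)
  finally have e: "(\<Sum>j\<in>UNIV. real_of_int (cell_coord (a # r) j) *\<^sub>R q j)
      = 2 *\<^sub>R (\<Sum>j\<in>UNIV. real_of_int (cell_coord r j) *\<^sub>R q j) + q a" .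
  have "SF q a x = (1/2) *\<^sub>R (x + q a)" by (simp add: SF_def vec_eq_iff field_simps)
  moreover have "SFw q (rev (a # r)) x
      = (1 / 2 ^ length r) *\<^sub>R (SF q a x + (\<Sum>j\<in>UNIV. real_of_int (cell_coord r j) *\<^sub>R q j))"
    by (simp add: SFw_append Cons.IH)
  ultimately show ?case
    unfolding e by (simp add: vec_eq_iff field_simps)
qed simp

lemma vertex_eq_coord:
  "vertex q r i = (1 / 2 ^ length r) *\<^sub>R
     (\<Sum>j\<in>UNIV. (of_bool (j = i) + real_of_int (cell_coord r j)) *\<^sub>R q j)"
proof -
  have "(\<Sum>j\<in>UNIV. (of_bool (j = i) + real_of_int (cell_coord r j)) *\<^sub>R q j)
      = q i + (\<Sum>j\<in>UNIV. real_of_int (cell_coord r j) *\<^sub>R q j)"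
    by (simp add: scaleR_left_distrib sum.distrib of_bool_def if_distrib[of "\<lambda>c. c *\<^sub>R _"] cong: if_cong)
  then show ?thesis by (simp add: vertex_def SFw_eq_coord)
qed

lemma sum_cell_coord: "(\<Sum>j\<in>UNIV. cell_coord r j) = 2 ^ length r - 1"
  by (induction r) (auto simp: sum.distrib simp flip: sum_distrib_left)

text \<open>The Gram matrix of two sides of an equilateral triangle is nonsingular.\<close>

lemma equilateral_affine_independent:
  assumes "equilateral q" "(\<Sum>j\<in>UNIV. c j *\<^sub>R q j) = 0" "(\<Sum>j\<in>UNIV. c j) = 0"
  shows "c j = 0"
proof -
  obtain d where d: "d > 0" "\<And>i j. i \<noteq> j \<Longrightarrow> dist (q i) (q j) = d"
    using assms(1) unfolding equilateral_def by blast
  define v w where "v = q 1 - q 3" and "w = q 2 - q 3"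
  have ne: "(1::3) \<noteq> 3" "(2::3) \<noteq> 3" "(1::3) \<noteq> 2" by simp_all
  have "norm v = d" "norm w = d" "norm (v - w) = d"
    using d(2)[OF ne(1)] d(2)[OF ne(2)] d(2)[OF ne(3)] by (simp_all add: v_def w_def dist_norm)
  then have vv: "v \<bullet> v = d\<^sup>2" "w \<bullet> w = d\<^sup>2" "(v - w) \<bullet> (v - w) = d\<^sup>2"
    by (simp_all add: dot_square_norm)
  then have vw: "v \<bullet> w = d\<^sup>2 / 2" by (simp add: inner_diff inner_commute)
  have c3: "c 3 = - c 1 - c 2" using assms(3) by (simp add: sum_3)
  have "c 1 *\<^sub>R v + c 2 *\<^sub>R w = 0"
    using assms(2) by (simp add: sum_3 c3 v_def w_def algebra_simps)
  then have "(c 1 *\<^sub>R v + c 2 *\<^sub>R w) \<bullet> v = 0" "(c 1 *\<^sub>R v + c 2 *\<^sub>R w) \<bullet> w = 0" by simp_all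
  then have "(2 * c 1 + c 2) * d\<^sup>2 = 0" "(c 1 + 2 * c 2) * d\<^sup>2 = 0"
    using vv vw by (simp_all add: inner_add inner_commute algebra_simps)
  then have "2 * c 1 + c 2 = 0" "c 1 + 2 * c 2 = 0" using d(1) by simp_all
  then have "c 1 = 0" "c 2 = 0" by linarith+
  with c3 show ?thesis using exhaust_3[of j] by auto
qed

lemma barycentric_unique:
  assumes "equilateral q" "(\<Sum>j\<in>UNIV. c j *\<^sub>R q j) = (\<Sum>j\<in>UNIV. c' j *\<^sub>R q j)"
    "(\<Sum>j\<in>UNIV. c j) = (\<Sum>j\<in>UNIV. c' j)"
  shows "c j = c' j"
  using equilateral_affine_independent[OF assms(1), of "\<lambda>j. c j - c' j" j] assms(2,3)
  by (simp add: scaleR_left_diff_distrib sum_subtractf)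

lemma vertex_eq_imp_coord_eq:
  assumes "equilateral q" "vertex q r i = vertex q r' i'" "length r = length r'"
  shows "of_bool (j = i) + cell_coord r j = of_bool (j = i') + cell_coord r' j"
proof -
  have total: "(\<Sum>j\<in>UNIV. of_bool (j = i) + real_of_int (cell_coord r j)) = 2 ^ length r" for r i
  proof -
    have "(\<Sum>j\<in>UNIV. of_bool (j = i) + real_of_int (cell_coord r j))
        = 1 + real_of_int (\<Sum>j\<in>UNIV. cell_coord r j)"
      by (simp add: sum.distrib)
    then show ?thesis by (simp only: sum_cell_coord) simp
  qed
  have "(\<Sum>j\<in>UNIV. (of_bool (j = i) + real_of_int (cell_coord r j)) *\<^sub>R q j)
      = (\<Sum>j\<in>UNIV. (of_bool (j = i') + real_of_int (cell_coord r' j)) *\<^sub>R q j)"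
    using assms(2) unfolding vertex_eq_coord assms(3) scaleR_cancel_left by simp
  moreover have "(\<Sum>j\<in>UNIV. of_bool (j = i) + real_of_int (cell_coord r j))
      = (\<Sum>j\<in>UNIV. of_bool (j = i') + real_of_int (cell_coord r' j))"
    unfolding total assms(3) ..
  ultimately have "of_bool (j = i) + real_of_int (cell_coord r j) = of_bool (j = i') + real_of_int (cell_coord r' j)"
    by (rule barycentric_unique[OF assms(1)])
  then have "real_of_int (of_bool (j = i) + cell_coord r j) = real_of_int (of_bool (j = i') + cell_coord r' j)"
    by simp
  then show ?thesis by (simp only: of_int_eq_iff)
qed

text \<open>The last letter of the word is the only coordinate that is odd.\<close>

lemma cell_coord_inj:
  assumes "\<And>j. cell_coord r j = cell_coord r' j" "length r = length r'"
  shows "r = r'"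
  using assms
proof (induction r arbitrary: r')
  case (Cons a r)
  then obtain b s where r': "r' = b # s" "length r = length s" by (cases r') auto
  have eq: "2 * cell_coord r j + of_bool (j = a) = 2 * cell_coord s j + of_bool (j = b)" for j
    using Cons.prems(1)[of j] by (simp add: r')
  have ab: "a = b"
  proof (rule ccontr)
    assume "a \<noteq> b"
    then have "2 * cell_coord r a + 1 = 2 * cell_coord s a" using eq[of a] by simp
    then show False by presburger
  qed
  then have "cell_coord r j = cell_coord s j" for j using eq[of j] by simp
  then show ?case using Cons.IH r' ab by blast
qed simp

text \<open>Compare the coordinates modulo \<open>2\<close>. If the last letter is the corner itself, all coordinates are even
  and the question descends one level; otherwise the vertex is a midpoint, and the two odd coordinates
  are the two ends of the edge it halves.\<close>

lemma coord_eq_imp_other_address: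
  assumes "\<And>j. of_bool (j = i) + cell_coord r j = of_bool (j = i') + cell_coord r' j"
    and "length r = length r'"
  shows "(r', i') = (r, i) \<or> (r', i') = other_address r i"
  using assms
proof (induction r arbitrary: i r' i')
  case Nil
  then show ?case by (auto dest: spec[of _ i'] simp: of_bool_def split: if_splits) (metis one_neq_zero)
next
  case (Cons a r)
  then obtain b s where r': "r' = b # s" "length r = length s" by (cases r') auto
  have eq: "of_bool (j = i) + (2 * cell_coord r j + of_bool (j = a))
      = of_bool (j = i') + (2 * cell_coord s j + of_bool (j = b))" for j
    using Cons.prems(1)[of j] by (simp add: r')
  have parity: "((j = i) \<noteq> (j = a)) = ((j = i') \<noteq> (j = b))" for j
  proof -
    have "even (of_bool (j = i) + (2 * cell_coord r j + of_bool (j = a)))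
      = even (of_bool (j = i') + (2 * cell_coord s j + of_bool (j = b)))" by (simp only: eq)
    then show ?thesis by (auto simp: of_bool_def split: if_splits)
  qed
  show ?case
  proof (cases "a = i")
    case True
    then have b: "b = i'" using parity[of b] by auto
    have "of_bool (j = i) + cell_coord r j = of_bool (j = i') + cell_coord s j" for j
      using eq[of j] True b by (auto simp: of_bool_def split: if_splits)
    from Cons.IH[OF this r'(2)] show ?thesis
    proof
      assume "(s, i') = (r, i)"
      then show ?thesis using True b r' by simp
    next
      assume "(s, i') = other_address r i"
      then show ?thesis using True b r' by (metis fst_conv other_address.simps(2) snd_conv)
    qed
  next
    case False
    have "a = i' \<and> i = b \<or> a = b \<and> i = i'"
      using parity[of a] parity[of i] False by auto
    moreover from this have "cell_coord r j = cell_coord s j" for j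
      using eq[of j] by auto
    then have "s = r" using cell_coord_inj r'(2) by metis
    ultimately show ?thesis using r' False by auto
  qed
qed

lemma length_other_address [simp]: "length (fst (other_address r i)) = length r"
  by (induction r arbitrary: i) auto

lemma vertex_other_address: "vertex q (fst (other_address r i)) (snd (other_address r i)) = vertex q r i"
  by (induction r arbitrary: i) (auto simp: vertex_Cons midpoint_sym)

lemma other_address_involution: "other_address (fst (other_address r i)) (snd (other_address r i)) = (r, i)"
  by (induction r arbitrary: i) auto

lemma other_address_fixed: "fst (other_address r i) = r \<longleftrightarrow> other_address r i = (r, i)"
proof (induction r arbitrary: i)
  case (Cons a r)
  from Cons[of i] show ?case by (cases "other_address r i") auto
qed auto

lemma other_address_fixed_iff: "other_address r i = (r, i) \<longleftrightarrow> r = replicate (length r) i"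
proof (induction r arbitrary: i)
  case (Cons a r)
  from Cons[of i] show ?case by (cases "other_address r i") auto
qed auto

lemma vertex_eq_iff:
  assumes "equilateral q" "length r = length r'"
  shows "vertex q r i = vertex q r' i' \<longleftrightarrow> (r', i') = (r, i) \<or> (r', i') = other_address r i"
proof
  assume "vertex q r i = vertex q r' i'"
  then show "(r', i') = (r, i) \<or> (r', i') = other_address r i"
    using coord_eq_imp_other_address[OF vertex_eq_imp_coord_eq[OF assms(1)] assms(2)] assms(2) by blast
next
  assume "(r', i') = (r, i) \<or> (r', i') = other_address r i"
  then show "vertex q r i = vertex q r' i'"
    using vertex_other_address[of q r i] by (cases "other_address r i") auto
qed

lemma vertex_inj:
  assumes "equilateral q"
  shows "vertex q r i = vertex q r j \<longleftrightarrow> i = j"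
  using vertex_eq_imp_coord_eq[OF assms, of r i r j i] by (auto simp: of_bool_def split: if_splits)

lemma V_eq: "V q m = {vertex q r i | r i. length r = m}"
proof (induction m)
  case (Suc m)
  have snoc: "vertex q (r @ [a]) i = SF q a (vertex q r i)" for r a i by (simp add: vertex_def)
  show ?case
  proof (intro equalityI subsetI)
    fix x assume "x \<in> V q (Suc m)"
    then obtain a r i where "x = vertex q (r @ [a]) i" "length r = m" using Suc snoc by auto
    then show "x \<in> {vertex q r i | r i. length r = Suc m}" by force
  next
    fix x assume "x \<in> {vertex q r i | r i. length r = Suc m}"
    then obtain s i where "x = vertex q s i" "length s = Suc m" by blast
    then obtain r a where r: "x = SF q a (vertex q r i)" "length r = m"
      using snoc by (cases s rule: rev_cases) auto
    then have "vertex q r i \<in> V q m" using Suc by blast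
    then show "x \<in> V q (Suc m)" using r by auto
  qed
qed auto

lemma vertex_in_V: "length r = m \<Longrightarrow> vertex q r i \<in> V q m"
  unfolding V_eq by blast

lemma vertex_in_V0_iff:
  assumes "equilateral q"
  shows "vertex q r i \<in> V q 0 \<longleftrightarrow> other_address r i = (r, i)"
proof
  assume "vertex q r i \<in> V q 0"
  then obtain k where "vertex q r i = q k" by auto
  then have "vertex q (replicate (length r) k) k = vertex q r i" by simp
  then have "(r, i) = (replicate (length r) k, k) \<or> (r, i) = other_address (replicate (length r) k) k"
    using vertex_eq_iff[OF assms, of "replicate (length r) k" r k i] by simp
  moreover have "other_address (replicate (length r) k) k = (replicate (length r) k, k)"
    by (simp add: other_address_fixed_iff)
  ultimately show "other_address r i = (r, i)" by auto
next
  assume "other_address r i = (r, i)"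
  then have "r = replicate (length r) i" by (simp add: other_address_fixed_iff)
  then have "vertex q r i = q i" by (metis vertex_replicate)
  then show "vertex q r i \<in> V q 0" by simp
qed

lemma adj_iff:
  assumes "equilateral q"
  shows "adj q m x y \<longleftrightarrow> (\<exists>r i j. length r = m \<and> i \<noteq> j \<and> x = vertex q r i \<and> y = vertex q r j)"
proof
  assume "adj q m x y"
  then obtain w i j where "x \<noteq> y" "length w = m" "x = SFw q w (q i)" "y = SFw q w (q j)"
    unfolding adj_def by blast
  then show "\<exists>r i j. length r = m \<and> i \<noteq> j \<and> x = vertex q r i \<and> y = vertex q r j"
    by (intro exI[of _ "rev w"] exI[of _ i] exI[of _ j]) (auto simp: vertex_def)
next
  assume "\<exists>r i j. length r = m \<and> i \<noteq> j \<and> x = vertex q r i \<and> y = vertex q r j"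
  then obtain r i j where h: "length r = m" "i \<noteq> j" "x = vertex q r i" "y = vertex q r j" by blast
  then have "x \<noteq> y" using vertex_inj[OF assms] by simp
  then show "adj q m x y"
    unfolding adj_def using h by (auto intro!: exI[of _ "rev r"] simp: vertex_def)
qed

text \<open>The neighbours of a vertex are the remaining corners of the cells given by its addresses.\<close>

lemma neighbours:
  assumes "equilateral q" "length r = m"
  shows "{y. adj q m (vertex q r i) y} = vertex q r ` (UNIV - {i})
     \<union> vertex q (fst (other_address r i)) ` (UNIV - {snd (other_address r i)})"
proof (intro equalityI subsetI)
  fix y assume "y \<in> {y. adj q m (vertex q r i) y}"
  then obtain s k j where h: "length s = m" "k \<noteq> j" "vertex q r i = vertex q s k" "y = vertex q s j"
    using adj_iff[OF assms(1)] by auto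
  have "(s, k) = (r, i) \<or> (s, k) = other_address r i" using vertex_eq_iff[OF assms(1)] h assms(2) by metis
  then show "y \<in> vertex q r ` (UNIV - {i}) \<union> vertex q (fst (other_address r i)) ` (UNIV - {snd (other_address r i)})"
    using h(2,4) by (metis DiffI UnI1 UnI2 UNIV_I fst_conv image_eqI singletonD snd_conv)
next
  fix y assume "y \<in> vertex q r ` (UNIV - {i}) \<union> vertex q (fst (other_address r i)) ` (UNIV - {snd (other_address r i)})"
  then show "y \<in> {y. adj q m (vertex q r i) y}"
  proof
    assume "y \<in> vertex q r ` (UNIV - {i})"
    then obtain j where "y = vertex q r j" "i \<noteq> j" by auto
    then show ?thesis unfolding mem_Collect_eq adj_iff[OF assms(1)] using assms(2) by blast
  next
    assume "y \<in> vertex q (fst (other_address r i)) ` (UNIV - {snd (other_address r i)})"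
    then obtain j where "y = vertex q (fst (other_address r i)) j" "snd (other_address r i) \<noteq> j" by auto
    moreover have "vertex q r i = vertex q (fst (other_address r i)) (snd (other_address r i))" by (simp add: vertex_other_address)
    ultimately show ?thesis unfolding mem_Collect_eq adj_iff[OF assms(1)]
      using assms(2) length_other_address by blast
  qed
qed

lemma sum_neighbours:
  fixes f :: "real^2 \<Rightarrow> real"
  assumes "equilateral q" "length r = m"
  shows "(\<Sum>y | adj q m (vertex q r i) y. f y) = (\<Sum>j\<in>UNIV - {i}. f (vertex q r j))
    + (if other_address r i = (r, i) then 0 else \<Sum>j\<in>UNIV - {snd (other_address r i)}. f (vertex q (fst (other_address r i)) j))"
proof -
  let ?s = "fst (other_address r i)" and ?k = "snd (other_address r i)"
  let ?A = "vertex q r ` (UNIV - {i})" and ?B = "vertex q ?s ` (UNIV - {?k})"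
  have reindex: "(\<Sum>y\<in>vertex q r ` S. f y) = (\<Sum>j\<in>S. f (vertex q r j))" for r S
    by (rule sum.reindex_cong[OF _ refl refl]) (auto simp: inj_on_def vertex_inj[OF assms(1)])
  show ?thesis
  proof (cases "other_address r i = (r, i)")
    case True
    then show ?thesis unfolding neighbours[OF assms] by (simp add: reindex)
  next
    case False
    have "?A \<inter> ?B = {}"
    proof (rule equals0I)
      fix y assume "y \<in> ?A \<inter> ?B"
      then obtain j k where jk: "j \<noteq> i" "k \<noteq> ?k" "vertex q r j = vertex q ?s k" by auto
      note e1 = vertex_eq_imp_coord_eq[OF assms(1) jk(3) length_other_address[symmetric]]
      note e2 = vertex_eq_imp_coord_eq[OF assms(1) vertex_other_address[of q r i] length_other_address]
      have ik: "i = ?k" using e1[of i] e2[of i] jk by (auto simp: of_bool_def split: if_splits)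
      then have "cell_coord r j = cell_coord ?s j" for j using e2[of j] by simp
      then have "?s = r" using cell_coord_inj[of r ?s] by simp
      then show False using False other_address_fixed by blast
    qed
    then show ?thesis unfolding neighbours[OF assms] using False
      by (subst sum.union_disjoint) (auto simp: reindex)
  qed
qed

definition cell_sum :: "(3 \<Rightarrow> real^2) \<Rightarrow> (real^2 \<Rightarrow> real) \<Rightarrow> 3 list \<Rightarrow> real" where
  "cell_sum q u r = (\<Sum>j\<in>UNIV. u (vertex q r j))"

lemma cell_sum_remove: "(\<Sum>j\<in>UNIV - {i}. u (vertex q r j)) = cell_sum q u r - u (vertex q r i)"
  unfolding cell_sum_def by (simp add: sum_diff1)

lemma card_remove_3: "card (UNIV - {i::3}) = 2"
  by (simp add: card_Diff_singleton)

text \<open>In terms of cell sums, the eigenvalue equation says that the sums over the two cells at a vertex add up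
  to \<open>(6 - x) * u\<close>. All later arguments about graph eigenfunctions start from this form.\<close>

lemma graph_laplacian_vertex:
  assumes "equilateral q" "length r = m" "other_address r i \<noteq> (r, i)"
  shows "graph_laplacian q m u (vertex q r i)
    = cell_sum q u r + cell_sum q u (fst (other_address r i)) - 6 * u (vertex q r i)"
  unfolding graph_laplacian_def sum_neighbours[OF assms(1,2)]
  using assms(3) by (simp add: sum_subtractf cell_sum_remove card_remove_3 vertex_other_address)

lemma corner_laplacian:
  assumes "equilateral q"
  shows "(\<Sum>y | adj q m (q i) y. u (q i) - u y) = 3 * u (q i) - cell_sum q u (replicate m i)"
proof -
  have "other_address (replicate m i) i = (replicate m i, i)" by (simp add: other_address_fixed_iff)
  then show ?thesis
    using sum_neighbours[OF assms, of "replicate m i" m "\<lambda>y. u (q i) - u y" i]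
    by (simp add: sum_subtractf cell_sum_remove card_remove_3)
qed

definition cell :: "(3 \<Rightarrow> real^2) \<Rightarrow> 3 list \<Rightarrow> (real^2) set" where
  "cell q r = SFw q (rev r) ` SG q"

lemma SG_eq: "SG q = (\<Union>i. SF q i ` SG q)"
  using SF_attractor_SG[of q] unfolding SF_attractor_def by blast

lemma compact_SG: "compact (SG q)"
  using SF_attractor_SG[of q] unfolding SF_attractor_def by blast

lemma Vstar_subset_SG: "Vstar q \<subseteq> SG q"
  by (simp add: SG_eq_closure closure_subset)

lemma V_subset_SG: "V q m \<subseteq> SG q"
  using Vstar_subset_SG by (force simp: Vstar_def)

lemma SG_subset_hull: "SG q \<subseteq> convex hull (range q)"
proof -
  have "closed (convex hull (range q))"
    by (intro compact_imp_closed compact_convex_hull finite_imp_compact finite_imageI) simp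
  moreover have "Vstar q \<subseteq> convex hull (range q)" unfolding Vstar_def using V_subset_hull by blast
  ultimately show ?thesis unfolding SG_eq_closure by (intro closure_minimal)
qed

lemma vertex_in_cell: "vertex q r i \<in> cell q r"
proof -
  have "q i \<in> SG q" using V_subset_SG[of q 0] by auto
  then show ?thesis unfolding cell_def vertex_def by blast
qed

lemma cell_Cons_subset: "cell q (a # r) \<subseteq> cell q r"
  unfolding cell_def using SG_eq[of q] by (auto simp: SFw_append)

lemma ex_cell_Cons:
  assumes "x \<in> cell q r"
  obtains a where "x \<in> cell q (a # r)"
proof -
  obtain y where y: "y \<in> SG q" "x = SFw q (rev r) y" using assms unfolding cell_def by blast
  then obtain a z where "z \<in> SG q" "y = SF q a z" using SG_eq[of q] by blast
  then have "x \<in> cell q (a # r)" unfolding cell_def using y by (auto simp: SFw_append)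
  then show thesis by (rule that)
qed

lemma ex_cell:
  assumes "x \<in> SG q"
  shows "\<exists>r. length r = n \<and> x \<in> cell q r"
proof (induction n)
  case 0
  then show ?case using assms by (simp add: cell_def)
next
  case (Suc n)
  then obtain r where r: "length r = n" "x \<in> cell q r" by blast
  then obtain a where "x \<in> cell q (a # r)" using ex_cell_Cons by blast
  then show ?case using r by (intro exI[of _ "a # r"]) simp
qed

lemma cell_subset_SG: "cell q r \<subseteq> SG q"
proof (induction r)
  case (Cons a r)
  then show ?case using cell_Cons_subset by blast
qed (simp add: cell_def)

lemma SFw_continuous: "continuous_on S (SFw q w)"
proof (induction w)
  case (Cons a w)
  show ?case unfolding SFw.simps
    by (rule continuous_on_compose[OF Cons SF_continuous])
qed (simp add: id_def)

lemma closed_cell: "closed (cell q r)"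
  unfolding cell_def
  by (intro compact_imp_closed compact_continuous_image SFw_continuous compact_SG)

lemma SG_barycentric:
  assumes "equilateral q" "x \<in> SG q"
  obtains c :: "3 \<Rightarrow> real" where "\<And>j. c j \<ge> 0" "(\<Sum>j\<in>UNIV. c j) = 1" "x = (\<Sum>j\<in>UNIV. c j *\<^sub>R q j)"
proof -
  have inj: "inj q" using vertex_inj[OF assms(1), of "[]"] by (simp add: inj_def)
  have "x \<in> convex hull (range q)" using assms(2) SG_subset_hull by blast
  then obtain u where u: "\<forall>x\<in>range q. 0 \<le> u x" "sum u (range q) = 1" "(\<Sum>x\<in>range q. u x *\<^sub>R x) = x"
    unfolding convex_hull_finite[OF finite_imageI[OF finite]] by blast
  show thesis
  proof (rule that[of "\<lambda>j. u (q j)"])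
    show "(\<Sum>j\<in>UNIV. u (q j)) = 1" using u(2) sum.reindex[OF inj, of u] by simp
    show "x = (\<Sum>j\<in>UNIV. u (q j) *\<^sub>R q j)"
      using u(3) sum.reindex[OF inj, of "\<lambda>x. u x *\<^sub>R x"] by simp
  qed (use u in auto)
qed

text \<open>A common point has barycentric coordinates in \<open>[0, 1]\<close> relative to each cell, and the two sets of
  coordinates differ by a nonzero integer vector with sum \<open>0\<close>. Such a vector has an entry \<open>\<ge> 1\<close> and an
  entry \<open>\<le> -1\<close>, which leaves only corners.\<close>

lemma cells_meet_at_vertices:
  assumes "equilateral q" "x \<in> cell q r" "x \<in> cell q r'" "length r = length r'" "r \<noteq> r'"
  obtains i i' where "x = vertex q r i" "x = vertex q r' i'"
proof -
  obtain y y' where y: "y \<in> SG q" "x = SFw q (rev r) y" and y': "y' \<in> SG q" "x = SFw q (rev r') y'"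
    using assms(2,3) unfolding cell_def by blast
  obtain c where c: "\<And>j. c j \<ge> 0" "(\<Sum>j\<in>UNIV. c j) = 1" "y = (\<Sum>j\<in>UNIV. c j *\<^sub>R q j)"
    using SG_barycentric[OF assms(1) y(1)] by blast
  obtain c' where c': "\<And>j. c' j \<ge> 0" "(\<Sum>j\<in>UNIV. c' j) = 1" "y' = (\<Sum>j\<in>UNIV. c' j *\<^sub>R q j)"
    using SG_barycentric[OF assms(1) y'(1)] by blast
  have total: "(\<Sum>j\<in>UNIV. real_of_int (cell_coord r j)) = real_of_int (2 ^ length r - 1)" for r
    by (simp only: sum_cell_coord flip: of_int_sum)
  have "x = (1 / 2 ^ length r) *\<^sub>R (\<Sum>j\<in>UNIV. (c j + real_of_int (cell_coord r j)) *\<^sub>R q j)"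
    unfolding y(2) SFw_eq_coord c(3) by (simp add: scaleR_left_distrib sum.distrib)
  moreover have "x = (1 / 2 ^ length r') *\<^sub>R (\<Sum>j\<in>UNIV. (c' j + real_of_int (cell_coord r' j)) *\<^sub>R q j)"
    unfolding y'(2) SFw_eq_coord c'(3) by (simp add: scaleR_left_distrib sum.distrib)
  ultimately have "(1 / 2 ^ length r') *\<^sub>R (\<Sum>j\<in>UNIV. (c j + real_of_int (cell_coord r j)) *\<^sub>R q j) 
      = (1 / 2 ^ length r') *\<^sub>R (\<Sum>j\<in>UNIV. (c' j + real_of_int (cell_coord r' j)) *\<^sub>R q j)"
    using assms(4) by simp
  then have "(\<Sum>j\<in>UNIV. (c j + real_of_int (cell_coord r j)) *\<^sub>R q j) 
      = (\<Sum>j\<in>UNIV. (c' j + real_of_int (cell_coord r' j)) *\<^sub>R q j)" by simp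
  then have eq: "c j + real_of_int (cell_coord r j) = c' j + real_of_int (cell_coord r' j)" for j
    by (rule barycentric_unique[OF assms(1)]) (simp add: sum.distrib c c' total assms(4))
  obtain k where k: "cell_coord r k \<noteq> cell_coord r' k" using cell_coord_inj assms(4,5) by blast
  have corner: "\<exists>j. y = q j" if c: "\<And>j. c j \<ge> 0" "(\<Sum>j\<in>UNIV. c j) = 1" "y = (\<Sum>j\<in>UNIV. c j *\<^sub>R q j)"
    and one: "c k \<ge> 1" for c :: "3 \<Rightarrow> real" and y k
  proof -
    have split: "(\<Sum>j\<in>UNIV. c j) = c k + (\<Sum>j\<in>UNIV - {k}. c j)" by (rule sum.remove) auto
    have "(\<Sum>j\<in>UNIV - {k}. c j) \<ge> 0" using c(1) by (intro sum_nonneg) auto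
    then have "(\<Sum>j\<in>UNIV - {k}. c j) = 0" "c k = 1" using split c(2) one by linarith+
    then have "c j = 0" if "j \<noteq> k" for j using that c(1) by (simp add: sum_nonneg_eq_0_iff)
    then have "y = (\<Sum>j\<in>UNIV. (if j = k then q j else 0))"
      unfolding c(3) by (intro sum.cong) (auto simp: \<open>c k = 1\<close>)
    then show ?thesis by auto
  qed
  have sum0: "(\<Sum>j\<in>UNIV. cell_coord r j - cell_coord r' j) = 0"
    by (simp add: sum_subtractf sum_cell_coord assms(4))
  have "\<exists>j. cell_coord r j - cell_coord r' j \<ge> 1"
  proof (rule ccontr)
    assume "\<not> ?thesis"
    then have lt: "cell_coord r j - cell_coord r' j < 1" for j by (auto simp: not_le)
    have "\<forall>j. 0 \<le> cell_coord r' j - cell_coord r j"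
    proof
      fix j show "0 \<le> cell_coord r' j - cell_coord r j" using lt[of j] by linarith
    qed
    moreover have "(\<Sum>j\<in>UNIV. cell_coord r' j - cell_coord r j) = 0"
      using sum0 by (simp add: sum_subtractf)
    ultimately show False using k by (simp add: sum_nonneg_eq_0_iff)
  qed
  moreover have "\<exists>j. cell_coord r' j - cell_coord r j \<ge> 1"
  proof (rule ccontr)
    assume "\<not> ?thesis"
    then have lt: "cell_coord r' j - cell_coord r j < 1" for j by (auto simp: not_le)
    have "\<forall>j. 0 \<le> cell_coord r j - cell_coord r' j"
    proof
      fix j show "0 \<le> cell_coord r j - cell_coord r' j" using lt[of j] by linarith
    qed
    then show False using k sum0 by (simp add: sum_nonneg_eq_0_iff)
  qed
  ultimately obtain a b where ab: "cell_coord r a - cell_coord r' a \<ge> 1" "cell_coord r' b - cell_coord r b \<ge> 1"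
    by blast
  have "c' a \<ge> 1" "c b \<ge> 1" using eq[of a] eq[of b] ab c(1)[of a] c'(1)[of b] by linarith+
  then obtain i i' where "y = q i" "y' = q i'" using corner c c' by metis
  then show thesis using that y y' unfolding vertex_def by blast
qed

section \<open>Local extension and the eigenvalue equation\<close>

text \<open>For a solution of the eigenvalue equation the normal derivatives of two adjacent cells at their common
  vertex add up to \<open>0\<close>.\<close>

definition normal_deriv :: "real \<Rightarrow> (3 \<Rightarrow> real) \<Rightarrow> 3 \<Rightarrow> real" where
  "normal_deriv x f i = (6 - x) * f i - 2 * sum f UNIV"

text \<open>The local extension algorithm, restricted to subcell \<open>a\<close> of a cell with corner values \<open>f\<close>. The formula is
  symmetric in \<open>a\<close> and \<open>i\<close>, as the two subcells share the midpoint; summing over all corners avoids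
  naming the third one.\<close>

definition subcell :: "real \<Rightarrow> (3 \<Rightarrow> real) \<Rightarrow> 3 \<Rightarrow> 3 \<Rightarrow> real" where
  "subcell t f a i = (if a = i then f i
     else ((2 - t) * (f a + f i) + 2 * sum f UNIV) / ((2 - t) * (5 - t)))"

lemma UNIV_3_distinct: "distinct [i, j, k] \<Longrightarrow> UNIV = {i, j, k :: 3}"
  by (rule card_subset_eq[symmetric]) auto

lemma sum_3_distinct:
  fixes f :: "3 \<Rightarrow> 'a::comm_monoid_add"
  assumes "distinct [i, j, k]"
  shows "sum f UNIV = f i + f j + f k"
  unfolding UNIV_3_distinct[OF assms] using assms by (simp add: add.assoc)

lemma ex_third:
  assumes "i \<noteq> (j::3)"
  obtains k where "distinct [i, j, k]"
proof -
  have "card {i, j} < card (UNIV :: 3 set)" using assms by simp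
  then have "{i, j} \<noteq> UNIV" by (metis less_irrefl)
  then obtain k where "k \<notin> {i, j}" by blast
  then have "distinct [i, j, k]" using assms by auto
  then show thesis by (rule that)
qed

lemma normal_deriv_diff: "normal_deriv x f i - normal_deriv x f j = (6 - x) * (f i - f j)"
  by (simp add: normal_deriv_def algebra_simps)

lemma normal_deriv_subcell_same:
  assumes "x = t * (5 - t)" "t \<noteq> 2" "t \<noteq> 5"
  shows "normal_deriv t (subcell t f i) i = corner_factor t * normal_deriv x f i"
proof -
  obtain j where "i \<noteq> j" by (metis (full_types) one_neq_zero)
  then obtain k where d: "distinct [i, j, k]" using ex_third by metis
  have nz: "2 - t \<noteq> 0" "5 - t \<noteq> 0" using assms by auto
  show ?thesis
    unfolding normal_deriv_def sum_3_distinct[OF d] subcell_def corner_factor_def assms(1)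
    using d nz by (simp add: divide_simps) (simp add: algebra_simps)
qed

lemma normal_deriv_subcell_mid:
  assumes "t \<noteq> 2" "t \<noteq> 5" "a \<noteq> i"
  shows "normal_deriv t (subcell t f a) i = mid_factor t * (f i - f a)"
proof -
  obtain k where d: "distinct [i, a, k]" using ex_third assms(3) by metis
  have nz: "2 - t \<noteq> 0" "5 - t \<noteq> 0" using assms by auto
  show ?thesis
    unfolding normal_deriv_def sum_3_distinct[OF d] subcell_def mid_factor_def
    using d nz assms(3) by (simp add: divide_simps) (simp add: algebra_simps)
qed

lemma subcell_zero_imp_zero:
  assumes "t \<noteq> 2" "t < 5" "\<And>a i. a \<noteq> i \<Longrightarrow> subcell t f a i = 0"
  shows "f i = 0"
proof -
  obtain j where "i \<noteq> j" by (metis (full_types) one_neq_zero)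
  then obtain k where d: "distinct [i, j, k]" using ex_third by metis
  define S where "S = sum f UNIV"
  have S: "S = f i + f j + f k" unfolding S_def sum_3_distinct[OF d] ..
  have e: "(2 - t) * (f a + f b) + 2 * S = 0" if "a \<noteq> b" for a b
    using assms(3)[OF that] that assms(1,2) by (simp add: subcell_def S_def)
  have "(2 - t) * (f i + f j) + 2 * S = 0" "(2 - t) * (f i + f k) + 2 * S = 0"
    "(2 - t) * (f j + f k) + 2 * S = 0" using e d by auto
  then have "(10 - 2 * t) * S = 0" using S by algebra
  then have "S = 0" using assms(2) by simp
  then have "f i + f j = 0" "f i + f k = 0" "f j + f k = 0"
    using e[of i j] e[of i k] e[of j k] d assms(1) by auto
  then show ?thesis by linarith
qed

abbreviation cell_values :: "(3 \<Rightarrow> real^2) \<Rightarrow> (real^2 \<Rightarrow> real) \<Rightarrow> 3 list \<Rightarrow> 3 \<Rightarrow> real" where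
  "cell_values q u r \<equiv> (\<lambda>j. u (vertex q r j))"

lemma local_extension_iff:
  "local_extension q m t u \<longleftrightarrow>
    (\<forall>r a i. length r = m \<longrightarrow> u (vertex q (a # r) i) = subcell t (cell_values q u r) a i)"
proof
  assume L: "local_extension q m t u"
  show "\<forall>r a i. length r = m \<longrightarrow> u (vertex q (a # r) i) = subcell t (cell_values q u r) a i"
  proof (intro allI impI)
    fix r :: "3 list" and a i :: 3
    assume r: "length r = m"
    show "u (vertex q (a # r) i) = subcell t (cell_values q u r) a i"
    proof (cases "a = i")
      case False
      then obtain k where d: "distinct [a, i, k]" using ex_third by metis
      have "u (vertex q (a # r) i) =
        ((4 - t) * (u (vertex q r a) + u (vertex q r i)) + 2 * u (vertex q r k)) / ((2 - t) * (5 - t))"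
        using L[unfolded local_extension_def, rule_format, of "rev r", OF _ d] r
        by (simp add: vertex_Cons vertex_def[symmetric])
      also have "(4 - t) * (u (vertex q r a) + u (vertex q r i)) + 2 * u (vertex q r k)
         = (2 - t) * (u (vertex q r a) + u (vertex q r i)) + 2 * sum (cell_values q u r) UNIV"
        unfolding sum_3_distinct[OF d] by (simp add: algebra_simps)
      finally show ?thesis using False by (simp add: subcell_def)
    qed (simp add: subcell_def)
  qed
next
  assume R: "\<forall>r a i. length r = m \<longrightarrow> u (vertex q (a # r) i) = subcell t (cell_values q u r) a i"
  show "local_extension q m t u"
    unfolding local_extension_def
  proof (intro allI impI)
    fix w :: "3 list" and i j k :: 3
    assume w: "length w = m" and d: "distinct [i, j, k]"
    have "u (vertex q (i # rev w) j) = subcell t (cell_values q u (rev w)) i j" using R w by simp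
    also have "\<dots> = ((2 - t) * (u (vertex q (rev w) i) + u (vertex q (rev w) j))
        + 2 * sum (cell_values q u (rev w)) UNIV) / ((2 - t) * (5 - t))"
      using d by (simp add: subcell_def)
    also have "(2 - t) * (u (vertex q (rev w) i) + u (vertex q (rev w) j)) + 2 * sum (cell_values q u (rev w)) UNIV
       = (4 - t) * (u (vertex q (rev w) i) + u (vertex q (rev w) j)) + 2 * u (vertex q (rev w) k)"
      unfolding sum_3_distinct[OF d] by (simp add: algebra_simps)
    finally show "u (midpoint (SFw q w (q i)) (SFw q w (q j))) =
          ((4 - t) * (u (SFw q w (q i)) + u (SFw q w (q j))) + 2 * u (SFw q w (q k))) / ((2 - t) * (5 - t))"
      unfolding vertex_Cons unfolding vertex_def rev_rev_ident .
  qed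
qed

lemma local_extensionD:
  assumes "local_extension q m t u" "length r = m"
  shows "cell_values q u (a # r) = subcell t (cell_values q u r) a"
  using assms unfolding local_extension_iff by auto

definition graph_equation :: "(3 \<Rightarrow> real^2) \<Rightarrow> nat \<Rightarrow> (real^2 \<Rightarrow> real) \<Rightarrow> real \<Rightarrow> bool" where
  "graph_equation q m u x \<longleftrightarrow> (\<forall>y \<in> V q m - V q 0. - graph_laplacian q m u y = x * u y)"

lemma graph_equation_iff:
  assumes "equilateral q"
  shows "graph_equation q m u x \<longleftrightarrow> (\<forall>r i. length r = m \<longrightarrow> other_address r i \<noteq> (r, i) \<longrightarrow>
    cell_sum q u r + cell_sum q u (fst (other_address r i)) = (6 - x) * u (vertex q r i))"
proof
  assume G: "graph_equation q m u x"
  show "\<forall>r i. length r = m \<longrightarrow> other_address r i \<noteq> (r, i) \<longrightarrow>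
    cell_sum q u r + cell_sum q u (fst (other_address r i)) = (6 - x) * u (vertex q r i)"
  proof (intro allI impI)
    fix r i assume h: "length r = m" "other_address r i \<noteq> (r, i)"
    then have "vertex q r i \<in> V q m - V q 0"
      using vertex_in_V vertex_in_V0_iff[OF assms] by blast
    then have "- graph_laplacian q m u (vertex q r i) = x * u (vertex q r i)"
      using G unfolding graph_equation_def by blast
    then show "cell_sum q u r + cell_sum q u (fst (other_address r i)) = (6 - x) * u (vertex q r i)"
      using graph_laplacian_vertex[OF assms h, of u] by (simp add: algebra_simps)
  qed
next
  assume A: "\<forall>r i. length r = m \<longrightarrow> other_address r i \<noteq> (r, i) \<longrightarrow>
    cell_sum q u r + cell_sum q u (fst (other_address r i)) = (6 - x) * u (vertex q r i)"
  show "graph_equation q m u x" unfolding graph_equation_def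
  proof
    fix y assume y: "y \<in> V q m - V q 0"
    then obtain r i where h: "y = vertex q r i" "length r = m" unfolding V_eq by blast
    then have o: "other_address r i \<noteq> (r, i)" using y vertex_in_V0_iff[OF assms] by blast
    have "cell_sum q u r + cell_sum q u (fst (other_address r i)) = (6 - x) * u (vertex q r i)"
      using A h o by blast
    then show "- graph_laplacian q m u y = x * u y"
      using graph_laplacian_vertex[OF assms h(2) o, of u] h(1) by (simp add: algebra_simps)
  qed
qed

lemma graph_equation_cong:
  assumes "equilateral q" "\<And>x. x \<in> V q m \<Longrightarrow> u x = v x"
  shows "graph_equation q m u x \<longleftrightarrow> graph_equation q m v x"
proof -
  have "u (vertex q r i) = v (vertex q r i)" if "length r = m" for r i
    using assms(2) vertex_in_V[OF that] by blast
  then show ?thesis unfolding graph_equation_iff[OF assms(1)] by (simp add: cell_sum_def)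
qed

text \<open>At an old vertex the normal derivatives of both cells are multiplied by the same factor, and at a new
  one they are opposite multiples of the difference of the ends; in both cases they keep cancelling.\<close>

lemma graph_equation_Suc:
  assumes "equilateral q" "graph_equation q m u x" "local_extension q m t u"
    "x = t * (5 - t)" "t \<noteq> 2" "t \<noteq> 5"
  shows "graph_equation q (Suc m) u t"
  unfolding graph_equation_iff[OF assms(1)]
proof (intro allI impI)
  fix s i assume s: "length s = Suc m" and o: "other_address s i \<noteq> (s, i)"
  then obtain a r where ar: "s = a # r" "length r = m" by (cases s) auto
  have sumN: "normal_deriv t (cell_values q u s) i = (6 - t) * u (vertex q s i) - 2 * cell_sum q u s" for s i
    by (simp add: normal_deriv_def cell_sum_def)
  show "cell_sum q u s + cell_sum q u (fst (other_address s i)) = (6 - t) * u (vertex q s i)"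
  proof (cases "a = i")
    case True
    obtain r' k where rk: "other_address r i = (r', k)" by (cases "other_address r i")
    have ne: "other_address r i \<noteq> (r, i)" using o True ar rk by auto
    have os: "other_address s i = (k # r', k)" using ar True rk by simp
    have r': "length r' = m" using length_other_address[of r i] rk ar by simp
    have v: "vertex q r' k = vertex q r i" using vertex_other_address[of q r i] rk by simp
    have G: "cell_sum q u r + cell_sum q u r' = (6 - x) * u (vertex q r i)"
      using assms(2)[unfolded graph_equation_iff[OF assms(1)]] ar(2) ne rk by (metis fst_conv)
    have "normal_deriv t (cell_values q u (i # r)) i = corner_factor t * normal_deriv x (cell_values q u r) i"
      unfolding local_extensionD[OF assms(3) ar(2)] by (rule normal_deriv_subcell_same[OF assms(4-6)])
    moreover have "normal_deriv t (cell_values q u (k # r')) k = corner_factor t * normal_deriv x (cell_values q u r') k"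
      unfolding local_extensionD[OF assms(3) r'] by (rule normal_deriv_subcell_same[OF assms(4-6)])
    moreover have "normal_deriv x (cell_values q u r) i + normal_deriv x (cell_values q u r') k
        = 2 * ((6 - x) * u (vertex q r i) - (cell_sum q u r + cell_sum q u r'))"
      by (simp add: normal_deriv_def cell_sum_def v algebra_simps)
    then have "normal_deriv x (cell_values q u r) i + normal_deriv x (cell_values q u r') k = 0"
      by (simp add: G)
    ultimately have "normal_deriv t (cell_values q u (i # r)) i + normal_deriv t (cell_values q u (k # r')) k = 0"
      by (simp flip: distrib_left)
    then have "((6 - t) * u (vertex q r i) - 2 * cell_sum q u (i # r))
        + ((6 - t) * u (vertex q r i) - 2 * cell_sum q u (k # r')) = 0"
      unfolding sumN by (simp only: vertex_Cons_same v)
    then have "cell_sum q u (i # r) + cell_sum q u (k # r') = (6 - t) * u (vertex q r i)" by linarith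
    then show ?thesis using ar True os by simp
  next
    case False
    have os: "other_address s i = (i # r, a)" using ar False by simp
    have "normal_deriv t (cell_values q u (a # r)) i = mid_factor t * (u (vertex q r i) - u (vertex q r a))"
      unfolding local_extensionD[OF assms(3) ar(2)] by (rule normal_deriv_subcell_mid[OF assms(5,6) False])
    moreover have "normal_deriv t (cell_values q u (i # r)) a = mid_factor t * (u (vertex q r a) - u (vertex q r i))"
      unfolding local_extensionD[OF assms(3) ar(2)]
      using False by (intro normal_deriv_subcell_mid[OF assms(5,6)]) simp
    ultimately have "normal_deriv t (cell_values q u (a # r)) i + normal_deriv t (cell_values q u (i # r)) a = 0"
      by (simp add: algebra_simps)
    moreover have "vertex q (i # r) a = vertex q (a # r) i" by (simp add: vertex_Cons midpoint_sym)
    ultimately show ?thesis using ar os by (simp add: sumN)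
  qed
qed

text \<open>Conversely, the equations at the three midpoints of a cell form a linear system for the midpoint values.
  Adding them determines the sum of the midpoint values, and then each equation gives one of them.\<close>

lemma graph_equation_imp_local_extension:
  assumes "equilateral q" "graph_equation q (Suc m) u t" "t \<noteq> 2" "t \<noteq> 5"
  shows "local_extension q m t u"
  unfolding local_extension_iff
proof (intro allI impI)
  fix r :: "3 list" and a i :: 3
  assume r: "length r = m"
  show "u (vertex q (a # r) i) = subcell t (cell_values q u r) a i"
  proof (cases "a = i")
    case False
    then obtain k where d: "distinct [a, i, k]" using ex_third by metis
    have eq: "cell_sum q u (a # r) + cell_sum q u (i # r) = (6 - t) * u (vertex q (a # r) i)"
      if "a \<noteq> i" for a i
      using assms(2)[unfolded graph_equation_iff[OF assms(1)], rule_format, of "a # r" i] that r by simp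
    have sym: "vertex q (b # r) c = vertex q (c # r) b" for b c by (simp add: vertex_Cons midpoint_sym)
    define A B C where "A = u (vertex q (a # r) i)" and "B = u (vertex q (a # r) k)" and "C = u (vertex q (i # r) k)"
    define ua ui uk where "ua = u (vertex q r a)" and "ui = u (vertex q r i)" and "uk = u (vertex q r k)"
    note defs = A_def B_def C_def ua_def ui_def uk_def
    have S: "cell_sum q u (a # r) = ua + A + B" "cell_sum q u (i # r) = ui + A + C"
       "cell_sum q u (k # r) = uk + B + C"
      unfolding cell_sum_def sum_3_distinct[OF d] defs using sym[of i a] sym[of k a] sym[of k i] by simp_all
    have e: "ua + ui + (A + B + C) = (5 - t) * A" "ua + uk + (A + B + C) = (5 - t) * B"
       "ui + uk + (A + B + C) = (5 - t) * C"
      using eq[of a i] eq[of a k] eq[of i k] d unfolding S by (simp_all add: A_def B_def C_def algebra_simps)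
    have R: "(2 - t) * (A + B + C) = 2 * (ua + ui + uk)" using e by algebra
    have "A * ((2 - t) * (5 - t)) = (2 - t) * (ua + ui) + (2 - t) * (A + B + C)"
      using e(1) by algebra
    then have "A * ((2 - t) * (5 - t)) = (2 - t) * (ua + ui) + 2 * (ua + ui + uk)" unfolding R .
    then have "A = ((2 - t) * (ua + ui) + 2 * (ua + ui + uk)) / ((2 - t) * (5 - t))"
      using assms(3,4) by (simp add: eq_divide_eq)
    then show ?thesis using False unfolding subcell_def sum_3_distinct[OF d] defs by simp
  qed (simp add: subcell_def)
qed

section \<open>Range of the graph eigenvalues\<close>

lemma graph_eigenfunction_equation:
  "graph_eigenfunction q b m u x \<Longrightarrow> graph_equation q m u x"
  by (simp add: graph_eigenfunction_def graph_equation_def)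

text \<open>The sum over the adjacent cell, with the conventions at the boundary that make \<open>partner_equation\<close> hold
  there as well: even reflection (the cell is its own neighbour) in the Neumann case and odd reflection in
  the Dirichlet case.\<close>

definition partner_sum :: "(3 \<Rightarrow> real^2) \<Rightarrow> boundary_condition \<Rightarrow> (real^2 \<Rightarrow> real) \<Rightarrow> 3 list \<Rightarrow> 3 \<Rightarrow> real" where
  "partner_sum q b u r i =
     (if b = Dirichlet \<and> other_address r i = (r, i) then - cell_sum q u r else cell_sum q u (fst (other_address r i)))"

lemma partner_equation:
  assumes "equilateral q" "graph_eigenfunction q b m u x" "length r = m"
  shows "cell_sum q u r + partner_sum q b u r i = (6 - x) * u (vertex q r i)"
proof (cases "other_address r i = (r, i)")
  case True
  then have r: "r = replicate m i" using assms(3) by (simp add: other_address_fixed_iff)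
  then have v: "vertex q r i = q i" by simp
  show ?thesis
  proof (cases b)
    case Dirichlet
    then show ?thesis using assms(2) True v by (simp add: graph_eigenfunction_def partner_sum_def)
  next
    case Neumann
    then have "2 * (\<Sum>y | adj q m (q i) y. u (q i) - u y) = x * u (q i)"
      using assms(2) unfolding graph_eigenfunction_def by simp
    then have "2 * (3 * u (q i) - cell_sum q u r) = x * u (q i)"
      unfolding corner_laplacian[OF assms(1)] r .
    then show ?thesis using Neumann True v by (simp add: partner_sum_def algebra_simps)
  qed
next
  case False
  then show ?thesis
    using graph_eigenfunction_equation[OF assms(2)] assms(3)
    unfolding graph_equation_iff[OF assms(1)] partner_sum_def by auto
qed

lemma finite_words: "finite {r :: 3 list. length r = m}"
  using finite_lists_length_eq[of "UNIV :: 3 set" m] by simp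

text \<open>The cell sums form an eigenfunction of the adjacency operator of the graph of cells, in which each cell
  has three neighbours, one per corner.\<close>

lemma partner_sum_total:
  assumes "equilateral q" "graph_eigenfunction q b m u x" "length r = m"
  shows "(\<Sum>i\<in>UNIV. partner_sum q b u r i) = (3 - x) * cell_sum q u r"
proof -
  have "(\<Sum>i\<in>UNIV. cell_sum q u r + partner_sum q b u r i) = (6 - x) * cell_sum q u r"
    unfolding partner_equation[OF assms] by (simp add: cell_sum_def sum_distrib_left)
  then show ?thesis by (simp add: sum.distrib algebra_simps)
qed

lemma ex_max_cell_sum:
  obtains r0 where "length r0 = m" "\<And>r. length r = m \<Longrightarrow> \<bar>cell_sum q u r\<bar> \<le> \<bar>cell_sum q u r0\<bar>"
proof -
  let ?S = "(\<lambda>r. \<bar>cell_sum q u r\<bar>) ` {r. length r = m}"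
  have "replicate m 0 \<in> {r :: 3 list. length r = m}" by simp
  then have ne: "?S \<noteq> {}" by blast
  have S: "finite ?S" by (rule finite_imageI[OF finite_words])
  then obtain r0 where "length r0 = m" "\<bar>cell_sum q u r0\<bar> = Max ?S" using Max_in[OF S ne] by auto
  then show thesis using that[of r0] Max_ge[OF S] by auto
qed

lemma abs_partner_sum_le:
  assumes "length r = m" "\<And>r. length r = m \<Longrightarrow> \<bar>cell_sum q u r\<bar> \<le> M"
  shows "\<bar>partner_sum q b u r i\<bar> \<le> M"
  using assms(2)[OF assms(1)] assms(2)[of "fst (other_address r i)"] assms(1) by (auto simp: partner_sum_def)

lemma graph_eigenfunction_nonzero_sum:
  assumes "equilateral q" "graph_eigenfunction q b m u x" "x \<noteq> 6"
  shows "\<exists>r. length r = m \<and> cell_sum q u r \<noteq> 0"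
proof (rule ccontr)
  assume "\<not> ?thesis"
  then have 0: "\<And>r. length r = m \<Longrightarrow> cell_sum q u r = 0" by blast
  obtain r i where r: "length r = m" "u (vertex q r i) \<noteq> 0"
    using assms(2) unfolding graph_eigenfunction_def V_eq by blast
  have "partner_sum q b u r i = 0" using 0[of r] 0[of "fst (other_address r i)"] r by (simp add: partner_sum_def)
  then have "(6 - x) * u (vertex q r i) = 0" using partner_equation[OF assms(1,2) r(1), of i] 0 r by simp
  then show False using r assms(3) by simp
qed

text \<open>Evaluated where the cell sum is largest in modulus, \<open>partner_sum_total\<close> gives \<open>\<bar>3 - x\<bar> \<le> 3\<close>. If
  all cell sums vanish, the equation leaves only \<open>x = 6\<close>.\<close>

lemma graph_eigenvalue_range:
  assumes "equilateral q" "graph_eigenfunction q b m u x"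
  shows "0 \<le> x" "x \<le> 6"
proof -
  have "0 \<le> x \<and> x \<le> 6"
  proof (cases "x = 6")
    case False
    obtain r where r: "length r = m" "\<And>s. length s = m \<Longrightarrow> \<bar>cell_sum q u s\<bar> \<le> \<bar>cell_sum q u r\<bar>"
      using ex_max_cell_sum by blast
    then have pos: "\<bar>cell_sum q u r\<bar> > 0"
      using graph_eigenfunction_nonzero_sum[OF assms False] by fastforce
    have "\<bar>3 - x\<bar> * \<bar>cell_sum q u r\<bar> = \<bar>\<Sum>i\<in>UNIV. partner_sum q b u r i\<bar>"
      unfolding partner_sum_total[OF assms r(1)] by (simp add: abs_mult)
    also have "\<dots> \<le> (\<Sum>i\<in>UNIV. \<bar>partner_sum q b u r i\<bar>)" by (rule sum_abs)
    also have "\<dots> \<le> (\<Sum>i\<in>(UNIV::3 set). \<bar>cell_sum q u r\<bar>)"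
      using abs_partner_sum_le[OF r(1)] r(2) by (intro sum_mono) blast
    also have "\<dots> = 3 * \<bar>cell_sum q u r\<bar>" by simp
    finally have "\<bar>3 - x\<bar> \<le> 3" using pos by simp
    then show ?thesis by (simp add: abs_le_iff)
  qed simp
  then show "0 \<le> x" "x \<le> 6" by auto
qed

text \<open>Connectedness of the graph of cells, by induction on the level: the three subcells of a cell are
  neighbours of each other, and adjacent cells have adjacent subcells.\<close>

lemma words_connected:
  assumes "\<And>r i. r \<in> A \<Longrightarrow> fst (other_address r i) \<in> A" "r \<in> A" "length r = length s"
  shows "s \<in> A"
  using assms
proof (induction s arbitrary: A r)
  case (Cons b s)
  then obtain a r' where r: "r = a # r'" "length r' = length s" by (cases r) auto
  have siblings: "c # r \<in> A" if "d # r \<in> A" for c d r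
    using Cons.prems(1)[OF that, of c] by (cases "c = d") (auto simp: that)
  \<comment> \<open>the cells of the previous level all of whose subcells belong to \<open>A\<close>\<close>
  define A' where "A' = {r. \<forall>a. a # r \<in> A}"
  have "fst (other_address r i) \<in> A'" if "r \<in> A'" for r i
  proof -
    have "i # r \<in> A" using that by (simp add: A'_def)
    then have "snd (other_address r i) # fst (other_address r i) \<in> A" using Cons.prems(1)[of "i # r" i] by simp
    then show ?thesis using siblings by (simp add: A'_def)
  qed
  moreover have "r' \<in> A'" using Cons.prems(2) r siblings by (auto simp: A'_def)
  ultimately have "s \<in> A'" using Cons.IH[of A' r'] r by blast
  then show ?case by (simp add: A'_def)
qed simp

text \<open>Equality in the maximum principle: the extremal cell sum spreads to all neighbours, hence everywhere.
  At a Dirichlet corner it would have to equal its own negative.\<close>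

lemma eigenvalue_zero_imp_const:
  assumes "equilateral q" "graph_eigenfunction q b m u 0"
  shows "b = Neumann \<and> (\<exists>c. c \<noteq> 0 \<and> (\<forall>y\<in>V q m. u y = c))"
proof -
  obtain r where r: "length r = m" "\<And>s. length s = m \<Longrightarrow> \<bar>cell_sum q u s\<bar> \<le> \<bar>cell_sum q u r\<bar>"
    using ex_max_cell_sum by blast
  define M where "M = cell_sum q u r"
  have M: "M \<noteq> 0" using graph_eigenfunction_nonzero_sum[OF assms] r by (force simp: M_def)
  \<comment> \<open>three terms bounded by \<open>\<bar>M\<bar>\<close> have the sum \<open>3 \<bar>M\<bar>\<close>, so each of them attains the bound\<close>
  have step: "partner_sum q b u s i = M" if s: "length s = m" "cell_sum q u s = M" for s i
  proof -
    have le: "sgn M * partner_sum q b u s i \<le> \<bar>M\<bar>" for i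
    proof -
      have "sgn M * partner_sum q b u s i \<le> \<bar>sgn M * partner_sum q b u s i\<bar>" by simp
      also have "\<dots> = \<bar>partner_sum q b u s i\<bar>" using M by (simp add: abs_mult abs_sgn_eq)
      also have "\<dots> \<le> \<bar>M\<bar>" using abs_partner_sum_le[OF s(1)] r(2) unfolding M_def by blast
      finally show ?thesis .
    qed
    have "(\<Sum>i\<in>UNIV. sgn M * partner_sum q b u s i) = sgn M * (3 * M)"
      using partner_sum_total[OF assms s(1)] s(2) by (simp flip: sum_distrib_left)
    also have "\<dots> = (\<Sum>i\<in>(UNIV::3 set). \<bar>M\<bar>)" by (simp add: abs_sgn mult.commute)
    finally have "(\<Sum>i\<in>UNIV. \<bar>M\<bar> - sgn M * partner_sum q b u s i) = 0" by (simp add: sum_subtractf)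
    then have "\<bar>M\<bar> - sgn M * partner_sum q b u s i = 0" using le by (simp add: sum_nonneg_eq_0_iff)
    moreover have "\<bar>M\<bar> = sgn M * M" by (simp add: abs_if sgn_if)
    ultimately have "sgn M * partner_sum q b u s i = sgn M * M" by linarith
    moreover have "sgn M \<noteq> 0" using M by (simp add: sgn_if)
    ultimately show ?thesis by simp
  qed
  define A where "A = {s. length s = m \<and> cell_sum q u s = M}"
  have "fst (other_address s i) \<in> A" if "s \<in> A" for s i
  proof (cases "other_address s i = (s, i)")
    case False
    then have "cell_sum q u (fst (other_address s i)) = M"
      using step[of s i] that unfolding A_def partner_sum_def by simp
    then show ?thesis using that by (simp add: A_def)
  qed (use that in simp)
  moreover have "r \<in> A" using r by (simp add: A_def M_def)
  ultimately have all: "cell_sum q u s = M" if "length s = m" for s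
    using words_connected[of A r s] that r(1) by (auto simp: A_def)
  have "b \<noteq> Dirichlet"
  proof
    assume b: "b = Dirichlet"
    let ?s = "replicate m (0::3)"
    have "other_address ?s 0 = (?s, 0)" by (simp add: other_address_fixed_iff)
    then have "partner_sum q b u ?s 0 = - M" using b all by (simp add: partner_sum_def)
    then show False using step[of ?s 0] all M by simp
  qed
  moreover have "u y = M / 3" if y: "y \<in> V q m" for y
  proof -
    obtain s i where s: "length s = m" "y = vertex q s i" using y unfolding V_eq by blast
    have "M + M = 6 * u y"
      using partner_equation[OF assms s(1), of i] step[OF s(1) all[OF s(1)], of i] all[OF s(1)] s(2) by simp
    then show ?thesis by simp
  qed
  ultimately show ?thesis using M by (cases b) (auto intro!: exI[of _ "M / 3"])
qed

lemma sum_words_Suc: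
  fixes f :: "3 list \<Rightarrow> real"
  shows "(\<Sum>s | length s = Suc m. f s) = (\<Sum>r | length r = m. \<Sum>a\<in>UNIV. f (a # r))"
proof -
  have "(\<Sum>r | length r = m. \<Sum>a\<in>UNIV. f (a # r))
      = (\<Sum>(r, a)\<in>{r. length r = m} \<times> UNIV. f (a # r))"
    by (rule sum.cartesian_product)
  also have "\<dots> = (\<Sum>s | length s = Suc m. f s)"
    by (rule sum.reindex_bij_witness[of _ "\<lambda>s. (tl s, hd s)" "\<lambda>(r, a). a # r"])
      (auto simp: length_Suc_conv)
  finally show ?thesis ..
qed

lemma sum_other_address:
  fixes f :: "3 list \<Rightarrow> real"
  shows "(\<Sum>r | length r = m. \<Sum>i\<in>UNIV. f (fst (other_address r i))) = (\<Sum>r | length r = m. \<Sum>i\<in>(UNIV::3 set). f r)"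
proof -
  define W where "W = (\<lambda>p :: 3 list \<times> 3. other_address (fst p) (snd p))"
  have "(\<Sum>r | length r = m. \<Sum>i\<in>UNIV. f (fst (other_address r i)))
      = (\<Sum>p\<in>{r. length r = m} \<times> (UNIV::3 set). f (fst (W p)))"
    unfolding sum.cartesian_product by (simp add: W_def case_prod_unfold)
  also have "\<dots> = (\<Sum>p\<in>{r. length r = m} \<times> (UNIV::3 set). f (fst p))"
    by (rule sum.reindex_bij_witness[of _ W W]) (auto simp: W_def other_address_involution mem_Times_iff)
  also have "\<dots> = (\<Sum>r | length r = m. \<Sum>i\<in>(UNIV::3 set). f r)"
    unfolding sum.cartesian_product by (simp add: case_prod_unfold)
  finally show ?thesis .
qed

text \<open>Summing the eigenvalue equation over all addresses shows that the sum of all cell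
  sums vanishes. On the other hand, the equations at the midpoints of one \<open>m\<close>-cell show that its three
  subcells contribute \<open>- c\<close> together.\<close>

lemma const_not_followed_by_five:
  assumes "equilateral q" "graph_eigenfunction q Neumann (Suc m) u 5" "\<And>y. y \<in> V q m \<Longrightarrow> u y = c"
  shows "c = 0"
proof -
  have eq: "cell_sum q u s + cell_sum q u (fst (other_address s i)) = u (vertex q s i)" if "length s = Suc m" for s i
    using partner_equation[OF assms(1,2) that, of i] by (simp add: partner_sum_def)
  let ?T = "\<Sum>s | length s = Suc m. cell_sum q u s"
  have "(\<Sum>s | length s = Suc m. \<Sum>i\<in>UNIV. cell_sum q u s + cell_sum q u (fst (other_address s i)))
      = (\<Sum>s | length s = Suc m. \<Sum>i\<in>UNIV. u (vertex q s i))"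
    by (intro sum.cong refl) (simp add: eq)
  also have "\<dots> = ?T" by (simp add: cell_sum_def)
  finally have "(\<Sum>s | length s = Suc m. \<Sum>i\<in>(UNIV::3 set). cell_sum q u s)
     + (\<Sum>s | length s = Suc m. \<Sum>i\<in>UNIV. cell_sum q u (fst (other_address s i))) = ?T"
    by (simp only: sum.distrib)
  then have "3 * ?T + 3 * ?T = ?T" unfolding sum_other_address by (simp flip: sum_distrib_left)
  then have T0: "?T = 0" by simp
  have cell: "(\<Sum>a\<in>UNIV. cell_sum q u (a # r)) = - c" if r: "length r = m" for r
  proof -
    \<comment> \<open>any corner will do: the sum over the subcells is expressed through one of them, which then cancels\<close>
    define a :: 3 where "a = 0"
    have c: "u (vertex q r a) = c" by (rule assms(3)[OF vertex_in_V[OF r]])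
    have "cell_sum q u (a # r) = c + (\<Sum>i\<in>UNIV - {a}. u (vertex q (a # r) i))"
      unfolding cell_sum_remove by (simp add: c)
    also have "(\<Sum>i\<in>UNIV - {a}. u (vertex q (a # r) i))
        = (\<Sum>i\<in>UNIV - {a}. cell_sum q u (a # r) + cell_sum q u (i # r))"
    proof (rule sum.cong[OF refl])
      fix i assume "i \<in> UNIV - {a}"
      then show "u (vertex q (a # r) i) = cell_sum q u (a # r) + cell_sum q u (i # r)"
        using eq[of "a # r" i] r by simp
    qed
    also have "\<dots> = 2 * cell_sum q u (a # r) + ((\<Sum>i\<in>UNIV. cell_sum q u (i # r)) - cell_sum q u (a # r))"
      by (simp add: sum.distrib card_remove_3 sum_diff1)
    finally show ?thesis by linarith
  qed
  have "?T = (\<Sum>r :: 3 list | length r = m. - c)"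
    unfolding sum_words_Suc by (intro sum.cong) (simp_all add: cell)
  also have "\<dots> = - c * card {r :: 3 list. length r = m}" by simp
  finally have "c * card {r :: 3 list. length r = m} = 0" using T0 by simp
  moreover have "card {r :: 3 list. length r = m} \<noteq> 0"
  proof -
    have "replicate m 0 \<in> {r :: 3 list. length r = m}" by simp
    then show ?thesis using finite_words[of m] by (metis card_0_eq empty_iff)
  qed
  ultimately show ?thesis by simp
qed

lemma V_mono_le: "m \<le> k \<Longrightarrow> V q m \<subseteq> V q k"
  using V_mono by (rule lift_Suc_mono_le)

lemma const_on_Vstar_imp_const:
  assumes "continuous_on (SG q) u" "\<And>y. y \<in> Vstar q \<Longrightarrow> u y = c" "y \<in> SG q"
  shows "u y = (c::real)"
  using continuous_constant_on_closure[of "Vstar q" u c y] assms by (simp add: SG_eq_closure)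

text \<open>If \<open>\<lambda>\<^sub>m = 0\<close>, the function is constant on \<open>V q m\<close>, and the next eigenvalue is \<open>0\<close> or \<open>5\<close>. As \<open>5\<close> is
  excluded, all later eigenvalues are \<open>0\<close> and the function is constant throughout.\<close>

lemma eigenvalue_ne_zero:
  assumes "equilateral q" "graph_eigenvalues q b u L m0 l" "m \<ge> m0"
    "continuous_on (SG q) u" "\<not> u constant_on SG q"
  shows "l m \<noteq> 0"
proof
  assume "l m = 0"
  have ef: "graph_eigenfunction q b k u (l k)" and rec: "l k = l (Suc k) * (5 - l (Suc k))" if "k \<ge> m0" for k
    using assms(2) that unfolding graph_eigenvalues_def by blast+
  obtain c where c: "b = Neumann" "c \<noteq> 0" "\<forall>y\<in>V q m. u y = c"
    using eigenvalue_zero_imp_const[OF assms(1), of b m u] ef[OF assms(3)] \<open>l m = 0\<close> by auto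
  have "l (m + j) = 0 \<and> (\<forall>y\<in>V q (m + j). u y = c)" for j
  proof (induction j)
    case (Suc j)
    have "l (Suc (m + j)) * (5 - l (Suc (m + j))) = 0" using rec[of "m + j"] Suc assms(3) by simp
    then consider "l (Suc (m + j)) = 0" | "l (Suc (m + j)) = 5" by auto
    then show ?case
    proof cases
      case 1
      obtain c' where c': "\<forall>y\<in>V q (Suc (m + j)). u y = c'"
        using eigenvalue_zero_imp_const[OF assms(1), of b "Suc (m + j)" u] ef[of "Suc (m + j)"] 1 assms(3) by auto
      have "q 0 \<in> V q 0" by simp
      then have "q 0 \<in> V q (m + j)" "q 0 \<in> V q (Suc (m + j))" using V_mono_le by blast+
      then have "c' = c" using c' Suc by auto
      then show ?thesis using c' 1 by simp
    next
      case 2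
      then have "c = 0"
        using const_not_followed_by_five[OF assms(1), of "m + j" u c] ef[of "Suc (m + j)"] Suc assms(3) c(1) by auto
      then show ?thesis using c by simp
    qed
  qed (use \<open>l m = 0\<close> c in auto)
  then have "u y = c" if "y \<in> Vstar q" for y
  proof -
    obtain k where "y \<in> V q k" using \<open>y \<in> Vstar q\<close> unfolding Vstar_def by blast
    then have "y \<in> V q (m + k)" using V_mono_le[of k "m + k"] by auto
    then show ?thesis using \<open>\<And>j. l (m + j) = 0 \<and> (\<forall>y\<in>V q (m + j). u y = c)\<close> by blast
  qed
  then have "\<forall>y\<in>SG q. u y = c" using const_on_Vstar_imp_const[OF assms(4)] by blast
  then show False using assms(5) unfolding constant_on_def by blast
qed

text \<open>The eigenvalue \<open>6\<close> above the level of birth would come from the negative eigenvalue \<open>6 * (5 - 6)\<close>.\<close>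

lemma eigenvalue_in_range:
  assumes "equilateral q" "graph_eigenvalues q b u L m0 l" "m \<ge> m0" "l m0 = 6 \<longrightarrow> m > m0"
    "continuous_on (SG q) u" "\<not> u constant_on SG q"
  shows "0 < l m" "l m < 6"
proof -
  have ef: "graph_eigenfunction q b k u (l k)" and rec: "l k = l (Suc k) * (5 - l (Suc k))" if "k \<ge> m0" for k
    using assms(2) that unfolding graph_eigenvalues_def by blast+
  note range = graph_eigenvalue_range[OF assms(1) ef]
  show "0 < l m" using range[OF assms(3)] eigenvalue_ne_zero[OF assms(1-3,5,6)] by simp
  have "l m \<noteq> 6"
  proof
    assume 6: "l m = 6"
    then have "m > m0" using assms(3,4) by (cases "m = m0") auto
    then obtain k where "m = Suc k" "k \<ge> m0" by (cases m) auto
    then show False using rec[of k] range(1)[of k] 6 by simp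
  qed
  then show "l m < 6" using range[OF assms(3)] by simp
qed

section \<open>Eigenfunctions along the edges of cells\<close>

definition edge_point :: "(3 \<Rightarrow> real^2) \<Rightarrow> 3 list \<Rightarrow> 3 \<Rightarrow> 3 \<Rightarrow> real \<Rightarrow> real^2" where
  "edge_point q r i j s = vertex q r i + s *\<^sub>R (vertex q r j - vertex q r i)"

lemma edge_point_left: "edge_point q (i # r) i j s = edge_point q r i j (s / 2)"
  by (simp add: edge_point_def vertex_Cons midpoint_def vec_eq_iff field_simps)

lemma edge_point_right: "edge_point q (j # r) i j s = edge_point q r i j ((s + 1) / 2)"
  by (simp add: edge_point_def vertex_Cons midpoint_def vec_eq_iff field_simps)

lemma edge_point_0 [simp]: "edge_point q r i j 0 = vertex q r i"
  and edge_point_1 [simp]: "edge_point q r i j 1 = vertex q r j"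
  by (simp_all add: edge_point_def)

lemma dyadic_edge_point_in_V:
  "p \<le> 2 ^ d \<Longrightarrow> edge_point q r i j (real p / 2 ^ d) \<in> V q (length r + d)"
proof (induction d arbitrary: r p)
  case 0
  then have "p = 0 \<or> p = 1" by auto
  then show ?case using vertex_in_V[of r "length r" q] by auto
next
  case (Suc d)
  show ?case
  proof (cases "p \<le> 2 ^ d")
    case True
    have e: "real p / 2 ^ d / 2 = real p / 2 ^ Suc d" by simp
    have "length (i # r) + d = length r + Suc d" by simp
    then show ?thesis using Suc.IH[OF True, of "i # r"] unfolding edge_point_left e by metis
  next
    case False
    define p' where "p' = p - 2 ^ d"
    have p': "p = 2 ^ d + p'" "p' \<le> 2 ^ d" using False Suc.prems by (auto simp: p'_def)
    have e: "(real p' / 2 ^ d + 1) / 2 = real p / 2 ^ Suc d" by (simp add: field_simps p')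
    show ?thesis using Suc.IH[OF p'(2), of "j # r"] unfolding edge_point_right e by simp
  qed
qed

lemma edge_point_in_SG:
  assumes "0 \<le> s" "s \<le> 1"
  shows "edge_point q r i j s \<in> SG q"
proof (rule Lim_in_closed_set[of _ "\<lambda>d. edge_point q r i j (real (dyadic_floor d s) / 2 ^ d)" sequentially])
  show "closed (SG q)" by (rule compact_imp_closed[OF compact_SG])
  show "\<forall>\<^sub>F d in sequentially. edge_point q r i j (real (dyadic_floor d s) / 2 ^ d) \<in> SG q"
    using dyadic_edge_point_in_V[OF dyadic_floor_le(1)[OF assms]] V_subset_SG by (intro always_eventually) blast
  show "(\<lambda>d. edge_point q r i j (real (dyadic_floor d s) / 2 ^ d)) \<longlonglongrightarrow> edge_point q r i j s"
    unfolding edge_point_def by (intro tendsto_intros dyadic_floor_tendsto[OF assms(1)])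
qed simp

lemma closed_segment_eq_edge_points:
  "closed_segment (vertex q r i) (vertex q r j) = edge_point q r i j ` {0..1}"
  unfolding closed_segment_def edge_point_def by (force simp: algebra_simps image_iff)

lemma continuous_on_edge:
  assumes "continuous_on (SG q) u"
  shows "continuous_on {0..1} (\<lambda>s. u (edge_point q r i j s))"
proof (rule continuous_on_compose2[OF assms])
  show "continuous_on {0..1} (edge_point q r i j)"
    unfolding edge_point_def by (intro continuous_intros)
  show "edge_point q r i j ` {0..1} \<subseteq> SG q" using edge_point_in_SG by auto
qed

text \<open>From level \<open>m\<close> on, \<open>u\<close> follows the local extension algorithm along the \<open>n\<close>-th Gray sequence.\<close>

definition spectral_extension :: "(3 \<Rightarrow> real^2) \<Rightarrow> nat \<Rightarrow> nat \<Rightarrow> real \<Rightarrow> (real^2 \<Rightarrow> real) \<Rightarrow> bool" where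
  "spectral_extension q m n x u \<longleftrightarrow> (\<forall>k. local_extension q (m + k) (decim_seq n x (Suc k)) u)"

lemma spectral_extension_Suc:
  assumes "spectral_extension q m n x u"
  shows "spectral_extension q (Suc m) (n div 2) (decim (gray n 0) x) u"
  unfolding spectral_extension_def
proof
  fix k
  have "local_extension q (m + Suc k) (decim_seq n x (Suc (Suc k))) u"
    using assms unfolding spectral_extension_def by blast
  then show "local_extension q (Suc m + k) (decim_seq (n div 2) (decim (gray n 0) x) (Suc k)) u"
    by (simp only: decim_seq_shift add_Suc_right add_Suc)
qed

lemma edge_profile_of_extension:
  assumes "spectral_extension q m n x u" "length r = m" "i \<noteq> j" "0 < x" "x < 6"
  shows "edge_profile n x (normal_deriv x (cell_values q u r) i) (- normal_deriv x (cell_values q u r) j)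
    (\<lambda>s. u (edge_point q r i j s))"
proof -
  define R where "R = (\<lambda>n x X Y g. \<exists>m r. spectral_extension q m n x u \<and> length r = m \<and> 0 < x \<and> x < 6 \<and>
     X = normal_deriv x (cell_values q u r) i \<and> Y = - normal_deriv x (cell_values q u r) j \<and>
     g = (\<lambda>s. u (edge_point q r i j s)))"
  show ?thesis
  proof (rule edge_profile_coinductI[of R])
    show "R n x (normal_deriv x (cell_values q u r) i) (- normal_deriv x (cell_values q u r) j)
      (\<lambda>s. u (edge_point q r i j s))" unfolding R_def using assms by blast
    fix n x X Y g assume "R n x X Y g"
    then obtain m r where h: "spectral_extension q m n x u" "length r = m" "0 < x" "x < 6"
      "X = normal_deriv x (cell_values q u r) i" "Y = - normal_deriv x (cell_values q u r) j"
      "g = (\<lambda>s. u (edge_point q r i j s))" unfolding R_def by blast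
    define t where "t = decim (gray n 0) x"
    have t: "x = t * (5 - t)" "t \<noteq> 2" "t \<noteq> 5" "0 < t" "t < 6"
      using decim_eq[of x "gray n 0"] decim_bounds[OF h(3,4), of "gray n 0"] h(4) by (auto simp: t_def)
    have ext: "local_extension q m t u"
      using h(1) unfolding spectral_extension_def t_def by (metis add_0_right decim_seq.simps)
    have diff: "g 0 - g 1 = (X + Y) / (6 - x)"
      using normal_deriv_diff[of x "cell_values q u r" i j] h(4) by (simp add: h(5-7))
    define M where "M = mid_factor t * (g 0 - g 1)"
    have left: "R (n div 2) t (corner_factor t * X) M (\<lambda>s. g (s / 2))"
    proof -
      have "normal_deriv t (cell_values q u (i # r)) i = corner_factor t * X"
        unfolding local_extensionD[OF ext h(2)] h(5) by (rule normal_deriv_subcell_same[OF t(1-3)])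
      moreover have "normal_deriv t (cell_values q u (i # r)) j = - M"
        unfolding local_extensionD[OF ext h(2)] normal_deriv_subcell_mid[OF t(2,3) assms(3)]
        by (simp add: M_def h(7) algebra_simps)
      moreover have "(\<lambda>s. g (s / 2)) = (\<lambda>s. u (edge_point q (i # r) i j s))"
        by (simp add: h(7) edge_point_left)
      ultimately show ?thesis
        unfolding R_def using spectral_extension_Suc[OF h(1)] t(4,5) h(2)
        by (intro exI[of _ "Suc m"] exI[of _ "i # r"]) (simp add: t_def)
    qed
    have right: "R (n div 2) t M (corner_factor t * Y) (\<lambda>s. g ((s + 1) / 2))"
    proof -
      have "normal_deriv t (cell_values q u (j # r)) j = - (corner_factor t * Y)"
        unfolding local_extensionD[OF ext h(2)] h(6) using normal_deriv_subcell_same[OF t(1-3)] by simp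
      moreover have "normal_deriv t (cell_values q u (j # r)) i = M"
        unfolding local_extensionD[OF ext h(2)] normal_deriv_subcell_mid[OF t(2,3) assms(3)[symmetric]]
        by (simp add: M_def h(7))
      moreover have "(\<lambda>s. g ((s + 1) / 2)) = (\<lambda>s. u (edge_point q (j # r) i j s))"
        by (simp add: h(7) edge_point_right)
      ultimately show ?thesis
        unfolding R_def using spectral_extension_Suc[OF h(1)] t(4,5) h(2)
        by (intro exI[of _ "Suc m"] exI[of _ "j # r"]) (simp add: t_def)
    qed
    show "g 0 - g 1 = (X + Y) / (6 - x) \<and> (\<exists>t M. t = decim (gray n 0) x \<and> M = mid_factor t * (g 0 - g 1) \<and>
        R (n div 2) t (corner_factor t * X) M (\<lambda>s. g (s / 2)) \<and>
        R (n div 2) t M (corner_factor t * Y) (\<lambda>s. g ((s + 1) / 2)))"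
      using t_def diff M_def left right by blast
  qed
qed

lemma graph_equation_spectral_extension:
  assumes "equilateral q" "graph_equation q m u x" "spectral_extension q m n x u" "0 < x" "x < 6"
  shows "graph_equation q (m + k) u (decim_seq n x k)"
proof (induction k)
  case (Suc k)
  note b = decim_seq_bounds[OF assms(4,5), of n k]
  have ext: "local_extension q (m + k) (decim_seq n x (Suc k)) u"
    using assms(3) unfolding spectral_extension_def by blast
  have "graph_equation q (Suc (m + k)) u (decim_seq n x (Suc k))"
    by (rule graph_equation_Suc[OF assms(1) Suc ext])
      (use decim_eq[of "decim_seq n x k" "gray n k"] decim_bounds[OF b, of "gray n k"] b in auto)
  then show ?case by simp
qed (use assms in simp)

text \<open>The Laplacian is only defined off the boundary, so identifying an eigenvalue takes a vertex off the
  boundary at which the function does not vanish.\<close>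

lemma ex_nonzero_midpoint:
  assumes "equilateral q" "local_extension q m t u" "t \<noteq> 2" "t < 5" "y \<in> V q m" "u y \<noteq> 0"
  shows "\<exists>z\<in>V q (Suc m) - V q 0. u z \<noteq> 0"
proof -
  obtain r i where r: "length r = m" "y = vertex q r i" using assms(5) unfolding V_eq by blast
  have "\<exists>a i. a \<noteq> i \<and> subcell t (cell_values q u r) a i \<noteq> 0"
    using subcell_zero_imp_zero[OF assms(3,4), of "cell_values q u r" i] r assms(6) by auto
  then obtain a i where a: "a \<noteq> i" "u (vertex q (a # r) i) \<noteq> 0"
    using local_extensionD[OF assms(2) r(1)] by metis
  have "vertex q (a # r) i \<in> V q (Suc m)" using r(1) by (intro vertex_in_V) simp
  moreover have "vertex q (a # r) i \<notin> V q 0" using vertex_in_V0_iff[OF assms(1), of "a # r" i] a(1) by simp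
  ultimately show ?thesis using a(2) by blast
qed

text \<open>At such a vertex both the definition of the Laplacian and the graph equations give the limit of the
  renormalised graph Laplacians.\<close>

lemma eigenvalue_eq_decim_limit:
  assumes "equilateral q" "eigenfunction q u L" "graph_equation q m u x" "spectral_extension q m n x u"
    "0 < x" "x < 6" "y \<in> V q m" "u y \<noteq> 0"
  shows "L = 3/2 * 5 ^ m * decim_limit n x"
proof -
  have "local_extension q m (decim (gray n 0) x) u"
    using assms(4) unfolding spectral_extension_def by (metis add_0_right decim_seq.simps)
  then obtain z where z: "z \<in> V q (Suc m) - V q 0" "u z \<noteq> 0"
    using ex_nonzero_midpoint[of q m "decim (gray n 0) x" u y] assms(1,7,8)
      decim_bounds[OF assms(5,6), of "gray n 0"] by blast
  have zV: "z \<in> V q (m + k)" if "k \<ge> 1" for k using z V_mono_le[of "Suc m" "m + k"] that by auto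
  have "z \<in> Vstar q - V q 0" using z unfolding Vstar_def by blast
  have lim1: "(\<lambda>k. 3/2 * 5 ^ k * graph_laplacian q k u z) \<longlonglongrightarrow> - L * u z"
  proof (rule LIMSEQ_I)
    fix e :: real assume "e > 0"
    then obtain N where N: "\<forall>k\<ge>N. \<forall>y\<in>Vstar q - V q 0. y \<in> V q k \<longrightarrow>
        \<bar>3/2 * 5^k * graph_laplacian q k u y - (- L * u y)\<bar> < e"
      using assms(2) unfolding eigenfunction_def has_laplacian_def by blast
    have "norm (3/2 * 5 ^ k * graph_laplacian q k u z - (- L * u z)) < e" if k: "k \<ge> max N (Suc m)" for k
    proof -
      have "z \<in> V q (m + (k - m))" using k by (intro zV) linarith
      then have "z \<in> V q k" using k by simp
      then show ?thesis using N[rule_format, of k z] k \<open>z \<in> Vstar q - V q 0\<close> by simp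
    qed
    then show "\<exists>N. \<forall>k\<ge>N. norm (3/2 * 5 ^ k * graph_laplacian q k u z - (- L * u z)) < e" by blast
  qed
  have "(\<lambda>k. 3/2 * 5 ^ m * (5 ^ k * decim_seq n x k)) \<longlonglongrightarrow> 3/2 * 5 ^ m * decim_limit n x"
    by (intro tendsto_mult_left decim_limit_tendsto assms)
  then have lim2: "(\<lambda>k. - (3/2 * 5 ^ m * (5 ^ k * decim_seq n x k)) * u z) \<longlonglongrightarrow> - (3/2 * 5 ^ m * decim_limit n x) * u z"
    by (rule tendsto_mult_right[OF tendsto_minus])
  have "(\<lambda>k. 3/2 * 5 ^ (k + m) * graph_laplacian q (k + m) u z) \<longlonglongrightarrow> - L * u z"
    using lim1 by (rule LIMSEQ_ignore_initial_segment)
  moreover have "\<forall>\<^sub>F k in sequentially. 3/2 * 5 ^ (k + m) * graph_laplacian q (k + m) u z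
      = - (3/2 * 5 ^ m * (5 ^ k * decim_seq n x k)) * u z"
    unfolding eventually_sequentially
  proof (intro exI[of _ 1] allI impI)
    fix k :: nat assume "k \<ge> 1"
    then have "- graph_laplacian q (m + k) u z = decim_seq n x k * u z"
      using graph_equation_spectral_extension[OF assms(1,3,4,5,6), of k] zV z unfolding graph_equation_def by blast
    then have "graph_laplacian q (k + m) u z = - (decim_seq n x k * u z)" by (simp add: add.commute)
    then show "3/2 * 5 ^ (k + m) * graph_laplacian q (k + m) u z
      = - (3/2 * 5 ^ m * (5 ^ k * decim_seq n x k)) * u z" by (simp add: power_add)
  qed
  ultimately have "(\<lambda>k. - (3/2 * 5 ^ m * (5 ^ k * decim_seq n x k)) * u z) \<longlonglongrightarrow> - L * u z"
    by (rule Lim_transform_eventually)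
  from LIMSEQ_unique[OF this lim2] show ?thesis using z by simp
qed

lemma initialed_imp_gray_index:
  assumes "equilateral q" "initialed q m u x \<psi> L" "graph_equation q m u x" "0 < x" "x < 6"
    "y \<in> V q m" "u y \<noteq> 0"
  obtains n where "spectral_extension q m n x \<psi>" "L = 3/2 * 5 ^ m * decim_limit n x"
proof -
  obtain \<epsilon> \<mu> :: "nat \<Rightarrow> real" where h: "eigenfunction q \<psi> L" "\<forall>y\<in>V q m. \<psi> y = u y"
    "\<forall>k>m. \<epsilon> k \<in> {-1, 1}" "finite {k. k > m \<and> \<epsilon> k \<noteq> -1}" "\<mu> m = x"
    "\<forall>k>m. \<mu> k = (5 + \<epsilon> k * sqrt (25 - 4 * \<mu> (k - 1))) / 2"
    "\<forall>k\<ge>m. local_extension q k (\<mu> (Suc k)) \<psi>"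
    using assms(2) unfolding initialed_def by blast
  obtain K where K: "\<forall>k\<in>{k. k > m \<and> \<epsilon> k \<noteq> -1}. k < K"
    using h(4) finite_nat_set_iff_bounded by blast
  have "\<exists>n. \<forall>j. gray n j = (\<epsilon> (m + Suc j) \<noteq> -1)"
  proof (rule gray_surj[of K])
    fix j assume "j \<ge> K"
    show "\<not> \<epsilon> (m + Suc j) \<noteq> -1"
    proof
      assume "\<epsilon> (m + Suc j) \<noteq> -1"
      then have "m + Suc j < K" using K by auto
      then show False using \<open>j \<ge> K\<close> by simp
    qed
  qed
  then obtain n where n: "\<And>j. gray n j = (\<epsilon> (m + Suc j) \<noteq> -1)" by blast
  have \<mu>: "\<mu> (m + k) = decim_seq n x k" for k
  proof (induction k)
    case (Suc k)
    have "\<epsilon> (m + Suc k) = -1 \<or> \<epsilon> (m + Suc k) = 1" using h(3)[rule_format, of "m + Suc k"] by simp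
    then show ?case using h(6)[rule_format, of "m + Suc k"] Suc n[of k] by (auto simp: decim_def)
  qed (use h in simp)
  have ext: "spectral_extension q m n x \<psi>"
    unfolding spectral_extension_def
  proof
    fix k show "local_extension q (m + k) (decim_seq n x (Suc k)) \<psi>"
      using h(7)[rule_format, of "m + k"] \<mu>[of "Suc k"] by simp
  qed
  have "graph_equation q m \<psi> x" using graph_equation_cong[OF assms(1), of m \<psi> u x] h(2) assms(3) by blast
  then have "L = 3/2 * 5 ^ m * decim_limit n x"
    using eigenvalue_eq_decim_limit[OF assms(1) h(1) _ ext assms(4,5,6)] assms(6,7) h(2) by simp
  with ext show thesis by (rule that)
qed

lemma initialedI:
  assumes "eigenfunction q \<psi> L" "\<And>y. y \<in> V q m \<Longrightarrow> \<psi> y = u y" "spectral_extension q m n x \<psi>"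
  shows "initialed q m u x \<psi> L"
proof -
  \<comment> \<open>the digit of index \<open>0\<close> is the sign at level \<open>m + 1\<close>\<close>
  define \<epsilon> :: "nat \<Rightarrow> real" where "\<epsilon> k = (if gray n (k - m - 1) then 1 else -1)" for k
  define \<mu> where "\<mu> k = decim_seq n x (k - m)" for k
  have "{k. k > m \<and> \<epsilon> k \<noteq> -1} \<subseteq> (\<lambda>j. m + Suc j) ` {j. gray n j}"
  proof
    fix k assume "k \<in> {k. k > m \<and> \<epsilon> k \<noteq> -1}"
    then have "k = m + Suc (k - m - 1)" "gray n (k - m - 1)" by (auto simp: \<epsilon>_def split: if_splits)
    then show "k \<in> (\<lambda>j. m + Suc j) ` {j. gray n j}" by blast
  qed
  then have fin: "finite {k. k > m \<and> \<epsilon> k \<noteq> -1}" using gray_finite finite_surj by blast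
  have \<mu>: "\<mu> k = (5 + \<epsilon> k * sqrt (25 - 4 * \<mu> (k - 1))) / 2" if "k > m" for k
  proof -
    obtain j where "k = Suc (m + j)" using less_imp_Suc_add[OF \<open>k > m\<close>] by blast
    then show ?thesis by (simp add: \<mu>_def \<epsilon>_def decim_def)
  qed
  have ext: "local_extension q k (\<mu> (Suc k)) \<psi>" if "k \<ge> m" for k
    using assms(3)[unfolded spectral_extension_def, rule_format, of "k - m"] that
    by (simp add: \<mu>_def Suc_diff_le del: decim_seq.simps)
  have "(\<forall>k>m. \<epsilon> k \<in> {-1, 1}) \<and> finite {k. k > m \<and> \<epsilon> k \<noteq> -1} \<and> \<mu> m = x \<and>
        (\<forall>k>m. \<mu> k = (5 + \<epsilon> k * sqrt (25 - 4 * \<mu> (k - 1))) / 2) \<and>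
        (\<forall>k\<ge>m. local_extension q k (\<mu> (Suc k)) \<psi>)"
    using fin \<mu> ext by (auto simp: \<epsilon>_def \<mu>_def)
  then show ?thesis unfolding initialed_def using assms(1,2) by blast
qed


section \<open>Existence of all eigenfunctions\<close>

text \<open>For \<open>t \<le> 1/2\<close> both transformation rules of normal derivatives contract uniformly; at \<open>t = 0\<close> the
  factors are \<open>3/5\<close> and \<open>2/5\<close>.\<close>

lemma normal_deriv_subcell_decay:
  assumes "0 < t" "t \<le> 1/2" "x = t * (5 - t)" "\<And>i. \<bar>normal_deriv x f i\<bar> \<le> B"
  shows "\<bar>normal_deriv t (subcell t f a) i\<bar> \<le> 9/10 * B"
proof -
  have B: "B \<ge> 0" using assms(4)[of 0] by simp
  have sq: "0 \<le> t * t" by simp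
  show ?thesis
  proof (cases "a = i")
    case True
    have "10 * (6 - t) \<le> 90 - 63 * t + 0" using assms(2) by simp
    also have "\<dots> \<le> 90 - 63 * t + 9 * (t * t)" using sq by (intro add_left_mono) simp
    also have "\<dots> = 9 * ((5 - t) * (2 - t))" by (simp add: algebra_simps)
    finally have "10 * (6 - t) \<le> 9 * ((5 - t) * (2 - t))" .
    then have c: "0 \<le> corner_factor t" "corner_factor t \<le> 9/10"
      using assms(1,2) by (simp_all add: corner_factor_def pos_divide_le_eq)
    have "normal_deriv t (subcell t f a) i = corner_factor t * normal_deriv x f i"
      unfolding True using assms(1-3) by (intro normal_deriv_subcell_same) auto
    then have "\<bar>normal_deriv t (subcell t f a) i\<bar> = corner_factor t * \<bar>normal_deriv x f i\<bar>"
      using c by (simp add: abs_mult)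
    also have "\<dots> \<le> 9/10 * B" using c assms(4) by (intro mult_mono) auto
    finally show ?thesis .
  next
    case False
    have "x \<le> t * 5" unfolding assms(3) using assms(1) by (intro mult_left_mono) auto
    then have x: "x \<le> 5/2" using assms(2) by linarith
    have c: "0 \<le> mid_factor t" "mid_factor t \<le> 5/4"
      using assms(1,2) by (simp_all add: mid_factor_def divide_simps)
    have "(6 - x) * \<bar>f i - f a\<bar> = \<bar>normal_deriv x f i - normal_deriv x f a\<bar>"
      unfolding normal_deriv_diff using x by (simp add: abs_mult)
    also have "\<dots> \<le> 2 * B" using assms(4)[of i] assms(4)[of a] by linarith
    finally have "(6 - x) * \<bar>f i - f a\<bar> \<le> 2 * B" .
    moreover have "7/2 * \<bar>f i - f a\<bar> \<le> (6 - x) * \<bar>f i - f a\<bar>"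
      using x by (intro mult_right_mono) auto
    ultimately have "7/2 * \<bar>f i - f a\<bar> \<le> 2 * B" by (rule order_trans[rotated])
    then have d: "\<bar>f i - f a\<bar> \<le> 4/7 * B" by simp
    have "normal_deriv t (subcell t f a) i = mid_factor t * (f i - f a)"
      using False assms(1,2) by (intro normal_deriv_subcell_mid) auto
    then have "\<bar>normal_deriv t (subcell t f a) i\<bar> = mid_factor t * \<bar>f i - f a\<bar>"
      using c by (simp add: abs_mult)
    also have "\<dots> \<le> 5/4 * (4/7 * B)" using c d by (intro mult_mono) auto
    also have "\<dots> \<le> 9/10 * B" using B by simp
    finally show ?thesis .
  qed
qed

lemma decim_seq_tendsto_0:
  assumes "0 < x" "x < 6"
  shows "decim_seq n x \<longlonglongrightarrow> 0"
proof -
  have "(\<lambda>k. (1/5) ^ k * (5 ^ k * decim_seq n x k)) \<longlonglongrightarrow> 0 * decim_limit n x"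
    by (intro tendsto_mult decim_limit_tendsto[OF assms] LIMSEQ_power_zero) simp
  then show ?thesis by (simp add: power_one_over)
qed

lemma geometric_increments_limit:
  fixes s :: "nat \<Rightarrow> real"
  assumes "\<And>k. \<bar>s (Suc k) - s k\<bar> \<le> C * (9/10) ^ k"
  shows "\<exists>l. \<forall>k. \<bar>l - s k\<bar> \<le> 10 * C * (9/10) ^ k"
proof -
  define d where "d k = s (Suc k) - s k" for k
  have g: "summable (\<lambda>k. C * (9/10::real) ^ k)" by (intro summable_mult summable_geometric) simp
  have d: "summable d"
    by (rule summable_comparison_test'[OF g, of 0]) (use assms in \<open>simp add: d_def\<close>)
  define l where "l = s 0 + suminf d"
  have "\<bar>l - s k\<bar> \<le> 10 * C * (9/10) ^ k" for k
  proof -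
    have "sum d {..<k} = s k - s 0" unfolding d_def by (rule sum_lessThan_telescope)
    then have "l - s k = (\<Sum>i. d (i + k))"
      using suminf_minus_initial_segment[OF d, of k] by (simp add: l_def)
    also have "\<bar>\<dots>\<bar> \<le> (\<Sum>i. C * (9/10) ^ k * (9/10) ^ i)"
    proof -
      have "summable (\<lambda>i. C * (9/10) ^ k * (9/10::real) ^ i)" by (intro summable_mult summable_geometric) simp
      moreover have "norm (d (i + k)) \<le> C * (9/10) ^ k * (9/10) ^ i" for i
        using assms[of "i + k"] by (simp add: d_def power_add mult_ac)
      ultimately show ?thesis using norm_suminf_le[of "\<lambda>i. d (i + k)"] by fastforce
    qed
    also have "\<dots> = C * (9/10) ^ k * (1 / (1 - 9/10))"
      by (subst suminf_mult) (simp_all add: suminf_geometric summable_geometric)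
    finally show ?thesis by simp
  qed
  then show ?thesis by blast
qed

context
  fixes q :: "3 \<Rightarrow> real^2" and m n :: nat and x :: real and u :: "real^2 \<Rightarrow> real"
  assumes eq: "equilateral q" and x: "0 < x" "x < 6"
begin

text \<open>The values produced by the algorithm, computed cell by cell. That they depend on the vertex only, and
  not on its address, is \<open>extended_values_vertex\<close>.\<close>

primrec extended_values :: "3 list \<Rightarrow> 3 \<Rightarrow> real" where
  "extended_values [] = cell_values q u []"
| "extended_values (a # r) = (if length r < m then cell_values q u (a # r)
     else subcell (decim_seq n x (Suc (length r - m))) (extended_values r) a)"

lemma extended_values_base: "length r \<le> m \<Longrightarrow> extended_values r = cell_values q u r"
  by (cases r) auto

lemma extended_values_Cons_same: "extended_values (i # r) i = extended_values r i"
  using extended_values_base[of r] by (cases "length r < m") (auto simp: subcell_def)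

lemma extended_values_other_address: "extended_values (fst (other_address r i)) (snd (other_address r i)) = extended_values r i"
proof (induction r arbitrary: i)
  case (Cons a r)
  show ?case
  proof (cases "length r < m")
    case True
    then have "length (a # r) \<le> m" "length (fst (other_address (a # r) i)) \<le> m" by (simp_all only: length_other_address) simp_all
    then show ?thesis by (simp only: extended_values_base vertex_other_address)
  next
    case False
    then show ?thesis
      using Cons.IH[of i] by (auto simp: extended_values_Cons_same subcell_def add.commute
          simp del: extended_values.simps(2)) (auto simp: subcell_def add.commute)
  qed
qed simp

lemma extended_values_vertex:
  assumes "vertex q r i = vertex q r' i'" "length r = length r'"
  shows "extended_values r i = extended_values r' i'"
  using assms(1) unfolding vertex_eq_iff[OF eq assms(2)]
proof
  assume "(r', i') = other_address r i"
  then show ?thesis using extended_values_other_address[of r i] by (metis fst_conv snd_conv)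
qed simp

lemma extended_values_pad:
  "extended_values (replicate k i @ r) i = extended_values r i"
  "vertex q (replicate k i @ r) i = vertex q r i"
  by (induction k) (simp_all add: extended_values_Cons_same del: extended_values.simps(2))

text \<open>Differences of corner values are multiples of differences of normal derivatives, so the decay of the
  latter bounds the oscillation.\<close>

lemma extended_values_oscillation:
  obtains K B where "B \<ge> 0"
    "\<And>k r i i'. length r = m + K + k \<Longrightarrow> \<bar>extended_values r i - extended_values r i'\<bar> \<le> B * (9/10) ^ k"
proof -
  have "\<forall>\<^sub>F k in sequentially. decim_seq n x k < 1/2"
    by (rule order_tendstoD(2)[OF decim_seq_tendsto_0[OF x]]) simp
  then obtain K where K: "\<And>k. k \<ge> K \<Longrightarrow> decim_seq n x k \<le> 1/2"
    unfolding eventually_sequentially by (meson less_imp_le)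
  let ?N = "\<lambda>k r i. normal_deriv (decim_seq n x k) (extended_values r) i"
  define B where "B = Max ((\<lambda>(r, i). \<bar>?N K r i\<bar>) ` ({r. length r = m + K} \<times> UNIV))"
  have fin: "finite ((\<lambda>(r, i). \<bar>?N K r i\<bar>) ` ({r. length r = m + K} \<times> UNIV))"
    using finite_words by simp
  have B: "\<bar>?N K r i\<bar> \<le> B" if "length r = m + K" for r i
    unfolding B_def by (rule Max_ge[OF fin]) (use that in force)
  have decay: "length r = m + K + k \<Longrightarrow> \<bar>?N (K + k) r i\<bar> \<le> B * (9/10) ^ k" for k r i
  proof (induction k arbitrary: r i)
    case (Suc k)
    then obtain a s where s: "r = a # s" "length s = m + K + k" by (cases r) auto
    have "\<bar>normal_deriv (decim_seq n x (Suc (K + k))) (subcell (decim_seq n x (Suc (K + k))) (extended_values s) a) i\<bar>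
        \<le> 9/10 * (B * (9/10) ^ k)"
    proof (rule normal_deriv_subcell_decay)
      show "decim_seq n x (Suc (K + k)) \<le> 1/2" by (rule K) simp
      show "0 < decim_seq n x (Suc (K + k))" by (rule decim_seq_bounds[OF x])
      show "decim_seq n x (K + k) = decim_seq n x (Suc (K + k)) * (5 - decim_seq n x (Suc (K + k)))"
        using decim_eq[of "decim_seq n x (K + k)" "gray n (K + k)"] decim_seq_bounds[OF x, of n "K + k"] by simp
    qed (rule Suc.IH[OF s(2)])
    then show ?case using s by (simp del: decim_seq.simps)
  qed (use B in simp)
  show thesis
  proof (rule that[of B K])
    show "B \<ge> 0" using B[of "replicate (m + K) 0" 0] by (simp add: order_trans[OF abs_ge_zero])
    fix k i i' and r :: "3 list" assume r: "length r = m + K + k"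
    let ?f = "extended_values r" and ?y = "decim_seq n x (K + k)"
    have y: "?y \<le> 1/2" by (rule K) simp
    have "(6 - ?y) * \<bar>?f i - ?f i'\<bar> = \<bar>?N (K + k) r i - ?N (K + k) r i'\<bar>"
      unfolding normal_deriv_diff using y by (simp add: abs_mult)
    also have "\<dots> \<le> 2 * (B * (9/10) ^ k)" using decay[OF r, of i] decay[OF r, of i'] by linarith
    finally have "(6 - ?y) * \<bar>?f i - ?f i'\<bar> \<le> 2 * (B * (9/10) ^ k)" .
    moreover have "2 * \<bar>?f i - ?f i'\<bar> \<le> (6 - ?y) * \<bar>?f i - ?f i'\<bar>"
      using y by (intro mult_right_mono) auto
    ultimately have "2 * \<bar>?f i - ?f i'\<bar> \<le> 2 * (B * (9/10) ^ k)" by (rule order_trans[rotated])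
    then show "\<bar>?f i - ?f i'\<bar> \<le> B * (9/10) ^ k" by simp
  qed
qed

text \<open>The value at a point is the limit of the values on smaller and smaller cells that contain it. Two cells
  of one level that share the point share a vertex, so the choice of the cells is immaterial up to twice
  the oscillation. Continuity follows because the finitely many cells of a level that miss a point have
  positive distance from it.\<close>

lemma ex_extension:
  "\<exists>\<phi>. continuous_on (SG q) \<phi> \<and> (\<forall>y\<in>V q m. \<phi> y = u y) \<and> spectral_extension q m n x \<phi>"
proof -
  obtain K B where B: "B \<ge> 0" and osc:
    "\<And>k r i i'. length r = m + K + k \<Longrightarrow> \<bar>extended_values r i - extended_values r i'\<bar> \<le> B * (9/10) ^ k"
    by (rule extended_values_oscillation) blast
  \<comment> \<open>values on two cells of one level that share a point are close, through a common vertex\<close>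
  have near: "\<bar>extended_values r i - extended_values r' i'\<bar> \<le> 2 * B * (9/10) ^ k"
    if c: "y \<in> cell q r" "y \<in> cell q r'" "length r = m + K + k" "length r' = m + K + k" for y r r' i i' k
  proof (cases "r = r'")
    case True
    have "0 \<le> B * (9/10) ^ k" using B by simp
    then show ?thesis using osc[OF c(3), of i i'] True by simp
  next
    case False
    then obtain a b where "y = vertex q r a" "y = vertex q r' b"
      using cells_meet_at_vertices[OF eq c(1,2)] c(3,4) by metis
    then have "extended_values r a = extended_values r' b"
      using c(3,4) by (intro extended_values_vertex) auto
    then show ?thesis using osc[OF c(3), of i a] osc[OF c(4), of b i'] by linarith
  qed
  define w where "w y k = (SOME r. length r = m + K + k \<and> y \<in> cell q r)" for y k
  have w: "length (w y k) = m + K + k" "y \<in> cell q (w y k)" if "y \<in> SG q" for y k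
    using someI_ex[OF ex_cell[OF that, of "m + K + k"]] unfolding w_def by auto
  define s where "s y k = extended_values (w y k) 0" for y k
  \<comment> \<open>from one level to the next: within the new cell, then to the cell chosen before\<close>
  have "\<exists>l. \<forall>k. \<bar>l - s y k\<bar> \<le> 10 * (3 * B) * (9/10) ^ k" if y: "y \<in> SG q" for y
  proof (rule geometric_increments_limit)
    fix k
    obtain a r where r: "w y (Suc k) = a # r" "length r = m + K + k"
      using w(1)[OF y, of "Suc k"] by (cases "w y (Suc k)") auto
    have "y \<in> cell q r" using w(2)[OF y, of "Suc k"] cell_Cons_subset unfolding r by blast
    then have "\<bar>extended_values r a - s y k\<bar> \<le> 2 * B * (9/10) ^ k"
      unfolding s_def using near[OF _ w(2)[OF y] r(2) w(1)[OF y]] by blast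
    moreover have "\<bar>s y (Suc k) - extended_values (a # r) a\<bar> \<le> B * (9/10) ^ Suc k"
      unfolding s_def r(1) by (rule osc) (simp add: r(2))
    moreover have "B * (9/10) ^ Suc k \<le> B * (9/10) ^ k" using B by (simp add: mult_left_mono)
    moreover have "extended_values (a # r) a = extended_values r a" by (rule extended_values_Cons_same)
    ultimately show "\<bar>s y (Suc k) - s y k\<bar> \<le> 3 * B * (9/10) ^ k" by linarith
  qed
  then obtain \<phi> where \<phi>: "\<And>y k. y \<in> SG q \<Longrightarrow> \<bar>\<phi> y - s y k\<bar> \<le> 10 * (3 * B) * (9/10) ^ k" by metis
  have approx: "\<bar>\<phi> y - extended_values r i\<bar> \<le> 32 * B * (9/10) ^ k"
    if "y \<in> cell q r" "length r = m + K + k" for y r i k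
  proof -
    have y: "y \<in> SG q" using that cell_subset_SG by blast
    have "\<bar>s y k - extended_values r i\<bar> \<le> 2 * B * (9/10) ^ k"
      unfolding s_def by (rule near[OF w(2)[OF y] that(1) w(1)[OF y] that(2)])
    then show ?thesis using \<phi>[OF y, of k] by linarith
  qed
  have small: "(\<lambda>k. C * (9/10::real) ^ k) \<longlonglongrightarrow> 0" for C :: real
    using tendsto_mult_left[OF LIMSEQ_power_zero[of "9/10::real"], of C] by simp
  have val: "\<phi> (vertex q r i) = extended_values r i" for r i
  proof -
    have "\<bar>\<phi> (vertex q r i) - extended_values r i\<bar> \<le> 0"
    proof (rule LIMSEQ_le_const[OF small[of "32 * B"]], intro exI[of _ "length r"] allI impI)
      fix k assume "length r \<le> k"
      then have len: "length (replicate (m + K + k - length r) i @ r) = m + K + k" by simp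
      have "vertex q r i \<in> cell q (replicate (m + K + k - length r) i @ r)"
        using vertex_in_cell extended_values_pad(2) by metis
      from approx[OF this len, of i] show "\<bar>\<phi> (vertex q r i) - extended_values r i\<bar> \<le> 32 * B * (9/10) ^ k"
        by (simp only: extended_values_pad(1))
    qed
    then show ?thesis by simp
  qed
  have "continuous_on (SG q) \<phi>"
    unfolding continuous_on_iff
  proof (intro ballI allI impI)
    fix y and e :: real assume y: "y \<in> SG q" and e: "e > 0"
    have "\<forall>\<^sub>F k in sequentially. 64 * B * (9/10) ^ k < e"
      by (rule order_tendstoD(2)[OF small e])
    then obtain k where k: "64 * B * (9/10) ^ k < e" by (auto simp: eventually_sequentially)
    \<comment> \<open>a point off this closed set lies in a cell that contains \<open>y\<close>\<close>
    define F where "F = (\<Union>r\<in>{r. length r = m + K + k \<and> y \<notin> cell q r}. cell q r)"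
    have "closed F" unfolding F_def
      by (intro closed_UN closed_cell ballI finite_subset[OF _ finite_words[of "m + K + k"]]) auto
    moreover have "y \<in> - F" unfolding F_def by blast
    ultimately obtain d where d: "d > 0" "ball y d \<subseteq> - F"
      using open_contains_ball[of "- F"] by (auto simp: open_Compl)
    have "dist (\<phi> z) (\<phi> y) < e" if z: "z \<in> SG q" "dist z y < d" for z
    proof -
      obtain r where r: "length r = m + K + k" "z \<in> cell q r" using ex_cell[OF z(1)] by blast
      have "z \<notin> F" using d z(2) by (auto simp: dist_commute)
      then have "y \<in> cell q r" using r unfolding F_def by blast
      then show ?thesis
        using approx[OF r(2,1), of 0] approx[OF _ r(1), of y 0] k unfolding dist_real_def by linarith
    qed
    then show "\<exists>d>0. \<forall>z\<in>SG q. dist z y < d \<longrightarrow> dist (\<phi> z) (\<phi> y) < e" using d by blast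
  qed
  moreover have "\<phi> y = u y" if y: "y \<in> V q m" for y
  proof -
    obtain r i where "length r = m" "y = vertex q r i" using y unfolding V_eq by blast
    then show ?thesis using val extended_values_base by simp
  qed
  moreover have "spectral_extension q m n x \<phi>"
    unfolding spectral_extension_def local_extension_iff
  proof (intro allI impI)
    fix k and r :: "3 list" and a i :: 3
    assume "length r = m + k"
    then show "\<phi> (vertex q (a # r) i) = subcell (decim_seq n x (Suc k)) (cell_values q \<phi> r) a i"
      unfolding val by (simp del: decim_seq.simps)
  qed
  ultimately show ?thesis by blast
qed

end

text \<open>The graph equations hold exactly at every level, so the renormalised graph Laplacians converge as fast
  as the renormalised eigenvalues, uniformly because \<open>u\<close> is bounded.\<close>

lemma extension_eigenfunction:
  assumes "equilateral q" "graph_equation q m u x" "spectral_extension q m n x u" "0 < x" "x < 6"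
    "continuous_on (SG q) u" "y \<in> SG q" "u y \<noteq> 0"
  shows "eigenfunction q u (3/2 * 5 ^ m * decim_limit n x)"
proof -
  let ?L = "3/2 * 5 ^ m * decim_limit n x"
  have "compact (u ` SG q)" by (rule compact_continuous_image[OF assms(6) compact_SG])
  then obtain C where C: "C > 0" "\<And>y. y \<in> SG q \<Longrightarrow> \<bar>u y\<bar> \<le> C"
    using compact_imp_bounded bounded_pos by (metis imageI real_norm_def)
  have lim: "(\<lambda>k. 3/2 * 5 ^ m * (5 ^ k * decim_seq n x k)) \<longlonglongrightarrow> ?L"
    by (intro tendsto_mult_left decim_limit_tendsto assms)
  have "has_laplacian q u (\<lambda>y. - ?L * u y)"
    unfolding has_laplacian_def
  proof (intro conjI allI impI)
    show "continuous_on (SG q) (\<lambda>y. - ?L * u y)" by (intro continuous_intros assms)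
    fix e :: real assume "e > 0"
    then have "e / C > 0" using C by simp
    then obtain N where N: "\<And>k. k \<ge> N \<Longrightarrow> \<bar>3/2 * 5 ^ m * (5 ^ k * decim_seq n x k) - ?L\<bar> < e / C"
      using LIMSEQ_D[OF lim] by (metis real_norm_def)
    show "\<exists>N. \<forall>k\<ge>N. \<forall>y\<in>Vstar q - V q 0. y \<in> V q k \<longrightarrow>
        \<bar>3/2 * 5 ^ k * graph_laplacian q k u y - - ?L * u y\<bar> < e"
    proof (intro exI[of _ "m + N"] allI impI ballI)
      fix k y assume k: "k \<ge> m + N" and y: "y \<in> Vstar q - V q 0" "y \<in> V q k"
      define j where "j = k - m"
      have j: "k = m + j" "j \<ge> N" using k by (auto simp: j_def)
      have "- graph_laplacian q k u y = decim_seq n x j * u y"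
        using graph_equation_spectral_extension[OF assms(1-5), of j] y unfolding graph_equation_def j by blast
      then have lap: "graph_laplacian q k u y = - (decim_seq n x j * u y)" by simp
      have "3/2 * 5 ^ k * graph_laplacian q k u y - - ?L * u y
         = - ((3/2 * 5 ^ m * (5 ^ j * decim_seq n x j) - ?L) * u y)"
        unfolding lap unfolding j(1) by (simp add: power_add algebra_simps)
      then have "\<bar>3/2 * 5 ^ k * graph_laplacian q k u y - - ?L * u y\<bar>
         = \<bar>3/2 * 5 ^ m * (5 ^ j * decim_seq n x j) - ?L\<bar> * \<bar>u y\<bar>" by (simp only: abs_minus_cancel abs_mult)
      also have "\<dots> \<le> \<bar>3/2 * 5 ^ m * (5 ^ j * decim_seq n x j) - ?L\<bar> * C"
        using C(2)[of y] V_subset_SG y(2) by (intro mult_left_mono) auto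
      also have "\<dots> < e / C * C" using N[OF j(2)] C by (intro mult_strict_right_mono) auto
      finally show "\<bar>3/2 * 5 ^ k * graph_laplacian q k u y - - ?L * u y\<bar> < e" using C by simp
    qed
  qed (rule assms)
  then show ?thesis unfolding eigenfunction_def using assms(7,8) by blast
qed

section \<open>The number of local extrema\<close>

lemma strict_mono_surj_imp_id:
  fixes c :: "nat \<Rightarrow> nat"
  assumes "strict_mono c" "surj c"
  shows "c n = n"
proof (induction n rule: less_induct)
  case (less n)
  obtain k where k: "c k = n" using assms(2) by (metis surjD)
  have "k = n"
  proof (cases k n rule: linorder_cases)
    case less
    then show ?thesis using less.IH[OF less] k by simp
  next
    case greater
    then have "c n < n" using strict_monoD[OF assms(1) greater] k by simp
    then show ?thesis using strict_mono_imp_increasing[OF assms(1), of n] by simp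
  qed simp
  then show ?case using k by simp
qed

lemma local_extrema_on_segment:
  assumes "equilateral q" "i \<noteq> j"
  shows "edge_local_extrema (vertex q r i) (vertex q r j) f
    = edge_point q r i j ` local_extrema01 (\<lambda>s. f (edge_point q r i j s))"
    and "inj (edge_point q r i j)"
proof -
  let ?p = "edge_point q r i j"
  let ?E = "closed_segment (vertex q r i) (vertex q r j)"
  define D where "D = norm (vertex q r j - vertex q r i)"
  have D: "D > 0" unfolding D_def using vertex_inj[OF assms(1), of r j i] assms(2) by simp
  have dist: "dist (?p s) (?p s') = \<bar>s - s'\<bar> * D" for s s'
  proof -
    have "?p s - ?p s' = (s - s') *\<^sub>R (vertex q r j - vertex q r i)"
      by (simp add: edge_point_def algebra_simps)
    then show ?thesis by (simp add: dist_norm D_def)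
  qed
  show inj: "inj ?p"
  proof (rule injI)
    fix s s' assume "?p s = ?p s'"
    then have "\<bar>s - s'\<bar> * D = 0" using dist[of s s'] by simp
    then show "s = s'" using D by simp
  qed
  have interior: "?E - {vertex q r i, vertex q r j} = ?p ` {0<..<1}"
  proof -
    have "{vertex q r i, vertex q r j} = ?p ` {0, 1}" by simp
    moreover have "{0<..<1} = {0..1} - {0, 1::real}" by auto
    ultimately show ?thesis
      unfolding closed_segment_eq_edge_points by (simp only: image_set_diff[OF inj])
  qed
  have ball: "?E \<inter> ball (?p s) (d * D)
      = ?p ` {y. 0 \<le> y \<and> y \<le> 1 \<and> \<bar>y - s\<bar> < d}" for s d
    unfolding closed_segment_eq_edge_points using D
    by (auto simp: dist abs_minus_commute)
  show "edge_local_extrema (vertex q r i) (vertex q r j) f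
    = ?p ` local_extrema01 (\<lambda>s. f (?p s))"
  proof -
    have iff: "(\<exists>d>0. (\<forall>y \<in> ?E \<inter> ball (?p s) d. f y \<le> f (?p s)) \<or>
        (\<forall>y \<in> ?E \<inter> ball (?p s) d. f (?p s) \<le> f y)) \<longleftrightarrow>
      (\<exists>d>0. (\<forall>y. 0 \<le> y \<and> y \<le> 1 \<and> \<bar>y - s\<bar> < d \<longrightarrow> f (?p y) \<le> f (?p s)) \<or>
        (\<forall>y. 0 \<le> y \<and> y \<le> 1 \<and> \<bar>y - s\<bar> < d \<longrightarrow> f (?p s) \<le> f (?p y)))" (is "(\<exists>d>0. ?A d) \<longleftrightarrow> (\<exists>d>0. ?B d)") for s
    proof -
      have "?A (d * D) \<longleftrightarrow> ?B d" for d unfolding ball by auto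
      moreover have "(\<exists>d>0. ?A d) \<longleftrightarrow> (\<exists>d>0. ?A (d * D))"
      proof
        assume "\<exists>d>0. ?A d"
        then obtain d where d: "d > 0" "?A d" by blast
        have "d / D * D = d" using D by simp
        then have "?A (d / D * D)" using d(2) by simp
        moreover have "d / D > 0" using d D by simp
        ultimately show "\<exists>d>0. ?A (d * D)" by blast
      next
        assume "\<exists>d>0. ?A (d * D)"
        then obtain d where d: "d > 0" "?A (d * D)" by blast
        moreover have "d * D > 0" using d D by simp
        ultimately show "\<exists>d>0. ?A d" by blast
      qed
      ultimately show ?thesis by simp
    qed
    have "edge_local_extrema (vertex q r i) (vertex q r j) f
       = {x \<in> ?p ` {0<..<1}. \<exists>d>0. (\<forall>y \<in> ?E \<inter> ball x d. f y \<le> f x) \<or>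
        (\<forall>y \<in> ?E \<inter> ball x d. f x \<le> f y)}"
      unfolding edge_local_extrema_def interior ..
    also have "\<dots> = ?p ` {s \<in> {0<..<1}. \<exists>d>0.
        (\<forall>y \<in> ?E \<inter> ball (?p s) d. f y \<le> f (?p s)) \<or>
        (\<forall>y \<in> ?E \<inter> ball (?p s) d. f (?p s) \<le> f y)}"
      by blast
    also have "\<dots> = ?p ` local_extrema01 (\<lambda>s. f (?p s))"
      unfolding iff local_extrema01_def by (rule arg_cong[of _ _ "image ?p"]) auto
    finally show ?thesis .
  qed
qed

text \<open>With \<open>\<rho>\<close> the ratio and \<open>K = 4 - t\<close>, the product \<open>X Y\<close> is a positive multiple of
  \<open>(K - \<rho>) (\<rho> - 1 / K)\<close>. An infinite ratio corresponds to \<open>a = 0\<close>, where the product is negative.\<close>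

lemma edge_ratio_classification:
  fixes f :: "real^2 \<Rightarrow> real"
  assumes "0 < t" "t < 2" and "f (midpoint p0 p1) - f p0 = a" "f p1 - f (midpoint p0 p1) = c"
    and X: "X = (2 - t) * (c - (4 - t) * a)" and Y: "Y = (2 - t) * (a - (4 - t) * c)"
    and "X \<noteq> 0 \<or> Y \<noteq> 0"
  shows "ereal (1 / (4 - t)) < edge_ratio p0 p1 f \<and> edge_ratio p0 p1 f < ereal (4 - t) \<longleftrightarrow> X * Y > 0"
    and "edge_ratio p0 p1 f = ereal (1 / (4 - t)) \<or> edge_ratio p0 p1 f = ereal (4 - t) \<longleftrightarrow> X * Y = 0"
proof -
  define K where "K = 4 - t"
  have K: "K > 2" using assms(2) by (simp add: K_def)
  have t: "2 - t > 0" using assms(2) by simp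
  have "(ereal (1 / K) < edge_ratio p0 p1 f \<and> edge_ratio p0 p1 f < ereal K \<longleftrightarrow> X * Y > 0) \<and>
    (edge_ratio p0 p1 f = ereal (1 / K) \<or> edge_ratio p0 p1 f = ereal K \<longleftrightarrow> X * Y = 0)"
  proof (cases "a = 0")
    case True
    then have XY: "X * Y = - ((2 - t)\<^sup>2 * K * c\<^sup>2)"
      by (simp add: X Y K_def power2_eq_square algebra_simps)
    have "c \<noteq> 0" using assms(7) True by (auto simp: X Y)
    then have "(2 - t)\<^sup>2 * K * c\<^sup>2 > 0" using K t by simp
    then have "X * Y < 0" unfolding XY by simp
    moreover from this have "X \<noteq> 0" "Y \<noteq> 0" by auto
    moreover have "edge_ratio p0 p1 f = \<infinity>" using assms(3) True by (simp add: edge_ratio_def)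
    ultimately show ?thesis by simp
  next
    case False
    define \<rho> where "\<rho> = c / a"
    have c: "c = \<rho> * a" using False by (simp add: \<rho>_def)
    have r: "edge_ratio p0 p1 f = ereal \<rho>"
      using assms(3,4) False by (auto simp: edge_ratio_def \<rho>_def)
    have XY: "X * Y = ((2 - t)\<^sup>2 * a\<^sup>2 * K) * ((K - \<rho>) * (\<rho> - 1 / K))"
      using K by (simp add: X Y K_def[symmetric] c power2_eq_square field_simps)
    have pos: "(2 - t)\<^sup>2 * a\<^sup>2 * K > 0" using t K False by simp
    have "1 / K < K" using K by (simp add: divide_less_eq) (metis less_1_mult less_trans one_less_numeral_iff semiring_norm(76))
    then have "(K - \<rho>) * (\<rho> - 1 / K) > 0 \<longleftrightarrow> 1 / K < \<rho> \<and> \<rho> < K"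
      by (auto simp: zero_less_mult_iff)
    moreover have "(K - \<rho>) * (\<rho> - 1 / K) = 0 \<longleftrightarrow> \<rho> = 1 / K \<or> \<rho> = K" by auto
    moreover have "0 < w * z \<longleftrightarrow> 0 < z" "w * z = 0 \<longleftrightarrow> z = 0" if "0 < w" for w z :: real
      using that by (auto simp: zero_less_mult_iff)
    then have "X * Y > 0 \<longleftrightarrow> (K - \<rho>) * (\<rho> - 1 / K) > 0" "X * Y = 0 \<longleftrightarrow> (K - \<rho>) * (\<rho> - 1 / K) = 0"
      unfolding XY using pos by blast+
    ultimately show ?thesis unfolding r by simp
  qed
  then show "ereal (1 / (4 - t)) < edge_ratio p0 p1 f \<and> edge_ratio p0 p1 f < ereal (4 - t) \<longleftrightarrow> X * Y > 0"
    and "edge_ratio p0 p1 f = ereal (1 / (4 - t)) \<or> edge_ratio p0 p1 f = ereal (4 - t) \<longleftrightarrow> X * Y = 0"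
    unfolding K_def by auto
qed

text \<open>The normal derivatives at the ends of an edge in terms of the differences over its two halves: here the
  numbers \<open>4 - t\<close> of the theorem appear.\<close>

lemma normal_deriv_edge_differences:
  assumes "x = t * (5 - t)" "t \<noteq> 2" "t \<noteq> 5" "i \<noteq> j"
  shows "normal_deriv x f i = (2 - t) * ((f j - subcell t f i j) - (4 - t) * (subcell t f i j - f i))"
    and "- normal_deriv x f j = (2 - t) * ((subcell t f i j - f i) - (4 - t) * (f j - subcell t f i j))"
proof -
  define s where "s = subcell t f i j"
  have s: "s * ((2 - t) * (5 - t)) = (2 - t) * (f i + f j) + 2 * sum f UNIV"
    using assms by (simp add: s_def subcell_def)
  then have S: "2 * sum f UNIV = s * ((2 - t) * (5 - t)) - (2 - t) * (f i + f j)" by simp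
  show "normal_deriv x f i = (2 - t) * ((f j - subcell t f i j) - (4 - t) * (subcell t f i j - f i))"
    unfolding normal_deriv_def S assms(1) s_def[symmetric] by algebra
  show "- normal_deriv x f j = (2 - t) * ((subcell t f i j - f i) - (4 - t) * (f j - subcell t f i j))"
    unfolding normal_deriv_def S assms(1) s_def[symmetric] by algebra
qed

lemma spectral_extension_cong:
  assumes "spectral_extension q m n x \<phi>" "\<And>y. y \<in> SG q \<Longrightarrow> \<phi> y = \<psi> y"
  shows "spectral_extension q m n x \<psi>"
proof -
  have "\<phi> (vertex q r i) = \<psi> (vertex q r i)" for r i
    using assms(2) vertex_in_V[OF refl] V_subset_SG by blast
  then show ?thesis using assms(1) unfolding spectral_extension_def local_extension_iff by simp
qed

text \<open>Every member of the enumeration has a Gray index, the eigenvalue is a strictly increasing function of the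
  index, and every index occurs. A strictly increasing surjection of the natural numbers is the identity.\<close>

lemma enumeration_is_gray_ordered:
  assumes "equilateral q" "initialed_enumeration q m u x \<psi>" "graph_equation q m u x" "0 < x" "x < 6"
    "y \<in> V q m" "u y \<noteq> 0"
  shows "spectral_extension q m n x (\<psi> n)"
proof -
  obtain L where L: "strict_mono L" "\<And>n. initialed q m u x (\<psi> n) (L n)"
    and all: "\<And>\<phi> L. initialed q m u x \<phi> L \<Longrightarrow> \<exists>n. \<forall>y\<in>SG q. \<phi> y = \<psi> n y"
    using assms(2) unfolding initialed_enumeration_def by blast
  have "\<exists>k. spectral_extension q m k x (\<psi> n) \<and> L n = 3/2 * 5 ^ m * decim_limit k x" for n
    using initialed_imp_gray_index[OF assms(1) L(2) assms(3-7)] by metis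
  then obtain c where c: "\<And>n. spectral_extension q m (c n) x (\<psi> n)" "\<And>n. L n = 3/2 * 5 ^ m * decim_limit (c n) x"
    by metis
  note decim_limit = strict_mono_decim_limit[OF assms(4,5)]
  have agree: "\<psi> n y = u y" if "y \<in> V q m" for n y using L(2)[of n] that unfolding initialed_def by blast
  have "strict_mono c"
  proof (rule strict_monoI)
    fix a b :: nat assume "a < b"
    then have "L a < L b" using L(1) by (rule strict_monoD[rotated])
    then have "decim_limit (c a) x < decim_limit (c b) x" unfolding c(2) by simp
    then show "c a < c b" using strict_mono_less[OF decim_limit] by simp
  qed
  moreover have "surj c"
  proof (rule surjI[of _ "\<lambda>k. SOME n. c n = k"])
    fix k
    \<comment> \<open>realise the sequence \<open>k\<close>, and find the result in the enumeration\<close>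
    obtain \<phi> where \<phi>: "continuous_on (SG q) \<phi>" "\<forall>y\<in>V q m. \<phi> y = u y" "spectral_extension q m k x \<phi>"
      using ex_extension[OF assms(1,4,5)] by blast
    have "graph_equation q m \<phi> x" using graph_equation_cong[OF assms(1), of m \<phi> u x] \<phi>(2) assms(3) by blast
    moreover have "y \<in> SG q" "\<phi> y \<noteq> 0" using assms(6,7) \<phi>(2) V_subset_SG by auto
    ultimately have ef: "eigenfunction q \<phi> (3/2 * 5 ^ m * decim_limit k x)"
      using extension_eigenfunction[OF assms(1) _ \<phi>(3) assms(4,5) \<phi>(1)] by blast
    have "initialed q m u x \<phi> (3/2 * 5 ^ m * decim_limit k x)"
      using \<phi>(2) by (intro initialedI[OF ef _ \<phi>(3)]) blast
    then obtain n where n: "\<forall>y\<in>SG q. \<phi> y = \<psi> n y" using all by blast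
    have "eigenfunction q (\<psi> n) (L n)" using L(2)[of n] unfolding initialed_def by blast
    moreover have "graph_equation q m (\<psi> n) x"
      using graph_equation_cong[OF assms(1), of m "\<psi> n" u x] agree assms(3) by blast
    moreover have "\<psi> n y \<noteq> 0" using agree assms(6,7) by simp
    moreover have "spectral_extension q m k x (\<psi> n)"
      by (rule spectral_extension_cong[OF \<phi>(3)]) (use n in blast)
    ultimately have "L n = 3/2 * 5 ^ m * decim_limit k x"
      using eigenvalue_eq_decim_limit[OF assms(1) _ _ _ assms(4,5,6)] by blast
    then have "decim_limit (c n) x = decim_limit k x" unfolding c(2) by simp
    then have "c n = k" using strict_mono_eq[OF decim_limit] by simp
    then show "c (SOME n. c n = k) = k" by (rule someI)
  qed
  ultimately have "c n = n" by (rule strict_mono_surj_imp_id)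
  then show ?thesis using c(1)[of n] by simp
qed

text \<open>Since \<open>5\<^sup>k \<lambda>\<^sub>k\<close> converges, \<open>\<lambda>\<^sub>k\<close> tends to \<open>0\<close>, so the upper branch, which takes values above \<open>5/2\<close>, is chosen
  only finitely often and the choices form a Gray sequence.\<close>

lemma eigenfunction_spectral_extension:
  assumes "equilateral q" "graph_eigenvalues q b u L m0 l" "m \<ge> m0"
    and range: "\<And>k. k \<ge> m \<Longrightarrow> 0 < l k \<and> l k < 6"
  obtains n where "spectral_extension q m n (l m) u"
proof -
  have ef: "graph_eigenfunction q b k u (l k)" and rec: "l (Suc k) * (5 - l (Suc k)) = l k" if "k \<ge> m" for k
    using assms(2) that assms(3) unfolding graph_eigenvalues_def by (metis order_trans)+
  have step: "l (Suc k) = decim (l (Suc k) > 5/2) (l k)" if "k \<ge> m" for k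
    by (rule decim_root[OF rec[OF that]])
  have "(\<lambda>k. 3/2 * 5 ^ k * l k) \<longlonglongrightarrow> L" using assms(2) unfolding graph_eigenvalues_def by blast
  then have "(\<lambda>k. (1/5) ^ k * (3/2 * 5 ^ k * l k)) \<longlonglongrightarrow> 0 * L"
    by (intro tendsto_mult LIMSEQ_power_zero) simp
  then have "(\<lambda>k. 3/2 * l k) \<longlonglongrightarrow> 0" by (simp add: power_one_over)
  then have "\<forall>\<^sub>F k in sequentially. 3/2 * l k < 1" by (rule order_tendstoD) simp
  then obtain K where K: "\<And>k. k \<ge> K \<Longrightarrow> l k < 5/2" unfolding eventually_sequentially by fastforce
  have "\<exists>n. \<forall>j. gray n j = (l (m + Suc j) > 5/2)"
  proof (rule gray_surj[of K])
    fix j assume "j \<ge> K"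
    then show "\<not> l (m + Suc j) > 5/2" using K[of "m + Suc j"] by simp
  qed
  then obtain n where n: "\<And>j. gray n j = (l (m + Suc j) > 5/2)" by blast
  have seq: "l (m + j) = decim_seq n (l m) j" for j
  proof (induction j)
    case (Suc j)
    then show ?case using step[of "m + j"] n[of j] by simp
  qed simp
  have "spectral_extension q m n (l m) u"
    unfolding spectral_extension_def
  proof
    fix k
    have r: "0 < l (m + k)" "l (m + k) < 6" using range[of "m + k"] by simp_all
    have "l (Suc (m + k)) \<noteq> 2" "l (Suc (m + k)) < 5"
      using decim_bounds[OF r, of "l (Suc (m + k)) > 5/2"] step[of "m + k"] by simp_all
    then have "local_extension q (m + k) (l (Suc (m + k))) u"
      using graph_eigenfunction_equation[OF ef[of "Suc (m + k)"]]
      by (intro graph_equation_imp_local_extension[OF assms(1)]) auto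
    then show "local_extension q (m + k) (decim_seq n (l m) (Suc k)) u"
      using seq[of "Suc k"] by simp
  qed
  then show thesis by (rule that)
qed

theorem theorem1p4:
  fixes q :: "3 \<Rightarrow> real^2"
    and b :: boundary_condition
    and u :: "real^2 \<Rightarrow> real"
    and L :: real
    and m0 m n :: nat
    and l :: "nat \<Rightarrow> real"
    and p0 p1 :: "real^2"
    and \<psi> :: "nat \<Rightarrow> real^2 \<Rightarrow> real"
    and l0 :: real
  assumes "equilateral q"
    and "eigenfunction q u L" and "satisfies_bc q b u"
    and "level_of_birth q b u L m0" and "graph_eigenvalues q b u L m0 l"
    and "m \<ge> m0" and "l m0 = 6 \<longrightarrow> m > m0"
    and "adj q m p0 p1"
    and "\<not> u constant_on closed_segment p0 p1"
    and "initialed_enumeration q m u (l m) \<psi>"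
    and "l0 = (5 - sqrt (25 - 4 * l m)) / 2"
  shows "finite (edge_local_extrema p0 p1 (\<psi> n)) \<and>
    card (edge_local_extrema p0 p1 (\<psi> n)) =
      (if ereal (1 / (4 - l0)) < edge_ratio p0 p1 (\<psi> 0)
            \<and> edge_ratio p0 p1 (\<psi> 0) < ereal (4 - l0)
       then 2 * ((n + 1) div 2)
       else if edge_ratio p0 p1 (\<psi> 0) = ereal (1 / (4 - l0))
            \<or> edge_ratio p0 p1 (\<psi> 0) = ereal (4 - l0)
       then n
       else 2 * (n div 2) + 1)"
proof -
  obtain r i j where r: "length r = m" "i \<noteq> j" "p0 = vertex q r i" "p1 = vertex q r j"
    using assms(8) unfolding adj_iff[OF assms(1)] by blast
  have cont: "continuous_on (SG q) u" using assms(2) unfolding eigenfunction_def has_laplacian_def by blast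
  have "closed_segment p0 p1 \<subseteq> SG q"
    unfolding r(3,4) closed_segment_eq_edge_points using edge_point_in_SG by auto
  then have nonconst: "\<not> u constant_on SG q" using assms(9) constant_on_subset by blast
  have range: "0 < l k \<and> l k < 6" if "k \<ge> m" for k
    using eigenvalue_in_range[OF assms(1,5) _ _ cont nonconst, of k] assms(6,7) that by auto
  define x where "x = l m"
  have x: "0 < x" "x < 6" using range[of m] by (simp_all add: x_def)
  have ef: "graph_eigenfunction q b m u x" using assms(5,6) unfolding graph_eigenvalues_def x_def by blast
  then obtain y where y: "y \<in> V q m" "u y \<noteq> 0" unfolding graph_eigenfunction_def by blast
  note G = graph_eigenfunction_equation[OF ef]
  have ext: "spectral_extension q m n x (\<psi> n)" for n
    using enumeration_is_gray_ordered[OF assms(1) _ G x y] assms(10) by (simp add: x_def)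
  have init: "\<exists>L. initialed q m u x (\<psi> n) L" for n
    using assms(10) unfolding initialed_enumeration_def x_def by blast
  have agree: "\<psi> n z = u z" if "z \<in> V q m" for n z
    using init[of n] that unfolding initialed_def by blast
  have cont_\<psi>: "continuous_on (SG q) (\<psi> n)" for n
    using init[of n] unfolding initialed_def eigenfunction_def has_laplacian_def by blast
  define X Y where "X = normal_deriv x (cell_values q u r) i" and "Y = - normal_deriv x (cell_values q u r) j"
  have vals: "cell_values q (\<psi> n) r = cell_values q u r" for n
    using agree vertex_in_V[OF r(1)] by blast
  have profile: "edge_profile n x X Y (\<lambda>s. \<psi> n (edge_point q r i j s))" for n
    using edge_profile_of_extension[OF ext r(1,2) x] unfolding vals X_def Y_def .
  have XY: "X \<noteq> 0 \<or> Y \<noteq> 0"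
  proof (rule ccontr)
    assume zero: "\<not> (X \<noteq> 0 \<or> Y \<noteq> 0)"
    \<comment> \<open>\<open>u\<close> itself is one of the extensions, and zero end values would make it constant on the edge\<close>
    obtain k where k: "spectral_extension q m k x u"
      using eigenfunction_spectral_extension[OF assms(1,5,6) range] unfolding x_def by blast
    have "edge_profile k x X Y (\<lambda>s. u (edge_point q r i j s))"
      using edge_profile_of_extension[OF k r(1,2) x] unfolding X_def Y_def .
    then have "edge_profile k x 0 0 (\<lambda>s. u (edge_point q r i j s))" using zero by simp
    then have "u (edge_point q r i j s) = u (edge_point q r i j 0)" if "s \<in> {0..1}" for s
      using edge_profile_const[OF _ x continuous_on_edge[OF cont] that] by blast
    then show False
      using assms(9) unfolding r(3,4) closed_segment_eq_edge_points constant_on_def by blast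
  qed
  have count: "finite (local_extrema01 (\<lambda>s. \<psi> n (edge_point q r i j s))) \<and>
      card (local_extrema01 (\<lambda>s. \<psi> n (edge_point q r i j s))) = extrema_count n X Y"
    by (rule card_local_extrema01[OF profile x XY continuous_on_edge[OF cont_\<psi>]])
  have edge: "finite (edge_local_extrema p0 p1 (\<psi> n))"
    "card (edge_local_extrema p0 p1 (\<psi> n)) = extrema_count n X Y"
    using count card_image[OF inj_on_subset[OF local_extrema_on_segment(2)[OF assms(1) r(2)] subset_UNIV]]
    unfolding r(3,4) local_extrema_on_segment(1)[OF assms(1) r(2)] by auto
  have l0: "l0 = decim False x" using assms(11) by (simp add: decim_def x_def)
  have l0_bounds: "0 < l0" "l0 < 2" unfolding l0 by (rule decim_False_bounds[OF x])+
  have l0_eq: "x = l0 * (5 - l0)" unfolding l0 using decim_eq[of x False] x by simp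
  have "local_extension q m l0 (\<psi> 0)"
    using ext[of 0, unfolded spectral_extension_def, rule_format, of 0] by (simp add: l0)
  then have mid: "\<psi> 0 (midpoint p0 p1) = subcell l0 (cell_values q u r) i j"
    using r(1) unfolding local_extension_iff r(3,4) vertex_Cons[symmetric] by (simp add: vals)
  have ends: "\<psi> 0 p0 = u (vertex q r i)" "\<psi> 0 p1 = u (vertex q r j)"
    unfolding r(3,4) by (simp_all add: agree vertex_in_V[OF r(1)])
  note ratio = edge_ratio_classification[OF l0_bounds refl refl _ _ XY, where f = "\<psi> 0" and ?p0.0 = p0 and ?p1.0 = p1]
  have diffs: "X = (2 - l0) * ((\<psi> 0 p1 - \<psi> 0 (midpoint p0 p1)) - (4 - l0) * (\<psi> 0 (midpoint p0 p1) - \<psi> 0 p0))"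
    "Y = (2 - l0) * ((\<psi> 0 (midpoint p0 p1) - \<psi> 0 p0) - (4 - l0) * (\<psi> 0 p1 - \<psi> 0 (midpoint p0 p1)))"
    unfolding X_def Y_def mid ends using l0_bounds
    by (intro normal_deriv_edge_differences[OF l0_eq _ _ r(2)]; simp)+
  show ?thesis
    using edge ratio[OF diffs] unfolding extrema_count_def by simp
qed

end
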